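(* Let $\Bbbk$ be an algebraically closed field, $d\geq1$, $\ell\geq 1$ and $\mathbf Q=(Q_1,\dots,Q_\ell)\in\Bbbk^\ell$. The homology of the DG-algebra $(\bar{\mathcal H}_d,\partial_{\mathbf Q})$ is concentrated in degree $0$ and is isomorphic to the degenerate cyclotomic Hecke algebra $\bar H_d^{\mathbf Q}$.
   Context: $\bar H_d$ (degenerate affine Hecke algebra) is the $\Bbbk$-algebra generated by $T_1,\dots,T_{d-1}$, $X_1,\dots,X_d$ with relations $T_i^2=1$; $T_iT_j=T_jT_i$ if $|i-j|>1$; $T_iT_{i+1}T_i=T_{i+1}T_iT_{i+1}$; $X_iX_j=X_jX_i$; $T_iX_i-X_{i+1}T_i=-1$; $T_iX_j=X_jT_i$ if $j-i\neq0,1$. The degenerate cyclotomic Hecke algebra $\bar H_d^{\mathbf Q}$ is the quotient of $\bar H_d$ by the two-sided ideal generated by $\prod_{r=1}^\ell(X_1-Q_r)$. $\bar{\mathcal H}_d$ is the $\Bbbk$-algebra generated by $T_1,\dots,T_{d-1}$, $X_1,\dots,X_d$ (in degree $\lambda=0$) and $\theta$ (in degree $\lambda=1$) with the relations $T_i^2=1$; $T_iT_j=T_jT_i$ if $|i-j|>1$; $T_iT_{i+1}T_i=T_{i+1}T_iT_{i+1}$; $X_iX_j=X_jX_i$; $T_iX_i-X_{i+1}T_i=-1$; $T_iX_j=X_jT_i$ if $j-i\neq0,1$; together with $\theta^2=0$; $X_r\theta=\theta X_r$ for all $r$; $T_r\theta=\theta T_r$ for $r>1$; $T_1\theta T_1\theta+\theta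 T_1\theta T_1=0$. The differential $\partial_{\mathbf Q}$ is the linear operator on $\bar{\mathcal H}_d$ that is zero on $\bar H_d$ (the subalgebra generated by the $T_i$ and $X_r$), with $\partial_{\mathbf Q}(\theta)=\prod_{r=1}^\ell(X_1-Q_r)$ and $\partial_{\mathbf Q}(ab)=\partial_{\mathbf Q}(a)b+(-1)^{\lambda(a)}a\,\partial_{\mathbf Q}(b)$ for $a$ homogeneous. The homological degree is $\lambda$ (so $\partial_{\mathbf Q}$ lowers the degree by $1$). *)

theory Defs
  imports "HOL-Computational_Algebra.Polynomial" "HOL-Algebra.QuotRing" "HOL-Algebra.Subrings" "HOL-Algebra.Module"
begin

section \<open>Algebras over a field by generators and relations\<close>

text \<open>
  Scalars form a type \<^typ>\<open>'k\<close> of class \<^class>\<open>field\<close>. An associative unital algebra over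
  \<^typ>\<open>'k\<close>, commutative or not, is given by the operations of a \<^type>\<open>module_ext\<close> record
  (a ring record extended by a scalar multiplication); the library locale \<open>algebra\<close>
  is reserved for commutative algebras and is not used.
\<close>

text \<open>Noncommutative polynomials: finitely supported functions on words over \<open>G\<close>, with the
  convolution product coming from concatenation of words.\<close>

definition free_alg :: "'g set \<Rightarrow> ('k::field, 'g list \<Rightarrow> 'k) module" where
  "free_alg G =
    \<lparr>carrier = {f. finite {w. f w \<noteq> 0} \<and> {w. f w \<noteq> 0} \<subseteq> lists G},
     mult = (\<lambda>f g w. \<Sum>i\<le>length w. f (take i w) * g (drop i w)),
     one = (\<lambda>w. if w = [] then 1 else 0),
     ring.zero = (\<lambda>w. 0),
     add = (\<lambda>f g w. f w + g w),
     smult = (\<lambda>c f w. c * f w)\<rparr>"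

definition free_gen :: "'g \<Rightarrow> 'g list \<Rightarrow> 'k::field" where
  "free_gen v = (\<lambda>w. if w = [v] then 1 else 0)"

text \<open>The library quotient \<open>A Quot I\<close> of the underlying ring, with the induced scalar
  multiplication of cosets.\<close>

definition alg_quot :: "('k, 'a) module \<Rightarrow> 'a set \<Rightarrow> ('k, 'a set) module" where
  "alg_quot A I =
    ring.extend (A Quot I) (module.fields (\<lambda>c C. \<Union>x\<in>C. I +>\<^bsub>A\<^esub> (c \<odot>\<^bsub>A\<^esub> x)))"

text \<open>A relation \<open>(u, v)\<close> stands for \<open>u = v\<close>; \<open>Idl\<close> is the two-sided ideal generated by a set.\<close>

definition rel_ideal :: "('k, 'a) module \<Rightarrow> ('a \<times> 'a) set \<Rightarrow> 'a set" where
  "rel_ideal A R = Idl\<^bsub>A\<^esub> {u \<ominus>\<^bsub>A\<^esub> v | u v. (u, v) \<in> R}"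

definition subalg_generated :: "('k, 'a) module \<Rightarrow> 'a set \<Rightarrow> 'a set" where
  "subalg_generated A S =
    \<Inter>{B. subring B A \<and> (\<forall>c. \<forall>x\<in>B. c \<odot>\<^bsub>A\<^esub> x \<in> B) \<and> S \<subseteq> B}"

definition alg_iso :: "('k, 'a) module \<Rightarrow> ('k, 'b) module \<Rightarrow> ('a \<Rightarrow> 'b) set" where
  "alg_iso A B =
    {h \<in> ring_iso A B. \<forall>c. \<forall>x\<in>carrier A. h (c \<odot>\<^bsub>A\<^esub> x) = c \<odot>\<^bsub>B\<^esub> h x}"

lemma free_alg_mult_closed:
  assumes "f \<in> carrier (free_alg G)" "g \<in> carrier (free_alg G)"
  shows "f \<otimes>\<^bsub>free_alg G\<^esub> g \<in> carrier (free_alg G)"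
proof -
  let ?h = "f \<otimes>\<^bsub>free_alg G\<^esub> g"
  let ?S = "(\<lambda>(u, v). u @ v) ` ({w. f w \<noteq> 0} \<times> {w. g w \<noteq> 0})"
  have "{w. ?h w \<noteq> 0} \<subseteq> ?S"
  proof
    fix w assume "w \<in> {w. ?h w \<noteq> 0}"
    then obtain i where "f (take i w) * g (drop i w) \<noteq> 0"
      unfolding free_alg_def by (auto elim: sum.not_neutral_contains_not_neutral)
    then show "w \<in> ?S" by (intro image_eqI[of _ _ "(take i w, drop i w)"]) auto
  qed
  moreover have "finite ?S" "?S \<subseteq> lists G"
    using assms unfolding free_alg_def by (simp, fastforce)
  ultimately show ?thesis
    by (auto simp: free_alg_def intro: finite_subset)
qed

lemma free_alg_mult_assoc:
  "f \<otimes>\<^bsub>free_alg G\<^esub> g \<otimes>\<^bsub>free_alg G\<^esub> h = f \<otimes>\<^bsub>free_alg G\<^esub> (g \<otimes>\<^bsub>free_alg G\<^esub> h)"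
proof
  fix w :: "'a list"
  define n where "n = length w"
  have "(f \<otimes>\<^bsub>free_alg G\<^esub> g \<otimes>\<^bsub>free_alg G\<^esub> h) w =
      (\<Sum>i\<le>n. \<Sum>j\<le>i. f (take j w) * g (drop j (take i w)) * h (drop i w))"
    by (auto simp: free_alg_def n_def sum_distrib_right min_def intro!: sum.cong)
  also have "\<dots> = (\<Sum>j\<le>n. \<Sum>i=j..n. f (take j w) * g (drop j (take i w)) * h (drop i w))"
    unfolding sum.Sigma[OF finite_atMost ballI[OF finite_atMost]] 
      sum.Sigma[OF finite_atMost ballI[OF finite_atLeastAtMost]]
    by (rule sum.reindex_bij_witness[of _ prod.swap prod.swap]) auto
  also have "\<dots> = (\<Sum>j\<le>n. \<Sum>k\<le>n - j. f (take j w) * g (take k (drop j w)) * h (drop k (drop j w)))"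
  proof (rule sum.cong[OF refl])
    fix j assume "j \<in> {..n}"
    then show "(\<Sum>i=j..n. f (take j w) * g (drop j (take i w)) * h (drop i w)) =
      (\<Sum>k\<le>n - j. f (take j w) * g (take k (drop j w)) * h (drop k (drop j w)))"
      by (intro sum.reindex_bij_witness[of _ "\<lambda>k. k + j" "\<lambda>i. i - j"])
        (auto simp: drop_take)
  qed
  also have "\<dots> = (f \<otimes>\<^bsub>free_alg G\<^esub> (g \<otimes>\<^bsub>free_alg G\<^esub> h)) w"
    by (simp add: free_alg_def n_def sum_distrib_left mult.assoc)
  finally show "(f \<otimes>\<^bsub>free_alg G\<^esub> g \<otimes>\<^bsub>free_alg G\<^esub> h) w = (f \<otimes>\<^bsub>free_alg G\<^esub> (g \<otimes>\<^bsub>free_alg G\<^esub> h)) w" .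
qed

lemma ring_free_alg: "ring (free_alg G :: ('k::field, _) module)"
proof (rule ringI)
  let ?F = "free_alg G :: ('k, _) module"
  show "abelian_group ?F"
  proof (rule abelian_groupI)
    show "x \<oplus>\<^bsub>?F\<^esub> y \<in> carrier ?F" if "x \<in> carrier ?F" "y \<in> carrier ?F" for x y
    proof -
      have "{w. x w + y w \<noteq> 0} \<subseteq> {w. x w \<noteq> 0} \<union> {w. y w \<noteq> 0}" by auto
      then show ?thesis using that
        by (auto simp: free_alg_def intro: finite_subset)
    qed
    show "\<exists>y\<in>carrier ?F. y \<oplus>\<^bsub>?F\<^esub> x = \<zero>\<^bsub>?F\<^esub>" if "x \<in> carrier ?F" for x
      using that by (intro bexI[of _ "\<lambda>w. - x w"]) (auto simp: free_alg_def)
  qed (auto simp: free_alg_def algebra_simps)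
  show "Group.monoid ?F"
  proof (rule monoidI)
    fix x y z assume x: "x \<in> carrier ?F" "y \<in> carrier ?F" "z \<in> carrier ?F"
    show "x \<otimes>\<^bsub>?F\<^esub> y \<in> carrier ?F" using x by (intro free_alg_mult_closed)
    show "x \<otimes>\<^bsub>?F\<^esub> y \<otimes>\<^bsub>?F\<^esub> z = x \<otimes>\<^bsub>?F\<^esub> (y \<otimes>\<^bsub>?F\<^esub> z)" by (rule free_alg_mult_assoc)
  next
    show "\<one>\<^bsub>?F\<^esub> \<in> carrier ?F" by (auto simp: free_alg_def)
  next
    fix x assume "x \<in> carrier ?F"
    show "\<one>\<^bsub>?F\<^esub> \<otimes>\<^bsub>?F\<^esub> x = x"
    proof
      fix w
      have "(\<one>\<^bsub>?F\<^esub> \<otimes>\<^bsub>?F\<^esub> x) w = (\<Sum>i\<le>length w. if i = 0 then x w else 0)"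
        unfolding free_alg_def monoid.simps by (intro sum.cong) auto
      then show "(\<one>\<^bsub>?F\<^esub> \<otimes>\<^bsub>?F\<^esub> x) w = x w" by simp
    qed
    show "x \<otimes>\<^bsub>?F\<^esub> \<one>\<^bsub>?F\<^esub> = x"
    proof
      fix w
      have "(x \<otimes>\<^bsub>?F\<^esub> \<one>\<^bsub>?F\<^esub>) w = (\<Sum>i\<le>length w. if i = length w then x w else 0)"
        unfolding free_alg_def monoid.simps by (intro sum.cong) auto
      then show "(x \<otimes>\<^bsub>?F\<^esub> \<one>\<^bsub>?F\<^esub>) w = x w" by simp
    qed
  qed
qed (auto simp: free_alg_def sum.distrib algebra_simps)

lemma alg_quot_simps:
  "carrier (alg_quot A I) = carrier (A Quot I)"
  "mult (alg_quot A I) = mult (A Quot I)"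
  "one (alg_quot A I) = one (A Quot I)"
  "ring.zero (alg_quot A I) = ring.zero (A Quot I)"
  "add (alg_quot A I) = add (A Quot I)"
  "c \<odot>\<^bsub>alg_quot A I\<^esub> C = (\<Union>x\<in>C. I +>\<^bsub>A\<^esub> (c \<odot>\<^bsub>A\<^esub> x))"
  by (simp_all add: alg_quot_def FactRing_def ring.defs module.defs)

lemma ring_alg_quot:
  assumes "ideal I A"
  shows "ring (alg_quot A I)"
proof -
  interpret q: ring "A Quot I" by (rule ideal.quotient_is_ring[OF assms])
  show ?thesis
  proof (rule ringI)
    show "abelian_group (alg_quot A I)"
      by (rule abelian_groupI)
        (auto simp add: alg_quot_simps q.add.m_assoc simp del: Union_iff
          intro: q.add.m_comm[THEN equalityD1, THEN subsetD] q.l_neg q.a_inv_closed)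
    show "Group.monoid (alg_quot A I)"
      by (rule monoidI) (auto simp: alg_quot_simps q.m_assoc)
  qed (auto simp: alg_quot_simps q.l_distr q.r_distr)
qed

lemma ideal_rel_ideal:
  assumes "ring A" "\<And>u v. (u, v) \<in> R \<Longrightarrow> u \<in> carrier A \<and> v \<in> carrier A"
  shows "ideal (rel_ideal A R) A"
proof -
  interpret ring A by fact
  show ?thesis unfolding rel_ideal_def
    by (rule genideal_ideal) (auto dest: assms(2))
qed

section \<open>Homology of a DG-algebra\<close>

text \<open>
  Here \<open>\<delta>\<close> is the differential of \<open>A\<close> and \<open>C n\<close> the homogeneous part of \<open>A\<close> of degree \<open>n\<close>.
  The homology is the algebra \<open>ker \<delta> / im \<delta>\<close>; its part of degree \<open>n\<close> consists of the classes of
  the cycles in \<open>C n\<close>.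
\<close>

definition homology_alg :: "('k, 'a) module \<Rightarrow> ('a \<Rightarrow> 'a) \<Rightarrow> ('k, 'a set) module" where
  "homology_alg A \<delta> =
    alg_quot (A\<lparr>carrier := {x \<in> carrier A. \<delta> x = \<zero>\<^bsub>A\<^esub>}\<rparr>) (\<delta> ` carrier A)"

definition homology_part ::
  "('k, 'a) module \<Rightarrow> ('a \<Rightarrow> 'a) \<Rightarrow> (nat \<Rightarrow> 'a set) \<Rightarrow> nat \<Rightarrow> 'a set set" where
  "homology_part A \<delta> C n =
    {(\<delta> ` carrier A) +>\<^bsub>A\<^esub> x | x. x \<in> C n \<and> \<delta> x = \<zero>\<^bsub>A\<^esub>}"

section \<open>Degenerate affine and cyclotomic Hecke algebras\<close>

datatype hgen = GenT nat | GenX nat | GenTheta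

definition hecke_gens :: "nat \<Rightarrow> hgen set" where
  "hecke_gens d = GenT ` {1..<d} \<union> GenX ` {1..d}"

definition hecke_rels ::
  "nat \<Rightarrow> ('k::field, hgen list \<Rightarrow> 'k) module \<Rightarrow>
    ((hgen list \<Rightarrow> 'k) \<times> (hgen list \<Rightarrow> 'k)) set" where
  "hecke_rels d F =
    (let t = (\<lambda>i. free_gen (GenT i)); x = (\<lambda>i. free_gen (GenX i)) in
      {(t i \<otimes>\<^bsub>F\<^esub> t i, \<one>\<^bsub>F\<^esub>) | i. i \<in> {1..<d}} \<union>
      {(t i \<otimes>\<^bsub>F\<^esub> t j, t j \<otimes>\<^bsub>F\<^esub> t i) | i j.
          i \<in> {1..<d} \<and> j \<in> {1..<d} \<and> \<bar>int i - int j\<bar> > 1} \<union>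
      {(t i \<otimes>\<^bsub>F\<^esub> t (i + 1) \<otimes>\<^bsub>F\<^esub> t i, t (i + 1) \<otimes>\<^bsub>F\<^esub> t i \<otimes>\<^bsub>F\<^esub> t (i + 1)) | i.
          i \<in> {1..<d} \<and> i + 1 \<in> {1..<d}} \<union>
      {(x i \<otimes>\<^bsub>F\<^esub> x j, x j \<otimes>\<^bsub>F\<^esub> x i) | i j. i \<in> {1..d} \<and> j \<in> {1..d}} \<union>
      {((t i \<otimes>\<^bsub>F\<^esub> x i) \<ominus>\<^bsub>F\<^esub> (x (i + 1) \<otimes>\<^bsub>F\<^esub> t i), \<ominus>\<^bsub>F\<^esub> \<one>\<^bsub>F\<^esub>) | i. i \<in> {1..<d}} \<union>
      {(t i \<otimes>\<^bsub>F\<^esub> x j, x j \<otimes>\<^bsub>F\<^esub> t i) | i j.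
          i \<in> {1..<d} \<and> j \<in> {1..d} \<and> int j - int i \<noteq> 0 \<and> int j - int i \<noteq> 1})"

definition affine_ideal :: "nat \<Rightarrow> (hgen list \<Rightarrow> 'k::field) set" where
  "affine_ideal d =
    (let F = free_alg (hecke_gens d) in rel_ideal F (hecke_rels d F))"

definition affine_hecke :: "nat \<Rightarrow> ('k::field, (hgen list \<Rightarrow> 'k) set) module" where
  "affine_hecke d = alg_quot (free_alg (hecke_gens d)) (affine_ideal d)"

definition affine_gen :: "nat \<Rightarrow> hgen \<Rightarrow> (hgen list \<Rightarrow> 'k::field) set" where
  "affine_gen d v = affine_ideal d +>\<^bsub>free_alg (hecke_gens d) :: ('k, _) module\<^esub> free_gen v"

text \<open>\<open>cyclotomic_prod A x l Q\<close> is the product of the \<open>x - Q r\<close> for \<open>r = 1, \<dots>, l\<close>.\<close>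

definition cyclotomic_prod :: "('k, 'a) module \<Rightarrow> 'a \<Rightarrow> nat \<Rightarrow> (nat \<Rightarrow> 'k) \<Rightarrow> 'a" where
  "cyclotomic_prod A x l Q =
    foldr (\<lambda>r p. (x \<ominus>\<^bsub>A\<^esub> (Q r \<odot>\<^bsub>A\<^esub> \<one>\<^bsub>A\<^esub>)) \<otimes>\<^bsub>A\<^esub> p) [1..<l + 1] \<one>\<^bsub>A\<^esub>"

definition cyclotomic_hecke ::
  "nat \<Rightarrow> nat \<Rightarrow> (nat \<Rightarrow> 'k::field) \<Rightarrow> ('k, (hgen list \<Rightarrow> 'k) set set) module" where
  "cyclotomic_hecke d l Q =
    alg_quot (affine_hecke d)
      (Idl\<^bsub>affine_hecke d\<^esub> {cyclotomic_prod (affine_hecke d) (affine_gen d (GenX 1)) l Q})"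

section \<open>The DG-enhancement\<close>

definition dg_gens :: "nat \<Rightarrow> hgen set" where
  "dg_gens d = insert GenTheta (hecke_gens d)"

definition dg_rels ::
  "nat \<Rightarrow> ('k::field, hgen list \<Rightarrow> 'k) module \<Rightarrow>
    ((hgen list \<Rightarrow> 'k) \<times> (hgen list \<Rightarrow> 'k)) set" where
  "dg_rels d F =
    (let t = (\<lambda>i. free_gen (GenT i)); x = (\<lambda>i. free_gen (GenX i)); \<theta> = free_gen GenTheta in
      hecke_rels d F \<union>
      {(\<theta> \<otimes>\<^bsub>F\<^esub> \<theta>, \<zero>\<^bsub>F\<^esub>)} \<union>
      {(x r \<otimes>\<^bsub>F\<^esub> \<theta>, \<theta> \<otimes>\<^bsub>F\<^esub> x r) | r. r \<in> {1..d}} \<union>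
      {(t r \<otimes>\<^bsub>F\<^esub> \<theta>, \<theta> \<otimes>\<^bsub>F\<^esub> t r) | r. r \<in> {1..<d} \<and> r > 1} \<union>
      {((t 1 \<otimes>\<^bsub>F\<^esub> \<theta> \<otimes>\<^bsub>F\<^esub> t 1 \<otimes>\<^bsub>F\<^esub> \<theta>) \<oplus>\<^bsub>F\<^esub> (\<theta> \<otimes>\<^bsub>F\<^esub> t 1 \<otimes>\<^bsub>F\<^esub> \<theta> \<otimes>\<^bsub>F\<^esub> t 1), \<zero>\<^bsub>F\<^esub>) | i.
          i = (1::nat) \<and> i \<in> {1..<d}})"

definition dg_ideal :: "nat \<Rightarrow> (hgen list \<Rightarrow> 'k::field) set" where
  "dg_ideal d = (let F = free_alg (dg_gens d) in rel_ideal F (dg_rels d F))"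

definition dg_hecke :: "nat \<Rightarrow> ('k::field, (hgen list \<Rightarrow> 'k) set) module" where
  "dg_hecke d = alg_quot (free_alg (dg_gens d)) (dg_ideal d)"

definition dg_gen :: "nat \<Rightarrow> hgen \<Rightarrow> (hgen list \<Rightarrow> 'k::field) set" where
  "dg_gen d v = dg_ideal d +>\<^bsub>free_alg (dg_gens d) :: ('k, _) module\<^esub> free_gen v"

lemma dg_rels_closed:
  assumes "(u::hgen list \<Rightarrow> 'k::field, v) \<in> dg_rels d (free_alg (dg_gens d))"
  shows "u \<in> carrier (free_alg (dg_gens d)) \<and> v \<in> carrier (free_alg (dg_gens d))"
proof -
  let ?F = "free_alg (dg_gens d) :: ('k,_) module"
  interpret ring ?F by (rule ring_free_alg)
  have g: "free_gen v \<in> carrier ?F" if "v \<in> dg_gens d" for v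
    using that by (auto simp: free_gen_def free_alg_def)
  have [simp]: "free_gen (GenT i) \<in> carrier ?F" if "Suc 0 \<le> i" "i < d" for i
    using that by (intro g) (auto simp: dg_gens_def hecke_gens_def)
  have [simp]: "free_gen (GenX i) \<in> carrier ?F" if "Suc 0 \<le> i" "i \<le> d" for i
    using that by (intro g) (auto simp: dg_gens_def hecke_gens_def)
  have [simp]: "free_gen GenTheta \<in> carrier ?F"
    by (intro g) (auto simp: dg_gens_def hecke_gens_def)
  show ?thesis using assms unfolding dg_rels_def hecke_rels_def Let_def by auto
qed

lemma ring_dg_hecke: "ring (dg_hecke d :: ('k::field,_) module)"
  unfolding dg_hecke_def by (rule ring_alg_quot) 
   (auto simp: dg_ideal_def Let_def intro!: ideal_rel_ideal ring_free_alg dest: dg_rels_closed)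

text \<open>The elements of homological degree \<open>n\<close>: classes of combinations of words containing
  \<open>\<theta>\<close> exactly \<open>n\<close> times.\<close>

definition dg_part :: "nat \<Rightarrow> nat \<Rightarrow> (hgen list \<Rightarrow> 'k::field) set set" where
  "dg_part d n =
    {dg_ideal d +>\<^bsub>free_alg (dg_gens d) :: ('k, _) module\<^esub> f | f.
      f \<in> carrier (free_alg (dg_gens d)) \<and> (\<forall>w. f w \<noteq> 0 \<longrightarrow> count_list w GenTheta = n)}"

definition is_dg_differential ::
  "nat \<Rightarrow> nat \<Rightarrow> (nat \<Rightarrow> 'k::field) \<Rightarrow>
    ((hgen list \<Rightarrow> 'k) set \<Rightarrow> (hgen list \<Rightarrow> 'k) set) \<Rightarrow> bool" where
  "is_dg_differential d l Q \<delta> \<longleftrightarrow>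
    (let A = dg_hecke d in
      \<delta> \<in> carrier A \<rightarrow>\<^sub>E carrier A \<and>
      (\<forall>x\<in>carrier A. \<forall>y\<in>carrier A. \<delta> (x \<oplus>\<^bsub>A\<^esub> y) = \<delta> x \<oplus>\<^bsub>A\<^esub> \<delta> y) \<and>
      (\<forall>c. \<forall>x\<in>carrier A. \<delta> (c \<odot>\<^bsub>A\<^esub> x) = c \<odot>\<^bsub>A\<^esub> \<delta> x) \<and>
      (\<forall>x\<in>subalg_generated A (dg_gen d ` hecke_gens d). \<delta> x = \<zero>\<^bsub>A\<^esub>) \<and>
      \<delta> (dg_gen d GenTheta) = cyclotomic_prod A (dg_gen d (GenX 1)) l Q \<and>
      (\<forall>n. \<forall>a\<in>dg_part d n. \<forall>b\<in>carrier A.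
        \<delta> (a \<otimes>\<^bsub>A\<^esub> b) = (\<delta> a \<otimes>\<^bsub>A\<^esub> b) \<oplus>\<^bsub>A\<^esub> ((-1) ^ n \<odot>\<^bsub>A\<^esub> (a \<otimes>\<^bsub>A\<^esub> \<delta> b))))"

text \<open>Requiring \<open>\<delta>\<close> to be \<^const>\<open>undefined\<close> outside the carrier (the arrow \<open>\<rightarrow>\<^sub>E\<close>) makes the
  map satisfying these conditions unique as a HOL function.\<close>

definition dg_differential ::
  "nat \<Rightarrow> nat \<Rightarrow> (nat \<Rightarrow> 'k::field) \<Rightarrow> (hgen list \<Rightarrow> 'k) set \<Rightarrow> (hgen list \<Rightarrow> 'k) set" where
  "dg_differential d l Q = (THE \<delta>. is_dg_differential d l Q \<delta>)"

end

theory Submission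
  imports Defs "HOL-Library.Function_Algebras" "HOL-Combinatorics.Transposition" "HOL-Library.Multiset"
begin

text \<open>
  Put \<open>\<theta>\<^sub>1 = \<theta>\<close> and \<open>\<theta>\<^sub>j\<^sub>+\<^sub>1 = T\<^sub>j \<theta>\<^sub>j T\<^sub>j\<close>. The \<open>\<theta>\<^sub>j\<close> anticommute, are permuted by the \<open>T\<^sub>i\<close>, and commute with the \<open>X\<^sub>i\<close> up
  to terms of lower weight, where \<open>X\<^sub>i\<close> has weight 1, \<open>\<theta>\<close> has weight \<open>\<ell>\<close> and \<open>T\<^sub>i\<close> has weight 0. Hence the
  products \<open>\<theta>\<^sub>J X\<^sup>a T\<^sub>u\<close> span the DG-algebra, compatibly with the weight filtration. Since \<open>\<partial>\<theta>\<^sub>j\<close> is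
  \<open>X\<^sub>j\<^sup>\<ell>\<close> plus terms of lower weight, the differential has as its leading part the Koszul differential
  of the regular sequence \<open>X\<^sub>1\<^sup>\<ell>, \<dots>, X\<^sub>d\<^sup>\<ell>\<close>, which has an explicit contracting homotopy on
  monomials. To lift this to the filtered algebra, leading terms must be linearly independent; this is
  read off from a representation on functions on tuples of distinct scalars, where \<open>T\<^sub>i\<close> acts by a
  Demazure-Lusztig operator with the factor \<open>1 / (X\<^sub>i\<^sub>+\<^sub>1 - X\<^sub>i)\<close>, of degree \<open>-1\<close>. So every cycle is a boundary plus a
  \<open>\<theta>\<close>-free element, and setting \<open>\<theta> = 0\<close> identifies the homology with the cyclotomic quotient.
\<close>

section \<open>Finitely supported functions\<close>

text \<open>The obstacle is that the DG-algebra is known by generators and relations alone.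
  Straightening shows that monomials span, but the Koszul argument needs more. If a cycle f has the
  leading combination c, then the leading combination \<open>lin d0 c\<close> of its differential
  lies in the ideal plus lower weight, and it must actually be zero before the homotopy gives c =
  \<open>lin d0 (lin htp c)\<close> plus a \<theta>-free rest. Independence supplies this, one
  weight at a time; subtracting the boundary of a lift of \<open>lin htp c\<close> and the rest
  leaves a cycle of smaller weight, and one descends.

  The representation is chosen so that leading terms can be read off: in top degree the divided
  differences vanish, T_i merely permutes, X_i multiplies and \<theta> contracts. What is left is a
  polynomial identity at tuples of distinct scalars, and here the infinitude of an algebraically
  closed field enters.

  Setting \<theta> = 0 is not a chain map to the affine Hecke algebra with zero differential, since
  \<theta> has boundary P; it sends boundaries into the ideal generated by P, which is why the
  cyclotomic quotient appears.\<close>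

definition fs :: "('a \<Rightarrow> 'k::zero) \<Rightarrow> bool" where
  "fs f \<longleftrightarrow> finite {a. f a \<noteq> 0}"

definition scl :: "'k::field \<Rightarrow> ('a \<Rightarrow> 'k) \<Rightarrow> 'a \<Rightarrow> 'k" where
  "scl c f = (\<lambda>a. c * f a)"

definition dlt :: "'a \<Rightarrow> 'a \<Rightarrow> 'k::field" where
  "dlt a = (\<lambda>b. if b = a then 1 else 0)"

text \<open>Linear extension of a map given on basis vectors. On a function of infinite support the
  sum defaults to 0, hence the \<open>fs\<close> assumptions in the additivity rules.\<close>

definition lin :: "('a \<Rightarrow> 'b \<Rightarrow> 'k::field) \<Rightarrow> ('a \<Rightarrow> 'k) \<Rightarrow> 'b \<Rightarrow> 'k" where
  "lin \<phi> f = (\<lambda>b. \<Sum>a | f a \<noteq> 0. f a * \<phi> a b)"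

lemma sum_fun_apply: "(\<Sum>i\<in>A. f i) x = (\<Sum>i\<in>A. f i x)"
  for f :: "'i \<Rightarrow> 'a \<Rightarrow> 'b::comm_monoid_add"
  by (induction A rule: infinite_finite_induct) (auto simp: plus_fun_apply zero_fun_apply)

lemma scl_apply: "scl c f a = c * f a"
  by (simp add: scl_def)

lemmas fun_applies = plus_fun_apply zero_fun_apply minus_apply uminus_apply scl_apply

declare plus_fun_apply [simp del] zero_fun_apply [simp del] minus_apply [simp del] uminus_apply [simp del]

lemma scl_simps [simp]: "scl c (0 :: _ \<Rightarrow> 'k::field) = 0" "scl 0 f = 0" "scl 1 f = f"
    "scl c (scl c' f) = scl (c * c') f"
  for f :: "'a \<Rightarrow> 'k::field"
  by (auto simp: fun_applies fun_eq_iff)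

lemma scl_distribs: "scl c (f + g) = scl c f + scl c g" "scl c (f - g) = scl c f - scl c g"
    "scl (c + c') f = scl c f + scl c' f" "scl (- c) f = - scl c f" "scl c (- f) = - scl c f"
  for f :: "'a \<Rightarrow> 'k::field"
  by (auto simp: fun_applies fun_eq_iff algebra_simps)

lemma scl_sum: "scl c (\<Sum>i\<in>A. f i) = (\<Sum>i\<in>A. scl c (f i))"
  by (auto simp: fun_applies fun_eq_iff sum_fun_apply sum_distrib_left)

lemma fs_0 [simp]: "fs 0" by (simp add: fs_def fun_applies)

lemma fs_dlt [simp]: "fs (dlt a)" by (simp add: fs_def dlt_def)

lemma fs_add [simp]: "fs f \<Longrightarrow> fs g \<Longrightarrow> fs (f + g)" for f :: "'a \<Rightarrow> 'k::field"
  unfolding fs_def by (rule finite_subset[of _ "{a. f a \<noteq> 0} \<union> {a. g a \<noteq> 0}"]) (auto simp: fun_applies)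

lemma fs_scl [simp]: "fs f \<Longrightarrow> fs (scl c f)"
  unfolding fs_def by (rule finite_subset[of _ "{a. f a \<noteq> 0}"]) (auto simp: fun_applies)

lemma fs_uminus [simp]: "fs (- f) \<longleftrightarrow> fs f" for f :: "'a \<Rightarrow> 'k::field"
  by (simp add: fs_def fun_applies)

lemma fs_diff [simp]: "fs f \<Longrightarrow> fs g \<Longrightarrow> fs (f - g)" for f :: "'a \<Rightarrow> 'k::field"
  using fs_add[of f "- g"] by simp

lemma fs_sum: "(\<And>i. i \<in> A \<Longrightarrow> fs (f i)) \<Longrightarrow> fs (\<Sum>i\<in>A. f i)" for f :: "'i \<Rightarrow> 'a \<Rightarrow> 'k::field"
  by (induction A rule: infinite_finite_induct) auto

lemma fun_expand: "fs f \<Longrightarrow> f = (\<Sum>a | f a \<noteq> 0. scl (f a) (dlt a))"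
  by (auto simp: fun_applies fun_eq_iff sum_fun_apply dlt_def fs_def if_distrib cong: if_cong)

text \<open>The partial sums keep their support inside that of \<open>f\<close>, so inductions can
  carry along constraints on the alphabet and on the weight of words.\<close>

lemma fs_induct [consumes 1, case_names zero add]:
  assumes "fs f" "P 0" 
    and add: "\<And>g a c. fs g \<Longrightarrow> f a \<noteq> 0 \<Longrightarrow> {b. g b \<noteq> 0} \<subseteq> {b. f b \<noteq> 0} \<Longrightarrow> P g \<Longrightarrow> c \<noteq> 0 \<Longrightarrow> P (scl c (dlt a) + g)"
  shows "P f"
proof -
  have "P (\<Sum>a\<in>A. scl (f a) (dlt a))" if "finite A" "A \<subseteq> {a. f a \<noteq> 0}" for A
    using that
  proof (induction A rule: finite_induct)
    case (insert a A)
    let ?g = "\<Sum>a\<in>A. scl (f a) (dlt a)"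
    have "?g b = (if b \<in> A then f b else 0)" for b
      using insert(1) by (auto simp: fun_applies sum_fun_apply dlt_def if_distrib cong: if_cong)
    then have "{b. ?g b \<noteq> 0} \<subseteq> {b. f b \<noteq> 0}" by auto
    then have "P (scl (f a) (dlt a) + ?g)"
      using insert by (intro add) (auto intro!: fs_sum)
    then show ?case using insert by simp
  qed (simp add: assms)
  from this[of "{a. f a \<noteq> 0}"] show ?thesis using assms(1) fun_expand[OF assms(1)]
    by (simp add: fs_def fun_applies)
qed

lemma lin_superset: "finite A \<Longrightarrow> {a. f a \<noteq> 0} \<subseteq> A \<Longrightarrow> lin \<phi> f b = (\<Sum>a\<in>A. f a * \<phi> a b)"
  unfolding lin_def by (rule sum.mono_neutral_left) auto

lemma lin_0 [simp]: "lin \<phi> 0 = 0"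
  by (simp add: lin_def fun_eq_iff fun_applies)

lemma lin_add: assumes "fs f" "fs g" shows "lin \<phi> (f + g) = lin \<phi> f + lin \<phi> g"
proof
  fix b
  let ?A = "{a. f a \<noteq> 0} \<union> {a. g a \<noteq> 0}"
  have A: "finite ?A" using assms by (simp add: fs_def fun_applies)
  show "lin \<phi> (f + g) b = (lin \<phi> f + lin \<phi> g) b"
    unfolding plus_fun_apply
    by (subst (1 2 3) lin_superset[OF A]) (auto simp: fun_applies sum.distrib algebra_simps)
qed

lemma lin_scl [simp]: "lin \<phi> (scl c f) = scl c (lin \<phi> f)"
proof (cases "c = 0")
  case False
  then show ?thesis by (auto simp: fun_applies lin_def fun_eq_iff sum_distrib_left mult.assoc)
qed (simp add: lin_def fun_eq_iff fun_applies)

lemma lin_dlt [simp]: "lin \<phi> (dlt a) = \<phi> a"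
proof
  fix b show "lin \<phi> (dlt a) b = \<phi> a b"
    by (subst lin_superset[of "{a}"]) (auto simp: dlt_def)
qed

lemma lin_uminus [simp]: "lin \<phi> (- f) = - lin \<phi> f"
  using lin_scl[of \<phi> "-1" f] by (simp add: scl_distribs)

lemma lin_diff: "fs f \<Longrightarrow> fs g \<Longrightarrow> lin \<phi> (f - g) = lin \<phi> f - lin \<phi> g"
  using lin_add[of f "- g" \<phi>] by simp

lemma lin_sum: "(\<And>i. i \<in> A \<Longrightarrow> fs (f i)) \<Longrightarrow> lin \<phi> (\<Sum>i\<in>A. f i) = (\<Sum>i\<in>A. lin \<phi> (f i))"
  by (induction A rule: infinite_finite_induct) (auto simp: lin_add fs_sum)

lemma lin_eq_sum: "lin \<phi> f = (\<Sum>a | f a \<noteq> 0. scl (f a) (\<phi> a))"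
  by (auto simp: fun_applies lin_def fun_eq_iff sum_fun_apply)

lemma fs_lin: "(\<And>a. f a \<noteq> 0 \<Longrightarrow> fs (\<phi> a)) \<Longrightarrow> fs (lin \<phi> f)"
  unfolding lin_eq_sum by (rule fs_sum) auto

lemma lin_cong: "(\<And>a. f a \<noteq> 0 \<Longrightarrow> \<phi> a = \<psi> a) \<Longrightarrow> lin \<phi> f = lin \<psi> f"
  unfolding lin_eq_sum by (rule sum.cong) auto

lemma lin_lin:
  assumes "\<And>a. f a \<noteq> 0 \<Longrightarrow> fs (\<phi> a)"
  shows "lin \<psi> (lin \<phi> f) = lin (\<lambda>a. lin \<psi> (\<phi> a)) f"
  unfolding lin_eq_sum[of \<phi>] lin_eq_sum[of "\<lambda>a. lin \<psi> (\<phi> a)"] using assms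
  by (subst lin_sum) auto

lemma lin_fun_add: "lin (\<lambda>a. \<phi> a + \<psi> a) f = lin \<phi> f + lin \<psi> f"
  by (auto simp: fun_applies lin_def fun_eq_iff sum.distrib algebra_simps)

lemma lin_fun_diff: "lin (\<lambda>a. \<phi> a - \<psi> a) f = lin \<phi> f - lin \<psi> f"
  by (auto simp: fun_applies lin_def fun_eq_iff sum_subtractf algebra_simps)

lemma lin_dlt_id [simp]: "fs f \<Longrightarrow> lin dlt f = f"
  using fun_expand[of f] by (simp add: lin_eq_sum)

section \<open>The free algebra as an algebra of functions on words\<close>

definition conv :: "('g list \<Rightarrow> 'k::field) \<Rightarrow> ('g list \<Rightarrow> 'k) \<Rightarrow> 'g list \<Rightarrow> 'k" (infixl \<open>\<star>\<close> 70) where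
  "f \<star> g = (\<lambda>w. \<Sum>i\<le>length w. f (take i w) * g (drop i w))"

abbreviation Fr :: "'g set \<Rightarrow> ('g list \<Rightarrow> 'k::field) set" where
  "Fr G \<equiv> carrier (free_alg G)"

lemma free_alg_ops:
  "mult (free_alg G) = (\<star>)" "one (free_alg G) = dlt []" "ring.zero (free_alg G) = 0"
  "add (free_alg G) = (+)" "smult (free_alg G) = scl"
  by (auto simp: fun_applies free_alg_def conv_def dlt_def fun_eq_iff fun_applies)

lemma free_gen_dlt: "free_gen v = dlt [v]"
  by (simp add: free_gen_def dlt_def)

lemma Fr_iff: "f \<in> Fr G \<longleftrightarrow> fs f \<and> (\<forall>w. f w \<noteq> 0 \<longrightarrow> w \<in> lists G)"
  by (auto simp: free_alg_def fs_def)

lemma Fr_fs: "f \<in> Fr G \<Longrightarrow> fs f" by (simp add: Fr_iff fun_applies)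

lemma Fr_conv [simp]: "f \<in> Fr G \<Longrightarrow> g \<in> Fr G \<Longrightarrow> f \<star> g \<in> Fr G"
  using free_alg_mult_closed[of f G g] by (simp add: free_alg_ops)

lemma Fr_0 [simp]: "0 \<in> Fr G" by (simp add: Fr_iff fun_applies)

lemma Fr_dlt: "dlt w \<in> Fr G \<longleftrightarrow> w \<in> lists G"
  by (simp add: Fr_iff fun_applies) (auto simp: dlt_def)

lemma Fr_dlt_lists [simp]: "w \<in> lists G \<Longrightarrow> dlt w \<in> Fr G"
  by (simp add: Fr_dlt)

lemma Fr_add [simp]: "f \<in> Fr G \<Longrightarrow> g \<in> Fr G \<Longrightarrow> f + g \<in> Fr G"
  by (simp add: Fr_iff fun_applies) (metis add.right_neutral)

lemma Fr_scl [simp]: "f \<in> Fr G \<Longrightarrow> scl c f \<in> Fr G"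
  by (simp add: Fr_iff fun_applies)

lemma Fr_uminus [simp]: "f \<in> Fr G \<Longrightarrow> - f \<in> Fr G"
  by (simp add: Fr_iff fun_applies)

lemma Fr_diff [simp]: "f \<in> Fr G \<Longrightarrow> g \<in> Fr G \<Longrightarrow> f - g \<in> Fr G"
  using Fr_add[of f G "- g"] by simp

lemma Fr_sum: "(\<And>i. i \<in> A \<Longrightarrow> f i \<in> Fr G) \<Longrightarrow> (\<Sum>i\<in>A. f i) \<in> Fr G"
  by (induction A rule: infinite_finite_induct) auto

lemma Fr_lin: "(\<And>a. f a \<noteq> 0 \<Longrightarrow> \<phi> a \<in> Fr G) \<Longrightarrow> lin \<phi> f \<in> Fr G"
  unfolding lin_eq_sum by (rule Fr_sum) auto

lemma Fr_mono: "G \<subseteq> G' \<Longrightarrow> f \<in> Fr G \<Longrightarrow> f \<in> Fr G'"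
  unfolding Fr_iff using lists_mono by blast

lemma free_alg_minus:
  assumes "f \<in> Fr G" shows "\<ominus>\<^bsub>free_alg G\<^esub> f = - f"
proof -
  interpret ring "free_alg G :: ('b, _) module" by (rule ring_free_alg)
  show ?thesis using assms by (intro minus_equality) (auto simp: free_alg_ops)
qed

lemma free_alg_diff:
  "g \<in> Fr G \<Longrightarrow> f \<ominus>\<^bsub>free_alg G\<^esub> g = f - g"
  by (simp add: a_minus_def free_alg_minus free_alg_ops)

lemma conv_assoc: "f \<star> g \<star> h = f \<star> (g \<star> h)"
  by (metis free_alg_mult_assoc free_alg_ops(1))

lemma conv_dlt_left: "(dlt u \<star> f) w = (if take (length u) w = u then f (drop (length u) w) else 0)"
proof -
  have "(dlt u \<star> f) w = f (drop (length u) w)" if "take (length u) w = u"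
  proof -
    have "length u \<le> length w" using that by (metis length_take min.cobounded1)
    moreover have "(dlt u \<star> f) w = (\<Sum>i\<le>length w. if i = length u then f (drop i w) else 0)"
      unfolding conv_def dlt_def using that 
      by (intro sum.cong refl) (auto simp: min_def dest!: arg_cong[where f = length] split: if_splits)
    ultimately show ?thesis by simp
  qed
  moreover have "(dlt u \<star> f) w = 0" if "take (length u) w \<noteq> u"
    using that unfolding conv_def dlt_def
    by (intro sum.neutral) (auto simp: min_def split: if_splits)
  ultimately show ?thesis by auto
qed

lemma conv_dlt_dlt [simp]: "dlt u \<star> dlt v = dlt (u @ v)"
proof
  fix w
  have "take (length u) w = u \<and> drop (length u) w = v \<longleftrightarrow> w = u @ v"
    by (metis append_eq_conv_conj)
  then show "(dlt u \<star> dlt v) w = dlt (u @ v) w"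
    unfolding conv_dlt_left by (auto simp: dlt_def)
qed

lemma conv_one [simp]: "dlt [] \<star> f = f" "f \<star> dlt [] = f"
proof -
  show "dlt [] \<star> f = f" by (simp add: fun_eq_iff conv_dlt_left)
  show "f \<star> dlt [] = f"
  proof
    fix w
    have "(f \<star> dlt []) w = (\<Sum>i\<le>length w. if i = length w then f w else 0)"
      unfolding conv_def dlt_def by (intro sum.cong) auto
    then show "(f \<star> dlt []) w = f w" by simp
  qed
qed

lemma conv_distribs:
  "(f + g) \<star> h = f \<star> h + g \<star> h" "f \<star> (g + h) = f \<star> g + f \<star> h"
  "(f - g) \<star> h = f \<star> h - g \<star> h" "f \<star> (g - h) = f \<star> g - f \<star> h"
  "scl c f \<star> g = scl c (f \<star> g)" "f \<star> scl c g = scl c (f \<star> g)"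
  "(- f) \<star> g = - (f \<star> g)" "f \<star> (- g) = - (f \<star> g)"
  by (auto simp: fun_applies fun_eq_iff conv_def algebra_simps sum.distrib sum_subtractf sum_distrib_left sum_negf)

lemma conv_0 [simp]: "0 \<star> f = 0" "f \<star> 0 = 0"
  by (auto simp: fun_applies fun_eq_iff conv_def)

lemma conv_sum: "(\<Sum>i\<in>A. f i) \<star> g = (\<Sum>i\<in>A. f i \<star> g)" "g \<star> (\<Sum>i\<in>A. f i) = (\<Sum>i\<in>A. g \<star> f i)"
  by (induction A rule: infinite_finite_induct) (auto simp: conv_distribs)

lemma lin_conv:
  assumes "fs f" "fs g"
  shows "lin \<phi> (f \<star> g) = lin (\<lambda>u. lin (\<lambda>v. \<phi> (u @ v)) g) f"
  using assms(1)
proof (induction rule: fs_induct)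
  case (add f' u c)
  have g: "fs (dlt u \<star> g) \<and> lin \<phi> (dlt u \<star> g) = lin (\<lambda>v. \<phi> (u @ v)) g"
    using assms(2)
    by (induction rule: fs_induct) (auto simp: conv_distribs lin_add)
  have f': "fs (f' \<star> g)"
    using Fr_conv[of f' UNIV g] add assms(2) by (auto simp: Fr_iff)
  show ?case using g f' add
    by (simp add: conv_distribs lin_add)
qed simp

lemma fs_conv [simp]: "fs f \<Longrightarrow> fs g \<Longrightarrow> fs (f \<star> g)"
  using Fr_conv[of f UNIV g] by (auto simp: Fr_iff)

lemma ideal_free_algI:
  fixes K :: "('g list \<Rightarrow> 'k::field) set"
  assumes "K \<subseteq> Fr G" "0 \<in> K" "\<And>f g. f \<in> K \<Longrightarrow> g \<in> K \<Longrightarrow> f + g \<in> K" "\<And>f. f \<in> K \<Longrightarrow> - f \<in> K"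
    "\<And>f g. f \<in> K \<Longrightarrow> g \<in> Fr G \<Longrightarrow> g \<star> f \<in> K" "\<And>f g. f \<in> K \<Longrightarrow> g \<in> Fr G \<Longrightarrow> f \<star> g \<in> K"
  shows "ideal K (free_alg G)"
proof (rule idealI[OF ring_free_alg])
  interpret ring "free_alg G :: ('k, _) module" by (rule ring_free_alg)
  have [simp]: "\<ominus>\<^bsub>free_alg G\<^esub> f = - f" if "f \<in> K" for f
    using free_alg_minus[of f G] that assms(1) by auto
  show "subgroup K (add_monoid (free_alg G))"
    by (rule add.subgroupI) (use assms in \<open>auto simp: free_alg_ops simp flip: a_inv_def\<close>)
qed (use assms in \<open>auto simp: free_alg_ops\<close>)

lemma ideal_free_algD:
  fixes K :: "('g list \<Rightarrow> 'k::field) set"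
  assumes "ideal K (free_alg G)"
  shows "f \<in> K \<Longrightarrow> f \<in> Fr G" "0 \<in> K" "f \<in> K \<Longrightarrow> g \<in> K \<Longrightarrow> f + g \<in> K" "f \<in> K \<Longrightarrow> - f \<in> K"
    "f \<in> K \<Longrightarrow> g \<in> K \<Longrightarrow> f - g \<in> K" "f \<in> K \<Longrightarrow> scl c f \<in> K"
    "f \<in> K \<Longrightarrow> g \<in> Fr G \<Longrightarrow> g \<star> f \<in> K" "f \<in> K \<Longrightarrow> g \<in> Fr G \<Longrightarrow> f \<star> g \<in> K"
proof -
  interpret ideal K "free_alg G" by fact
  show sub: "f \<in> Fr G" if "f \<in> K" for f using a_subset that by auto
  show "0 \<in> K" using additive_subgroup.zero_closed[OF is_additive_subgroup] by (simp add: free_alg_ops)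
  show add: "f + g \<in> K" if "f \<in> K" "g \<in> K" for f g using additive_subgroup.a_closed[OF is_additive_subgroup that] by (simp add: free_alg_ops)
  show l: "g \<star> f \<in> K" if "f \<in> K" "g \<in> Fr G" for f g using I_l_closed[OF that] by (simp add: free_alg_ops)
  show "f \<star> g \<in> K" if "f \<in> K" "g \<in> Fr G" for f g using I_r_closed[OF that] by (simp add: free_alg_ops)
  show s: "scl c f \<in> K" if "f \<in> K" for f c
    using l[OF that, of "scl c (dlt [])"] by (simp add: conv_distribs)
  show u: "- f \<in> K" if "f \<in> K" for f using s[OF that, of "-1"] by (simp add: scl_distribs)
  show "f - g \<in> K" if "f \<in> K" "g \<in> K" for f g using add[OF that(1) u[OF that(2)]] by simp
qed

section \<open>Defining relations\<close>

text \<open>Relators as concrete functions on words. They do not mention the alphabet, so one set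
  serves both the affine ideal and the larger DG ideal.\<close>

inductive_set hecke_diffs :: "nat \<Rightarrow> (hgen list \<Rightarrow> 'k::field) set" for d where
  TT: "i \<in> {1..<d} \<Longrightarrow> dlt [GenT i, GenT i] - dlt [] \<in> hecke_diffs d"
| TcT: "i \<in> {1..<d} \<Longrightarrow> j \<in> {1..<d} \<Longrightarrow> \<bar>int i - int j\<bar> > 1 \<Longrightarrow>
    dlt [GenT i, GenT j] - dlt [GenT j, GenT i] \<in> hecke_diffs d"
| TTT: "i \<in> {1..<d} \<Longrightarrow> Suc i \<in> {1..<d} \<Longrightarrow>
    dlt [GenT i, GenT (Suc i), GenT i] - dlt [GenT (Suc i), GenT i, GenT (Suc i)] \<in> hecke_diffs d"
| XX: "i \<in> {1..d} \<Longrightarrow> j \<in> {1..d} \<Longrightarrow> dlt [GenX i, GenX j] - dlt [GenX j, GenX i] \<in> hecke_diffs d"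
| TX: "i \<in> {1..<d} \<Longrightarrow> dlt [GenT i, GenX i] - dlt [GenX (Suc i), GenT i] + dlt [] \<in> hecke_diffs d"
| TcX: "i \<in> {1..<d} \<Longrightarrow> j \<in> {1..d} \<Longrightarrow> j \<noteq> i \<Longrightarrow> j \<noteq> Suc i \<Longrightarrow>
    dlt [GenT i, GenX j] - dlt [GenX j, GenT i] \<in> hecke_diffs d"

inductive_set dg_diffs :: "nat \<Rightarrow> (hgen list \<Rightarrow> 'k::field) set" for d where
  hecke: "f \<in> hecke_diffs d \<Longrightarrow> f \<in> dg_diffs d"
| thth: "dlt [GenTheta, GenTheta] \<in> dg_diffs d"
| Xth: "i \<in> {1..d} \<Longrightarrow> dlt [GenX i, GenTheta] - dlt [GenTheta, GenX i] \<in> dg_diffs d"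
| Tth: "i \<in> {1..<d} \<Longrightarrow> i > 1 \<Longrightarrow> dlt [GenT i, GenTheta] - dlt [GenTheta, GenT i] \<in> dg_diffs d"
| TthTth: "1 < d \<Longrightarrow> dlt [GenT 1, GenTheta, GenT 1, GenTheta] + dlt [GenTheta, GenT 1, GenTheta, GenT 1] \<in> dg_diffs d"

lemma hecke_gens_simps [simp]: "GenT i \<in> hecke_gens d \<longleftrightarrow> i \<in> {1..<d}" "GenX i \<in> hecke_gens d \<longleftrightarrow> i \<in> {1..d}"
    "GenTheta \<notin> hecke_gens d"
  by (auto simp: hecke_gens_def)

lemma dg_gens_simps [simp]: "GenT i \<in> dg_gens d \<longleftrightarrow> i \<in> {1..<d}" "GenX i \<in> dg_gens d \<longleftrightarrow> i \<in> {1..d}"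
    "GenTheta \<in> dg_gens d"
  by (auto simp: dg_gens_def)

lemma hecke_subset_dg: "hecke_gens d \<subseteq> dg_gens d" by (auto simp: dg_gens_def)

lemma hecke_diffs_eq:
  assumes "hecke_gens d \<subseteq> G"
  shows "{u \<ominus>\<^bsub>free_alg G\<^esub> v | u v. (u, v) \<in> hecke_rels d (free_alg G)} = (hecke_diffs d :: (_ \<Rightarrow> 'k::field) set)"
    (is "?L = _")
proof -
  have T: "GenT i \<in> G" if "Suc 0 \<le> i" "i < d" for i using assms that hecke_gens_simps by fastforce
  have X: "GenX i \<in> G" if "Suc 0 \<le> i" "i \<le> d" for i using assms that hecke_gens_simps by fastforce
  note R = hecke_rels_def Let_def free_alg_ops free_gen_dlt
  show ?thesis
  proof (intro equalityI subsetI)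
    fix f :: "_ \<Rightarrow> 'k" assume "f \<in> ?L"
    then obtain u v where uv: "f = u \<ominus>\<^bsub>free_alg G\<^esub> v" "(u, v) \<in> hecke_rels d (free_alg G)" by auto
    show "f \<in> hecke_diffs d"
      using uv(2) unfolding hecke_rels_def Let_def
      by - (elim UnE CollectE exE conjE; clarsimp simp: uv(1) free_alg_diff free_alg_minus free_alg_ops free_gen_dlt T X;
        rule hecke_diffs.intros; auto)
  next
    fix f :: "_ \<Rightarrow> 'k" assume "f \<in> hecke_diffs d"
    then obtain u v where "f = u \<ominus>\<^bsub>free_alg G\<^esub> v" "(u, v) \<in> hecke_rels d (free_alg G)"
    proof cases
      case (TT i)
      show ?thesis
        by (rule that[of "dlt [GenT i, GenT i]" "dlt []"])
          (use TT in \<open>simp add: free_alg_diff\<close>, use TT in \<open>simp add: R; blast\<close>)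
    next
      case (TcT i j)
      show ?thesis
        by (rule that[of "dlt [GenT i, GenT j]" "dlt [GenT j, GenT i]"])
          (use TcT in \<open>simp add: free_alg_diff T\<close>, use TcT in \<open>simp add: R; blast\<close>)
    next
      case (TTT i)
      show ?thesis
        by (rule that[of "dlt [GenT i, GenT (Suc i), GenT i]" "dlt [GenT (Suc i), GenT i, GenT (Suc i)]"])
          (use TTT in \<open>simp add: free_alg_diff T\<close>, use TTT in \<open>simp add: R; blast dest: Suc_lessD\<close>)
    next
      case (XX i j)
      show ?thesis
        by (rule that[of "dlt [GenX i, GenX j]" "dlt [GenX j, GenX i]"])
          (use XX in \<open>simp add: free_alg_diff X\<close>, use XX in \<open>simp add: R; blast\<close>)
    next
      case (TX i)
      show ?thesis
        by (rule that[of "dlt [GenT i, GenX i] \<ominus>\<^bsub>free_alg G\<^esub> dlt [GenX (Suc i), GenT i]" "\<ominus>\<^bsub>free_alg G\<^esub> dlt []"])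
          (use TX in \<open>simp add: free_alg_diff free_alg_minus X T\<close>, use TX in \<open>simp add: R; blast\<close>)
    next
      case (TcX i j)
      then have ij: "j \<noteq> i \<and> int j - int i \<noteq> 1" by auto
      show ?thesis
        by (rule that[of "dlt [GenT i, GenX j]" "dlt [GenX j, GenT i]"])
          (use TcX in \<open>simp add: free_alg_diff T X\<close>, use TcX(2,3) ij in \<open>simp add: R; blast\<close>)
    qed
    then show "f \<in> ?L" by blast
  qed
qed

lemma dg_diffs_eq:
  "{u \<ominus>\<^bsub>free_alg (dg_gens d)\<^esub> v | u v. (u, v) \<in> dg_rels d (free_alg (dg_gens d))} = (dg_diffs d :: (_ \<Rightarrow> 'k::field) set)"
    (is "?L = _")
proof -
  let ?F = "free_alg (dg_gens d) :: ('k, _) module"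
  have H: "{u \<ominus>\<^bsub>?F\<^esub> v | u v. (u, v) \<in> hecke_rels d ?F} = hecke_diffs d"
    by (rule hecke_diffs_eq[OF hecke_subset_dg])
  show ?thesis
  proof (intro equalityI subsetI)
    fix f assume "f \<in> ?L"
    then obtain u v where uv: "f = u \<ominus>\<^bsub>?F\<^esub> v" "(u, v) \<in> dg_rels d ?F" by auto
    show "f \<in> dg_diffs d"
    proof (cases "(u, v) \<in> hecke_rels d ?F")
      case True
      then show ?thesis using H uv by (auto intro: dg_diffs.hecke)
    next
      case False
      then show ?thesis
        using uv(2) unfolding dg_rels_def Let_def
        by - (elim UnE CollectE exE conjE; clarsimp simp: uv(1) free_alg_diff free_alg_minus free_alg_ops free_gen_dlt simp del: One_nat_def;
          (rule dg_diffs.intros(2-); auto)?)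
    qed
  next
    fix f assume "f \<in> (dg_diffs d :: (_ \<Rightarrow> 'k) set)"
    then show "f \<in> ?L"
    proof cases
      case hecke
      then obtain u v where "f = u \<ominus>\<^bsub>?F\<^esub> v" "(u, v) \<in> hecke_rels d ?F"
        unfolding H[symmetric] by blast
      then show ?thesis unfolding dg_rels_def Let_def by blast
    next
      case thth
      then show ?thesis
        by (intro CollectI exI[of _ "dlt [GenTheta, GenTheta]"] exI[of _ "0"])
          (auto simp: free_alg_diff dg_rels_def free_alg_ops free_gen_dlt)
    next
      case (Xth i)
      then show ?thesis
        by (intro CollectI exI[of _ "dlt [GenX i, GenTheta]"] exI[of _ "dlt [GenTheta, GenX i]"])
          (auto simp: free_alg_diff dg_rels_def free_alg_ops free_gen_dlt)
    next
      case (Tth i)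
      then show ?thesis
        by (intro CollectI exI[of _ "dlt [GenT i, GenTheta]"] exI[of _ "dlt [GenTheta, GenT i]"])
          (auto simp: free_alg_diff dg_rels_def free_alg_ops free_gen_dlt)
    next
      case TthTth
      then show ?thesis
        by (intro CollectI exI[of _ "dlt [GenT 1, GenTheta, GenT 1, GenTheta] + dlt [GenTheta, GenT 1, GenTheta, GenT 1]"] exI[of _ 0])
          (auto simp: free_alg_diff dg_rels_def free_alg_ops free_gen_dlt)
    qed
  qed
qed

lemma hecke_diffs_Fr: "f \<in> hecke_diffs d \<Longrightarrow> f \<in> Fr (hecke_gens d)"
  by (erule hecke_diffs.cases) auto

lemma dg_diffs_Fr: "f \<in> dg_diffs d \<Longrightarrow> f \<in> Fr (dg_gens d)"
  by (erule dg_diffs.cases) (auto intro: Fr_mono[OF hecke_subset_dg] dest: hecke_diffs_Fr)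

lemma affine_ideal_eq: "affine_ideal d = Idl\<^bsub>free_alg (hecke_gens d)\<^esub> hecke_diffs d"
  by (simp add: affine_ideal_def rel_ideal_def hecke_diffs_eq)

lemma dg_ideal_eq: "dg_ideal d = Idl\<^bsub>free_alg (dg_gens d)\<^esub> dg_diffs d"
  by (simp add: dg_ideal_def rel_ideal_def dg_diffs_eq)

lemma ideal_affine: "ideal (affine_ideal d :: (_ \<Rightarrow> 'k::field) set) (free_alg (hecke_gens d))"
  unfolding affine_ideal_eq using hecke_diffs_Fr by (intro ring.genideal_ideal ring_free_alg) auto

lemma ideal_dg: "ideal (dg_ideal d :: (_ \<Rightarrow> 'k::field) set) (free_alg (dg_gens d))"
  unfolding dg_ideal_eq using dg_diffs_Fr by (intro ring.genideal_ideal ring_free_alg) auto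

lemma hecke_diffs_in_ideal: "f \<in> hecke_diffs d \<Longrightarrow> f \<in> affine_ideal d"
  unfolding affine_ideal_eq using ring.genideal_self[OF ring_free_alg, of "hecke_diffs d" "hecke_gens d"]
    hecke_diffs_Fr by blast

lemma dg_diffs_in_ideal: "f \<in> dg_diffs d \<Longrightarrow> f \<in> dg_ideal d"
  unfolding dg_ideal_eq using ring.genideal_self[OF ring_free_alg, of "dg_diffs d" "dg_gens d"]
    dg_diffs_Fr by blast

text \<open>Serves as an induction principle: a property holds throughout the ideal once the
  elements having it form an ideal that contains the relators.\<close>

lemma affine_ideal_minimal: "ideal K (free_alg (hecke_gens d)) \<Longrightarrow> hecke_diffs d \<subseteq> K \<Longrightarrow> affine_ideal d \<subseteq> K"
  unfolding affine_ideal_eq by (rule ring.genideal_minimal[OF ring_free_alg])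

lemma dg_ideal_minimal: "ideal K (free_alg (dg_gens d)) \<Longrightarrow> dg_diffs d \<subseteq> K \<Longrightarrow> dg_ideal d \<subseteq> K"
  unfolding dg_ideal_eq by (rule ring.genideal_minimal[OF ring_free_alg])

section \<open>The superderivation of the free algebra\<close>

definition pol :: "(nat \<Rightarrow> 'k::field) \<Rightarrow> nat list \<Rightarrow> nat \<Rightarrow> hgen list \<Rightarrow> 'k" where
  "pol Q rs i = foldr (\<lambda>r p. (dlt [GenX i] - scl (Q r) (dlt [])) \<star> p) rs (dlt [])"

lemma pol_simps [simp]: "pol Q [] i = dlt []"
  "pol Q (r # rs) i = (dlt [GenX i] - scl (Q r) (dlt [])) \<star> pol Q rs i"
  by (simp_all add: pol_def)

text \<open>The odd derivation with \<theta> \<mapsto> P that kills all T_i and X_i. The minus sign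
  is the sign of moving an odd operator past \<theta>.\<close>

fun derw :: "(hgen list \<Rightarrow> 'k::field) \<Rightarrow> hgen list \<Rightarrow> hgen list \<Rightarrow> 'k" where
  "derw P [] = 0"
| "derw P (GenTheta # w) = P \<star> dlt w - dlt [GenTheta] \<star> derw P w"
| "derw P (g # w) = dlt [g] \<star> derw P w"

definition der :: "(hgen list \<Rightarrow> 'k::field) \<Rightarrow> (hgen list \<Rightarrow> 'k) \<Rightarrow> hgen list \<Rightarrow> 'k" where
  "der P = lin (derw P)"

definition sgw :: "hgen list \<Rightarrow> 'k::field" where
  "sgw w = (-1) ^ count_list w GenTheta"

text \<open>The grading automorphism. It gives a Leibniz rule for inhomogeneous first factors, D(fg)
  = D(f) g + \<open>sgi f\<close> D(g).\<close>

definition sgi :: "(hgen list \<Rightarrow> 'k::field) \<Rightarrow> hgen list \<Rightarrow> 'k" where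
  "sgi = lin (\<lambda>w. scl (sgw w) (dlt w))"

lemma sgw_simps [simp]: "sgw [] = 1" "sgw (u @ v) = sgw u * sgw v"
  "sgw (GenTheta # w) = - sgw w" "sgw (GenT i # w) = sgw w" "sgw (GenX i # w) = sgw w"
  by (auto simp: sgw_def power_add)

lemma derw_append: "derw P (u @ v) = derw P u \<star> dlt v + scl (sgw u) (dlt u \<star> derw P v)"
proof (induction P u rule: derw.induct)
  case (2 P w)
  have "dlt (GenTheta # w) = (dlt [GenTheta] \<star> dlt w :: _ \<Rightarrow> 'a)" by simp
  then show ?case using 2 by (simp add: conv_distribs conv_assoc scl_distribs del: conv_dlt_dlt) 
     (simp add: conv_assoc[symmetric])
next
  case ("3_1" P i w)
  have "dlt (GenT i # w) = (dlt [GenT i] \<star> dlt w :: _ \<Rightarrow> 'a)" by simp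
  then show ?case using "3_1" by (simp add: conv_distribs conv_assoc del: conv_dlt_dlt)
next
  case ("3_2" P i w)
  have "dlt (GenX i # w) = (dlt [GenX i] \<star> dlt w :: _ \<Rightarrow> 'a)" by simp
  then show ?case using "3_2" by (simp add: conv_distribs conv_assoc del: conv_dlt_dlt)
qed simp

lemma fs_derw [simp]: "fs P \<Longrightarrow> fs (derw P w)"
  by (induction P w rule: derw.induct) auto

lemma fs_der [simp]: "fs P \<Longrightarrow> fs (der P f)"
  unfolding der_def by (rule fs_lin) simp

lemma fs_sgi [simp]: "fs (sgi f)"
  unfolding sgi_def by (rule fs_lin) simp

lemma der_linear: "fs f \<Longrightarrow> fs g \<Longrightarrow> der P (f + g) = der P f + der P g"
   "fs f \<Longrightarrow> fs g \<Longrightarrow> der P (f - g) = der P f - der P g"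
   "der P (scl c f) = scl c (der P f)" "der P (- f) = - der P f" "der P 0 = 0" "der P (dlt w) = derw P w"
  by (simp_all add: der_def lin_add lin_diff)

lemma sgi_linear: "fs f \<Longrightarrow> fs g \<Longrightarrow> sgi (f + g) = sgi f + sgi g"
   "fs f \<Longrightarrow> fs g \<Longrightarrow> sgi (f - g) = sgi f - sgi g"
   "sgi (scl c f) = scl c (sgi f)" "sgi (- f) = - sgi f" "sgi 0 = 0" "sgi (dlt w) = scl (sgw w) (dlt w)"
  by (simp_all add: sgi_def lin_add lin_diff)

lemma der_conv:
  assumes "fs f" "fs g" and P: "fs P"
  shows "der P (f \<star> g) = der P f \<star> g + sgi f \<star> der P g"
  using assms(1)
proof (induction rule: fs_induct)
  case (add f' u c)
  have *: "der P (dlt u \<star> g) = derw P u \<star> g + scl (sgw u) (dlt u \<star> der P g)"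
    using assms(2)
  proof (induction rule: fs_induct)
    case (add g' v c')
    then show ?case using P
      by (simp add: conv_distribs der_linear derw_append scl_distribs algebra_simps)
  qed (simp add: der_linear)
  show ?case using * add assms P
    by (simp add: conv_distribs der_linear sgi_linear algebra_simps scl_distribs)
qed (simp add: der_linear sgi_linear)

lemma sgi_conv:
  assumes "fs f" "fs g"
  shows "sgi (f \<star> g) = sgi f \<star> sgi g"
  using assms(1)
proof (induction rule: fs_induct)
  case (add f' u c)
  have *: "sgi (dlt u \<star> g) = scl (sgw u) (dlt u \<star> sgi g)"
    using assms(2)
  proof (induction rule: fs_induct)
    case (add g' v c')
    then show ?case
      by (simp add: conv_distribs sgi_linear scl_distribs algebra_simps)
  qed (simp add: sgi_linear)
  show ?case using * add assms
    by (simp add: conv_distribs sgi_linear scl_distribs algebra_simps)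
qed (simp add: sgi_linear)

lemma sgi_Fr: "f \<in> Fr G \<Longrightarrow> sgi f \<in> Fr G"
  unfolding sgi_def by (rule Fr_lin) (simp add: Fr_iff[of f] Fr_dlt)

lemma derw_Fr: "P \<in> Fr (dg_gens d) \<Longrightarrow> w \<in> lists (dg_gens d) \<Longrightarrow> derw P w \<in> Fr (dg_gens d)"
  by (induction P w rule: derw.induct) auto

lemma der_Fr: "P \<in> Fr (dg_gens d) \<Longrightarrow> f \<in> Fr (dg_gens d) \<Longrightarrow> der P f \<in> Fr (dg_gens d)"
  unfolding der_def by (rule Fr_lin) (simp add: Fr_iff[of f] derw_Fr)

lemma derw_hecke: "GenTheta \<notin> set w \<Longrightarrow> derw P w = 0"
  by (induction P w rule: derw.induct) auto

lemma sgw_hecke: "GenTheta \<notin> set w \<Longrightarrow> sgw w = 1"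
  by (simp add: sgw_def)

lemma Fr_hecke_theta: "f \<in> Fr (hecke_gens d) \<Longrightarrow> f w \<noteq> 0 \<Longrightarrow> GenTheta \<notin> set w"
  using hecke_gens_simps(3) by (fastforce simp: Fr_iff in_lists_conv_set)

lemma der_hecke: "f \<in> Fr (hecke_gens d) \<Longrightarrow> der P f = 0"
  unfolding der_def lin_eq_sum by (rule sum.neutral) (auto dest: Fr_hecke_theta simp: derw_hecke)

lemma sgi_hecke: "f \<in> Fr (hecke_gens d) \<Longrightarrow> sgi f = f"
  unfolding sgi_def by (subst lin_cong[of _ _ dlt]) (auto dest: Fr_hecke_theta Fr_fs simp: sgw_hecke)

lemma pol_Fr: "i \<in> {1..d} \<Longrightarrow> pol Q rs i \<in> Fr (hecke_gens d)"
  by (induction rs) auto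

text \<open>P is free of \<theta>, hence killed by the derivation and fixed by \<open>sgi\<close>.
  Applying the derivation twice to \<theta>w then produces P D(w) with both signs, and only \<theta>
  D(D(w)) remains for the induction.\<close>

lemma der_der:
  assumes "fs f" "P \<in> Fr (hecke_gens d)"
  shows "der P (der P f) = 0"
  using assms(1)
proof (induction rule: fs_induct)
  case (add f' u c)
  have P: "fs P" "der P P = 0" "sgi P = P" using assms(2) by (auto simp: Fr_fs der_hecke sgi_hecke)
  have "der P (derw P u) = 0" using P
    by (induction P u rule: derw.induct) (auto simp: der_linear der_conv sgi_linear conv_distribs sgi_conv)
  then show ?case using add P by (simp add: der_linear)
qed (simp add: der_linear)

lemma conv_dlt_dlt_left [simp]: "dlt u \<star> (dlt v \<star> f) = dlt (u @ v) \<star> f"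
  by (simp add: conv_assoc[symmetric])

lemmas conv_norm = conv_distribs conv_assoc scl_distribs

section \<open>The differential preserves the defining ideal\<close>

text \<open>Represents the divided difference \<open>(P(X\<^sub>2) - P(X\<^sub>1)) / (X\<^sub>2 - X\<^sub>1)\<close> of \<open>P = pol Q rs\<close>.\<close>

fun dpol :: "(nat \<Rightarrow> 'k::field) \<Rightarrow> nat list \<Rightarrow> hgen list \<Rightarrow> 'k" where
  "dpol Q [] = 0"
| "dpol Q (r # rs) = (dlt [GenX 2] - scl (Q r) (dlt [])) \<star> dpol Q rs + pol Q rs 1"

locale dg_setting =
  fixes d l :: nat and Q :: "nat \<Rightarrow> 'k::alg_closed_field"
  assumes d1: "1 \<le> d" and l1: "1 \<le> l"
begin

abbreviation I :: "(hgen list \<Rightarrow> 'k) set" where "I \<equiv> dg_ideal d"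
abbreviation FG :: "(hgen list \<Rightarrow> 'k) set" where "FG \<equiv> Fr (dg_gens d)"
abbreviation FH :: "(hgen list \<Rightarrow> 'k) set" where "FH \<equiv> Fr (hecke_gens d)"
definition P :: "hgen list \<Rightarrow> 'k" where "P = pol Q [1..<l + 1] 1"
abbreviation D :: "(hgen list \<Rightarrow> 'k) \<Rightarrow> hgen list \<Rightarrow> 'k" where "D \<equiv> der P"
abbreviation WG :: "hgen list set" where "WG \<equiv> lists (dg_gens d)"

lemmas I_D = ideal_free_algD[OF ideal_dg[where ?'k = 'k and d = d]]

lemma I_rels:
  "i \<in> {1..<d} \<Longrightarrow> dlt [GenT i, GenT i] - dlt [] \<in> I"
  "i \<in> {1..<d} \<Longrightarrow> j \<in> {1..<d} \<Longrightarrow> \<bar>int i - int j\<bar> > 1 \<Longrightarrow>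
    dlt [GenT i, GenT j] - dlt [GenT j, GenT i] \<in> I"
  "i \<in> {1..<d} \<Longrightarrow> Suc i \<in> {1..<d} \<Longrightarrow>
    dlt [GenT i, GenT (Suc i), GenT i] - dlt [GenT (Suc i), GenT i, GenT (Suc i)] \<in> I"
  "i \<in> {1..d} \<Longrightarrow> j \<in> {1..d} \<Longrightarrow> dlt [GenX i, GenX j] - dlt [GenX j, GenX i] \<in> I"
  "i \<in> {1..<d} \<Longrightarrow> dlt [GenT i, GenX i] - dlt [GenX (Suc i), GenT i] + dlt [] \<in> I"
  "i \<in> {1..<d} \<Longrightarrow> j \<in> {1..d} \<Longrightarrow> j \<noteq> i \<Longrightarrow> j \<noteq> Suc i \<Longrightarrow>
    dlt [GenT i, GenX j] - dlt [GenX j, GenT i] \<in> I"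
  "dlt [GenTheta, GenTheta] \<in> I"
  "i \<in> {1..d} \<Longrightarrow> dlt [GenX i, GenTheta] - dlt [GenTheta, GenX i] \<in> I"
  "i \<in> {1..<d} \<Longrightarrow> i > 1 \<Longrightarrow> dlt [GenT i, GenTheta] - dlt [GenTheta, GenT i] \<in> I"
  "1 < d \<Longrightarrow> dlt [GenT 1, GenTheta, GenT 1, GenTheta] + dlt [GenTheta, GenT 1, GenTheta, GenT 1] \<in> I"
  by (intro dg_diffs_in_ideal dg_diffs.hecke hecke_diffs.intros dg_diffs.intros(2-); assumption)+

lemmas I_simps = I_D(3-8)

lemma I_TX': 
  assumes "i \<in> {1..<d}"
  shows "dlt [GenT i, GenX (Suc i)] - dlt [GenX i, GenT i] - dlt [] \<in> I"
proof -
  define r t :: "hgen list \<Rightarrow> 'k" where rt: "r = dlt [GenT i, GenX i] - dlt [GenX (Suc i), GenT i] + dlt []" "t = dlt [GenT i, GenT i] - dlt []"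
  then have "r \<in> I" "t \<in> I" using I_rels(1,5)[OF assms] by auto
  \<comment> \<open>Conjugation of the relator of T_i and X_i by T_i; the terms with
    \<open>t\<close> carry out the reduction by T_i^2 = 1.\<close>
  then have "- (dlt [GenT i] \<star> r \<star> dlt [GenT i]) + t \<star> dlt [GenX i, GenT i] - dlt [GenT i, GenX (Suc i)] \<star> t + t \<in> I"
    using assms by (simp add: I_simps)
  then show ?thesis by (simp add: rt conv_norm algebra_simps)
qed

lemma pol_in [simp]: "i \<in> {1..d} \<Longrightarrow> pol Q rs i \<in> FG"
  using Fr_mono[OF hecke_subset_dg pol_Fr] .

lemma dpol_in [simp]: "2 \<le> d \<Longrightarrow> dpol Q rs \<in> FG"
  by (induction rs) auto

text \<open>The centralizer of g modulo I is closed under products. With \<open>commute_add\<close>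
  and \<open>commute_shift\<close> this reduces commutation with polynomials to commutation with the
  variables.\<close>

lemma commute_conv:
  assumes "g \<star> f - f \<star> g \<in> I" "g \<star> h - h \<star> g \<in> I" "f \<in> FG" "h \<in> FG"
  shows "g \<star> (f \<star> h) - (f \<star> h) \<star> g \<in> I"
  using I_D(3)[OF I_D(8)[OF assms(1,4)] I_D(7)[OF assms(2,3)]] by (simp add: conv_norm)

lemma commute_add:
  assumes "g \<star> f - f \<star> g \<in> I" "g \<star> h - h \<star> g \<in> I"
  shows "g \<star> (f + h) - (f + h) \<star> g \<in> I"
  using I_D(3)[OF assms] by (simp add: conv_norm algebra_simps)

lemma commute_shift:
  assumes "g \<star> f - f \<star> g \<in> I"
  shows "g \<star> (f - scl c (dlt [])) - (f - scl c (dlt [])) \<star> g \<in> I"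
  using assms by (simp add: conv_norm algebra_simps)

lemma pol_commute:
  assumes "g \<star> dlt [GenX i] - dlt [GenX i] \<star> g \<in> I" "i \<in> {1..d}"
  shows "g \<star> pol Q rs i - pol Q rs i \<star> g \<in> I"
proof (induction rs)
  case (Cons r rs)
  then show ?case using assms
    by (simp only: pol_simps) (intro commute_conv commute_shift, auto)
qed (simp add: I_D(2))

lemma dpol_commute:
  assumes "g \<star> dlt [GenX 1] - dlt [GenX 1] \<star> g \<in> I" "g \<star> dlt [GenX 2] - dlt [GenX 2] \<star> g \<in> I" "2 \<le> d"
  shows "g \<star> dpol Q rs - dpol Q rs \<star> g \<in> I"
proof (induction rs)
  case (Cons r rs)
  then show ?case using assms
    by (simp only: dpol.simps) (intro commute_conv commute_shift commute_add pol_commute, auto)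
qed (simp add: I_D(2))

text \<open>The claims are proved together because the step for the third, which expresses that the
  divided difference is symmetric in X_1 and X_2, uses the first two. Each step is an explicit
  combination of the induction hypotheses and relators.\<close>

lemma dpol_props:
  assumes "2 \<le> d"
  shows "dlt [GenT 1] \<star> pol Q rs 1 - pol Q rs 2 \<star> dlt [GenT 1] + dpol Q rs \<in> I \<and>
    (dlt [GenX 2] - dlt [GenX 1]) \<star> dpol Q rs - pol Q rs 2 + pol Q rs 1 \<in> I \<and>
    dlt [GenT 1] \<star> dpol Q rs - dpol Q rs \<star> dlt [GenT 1] \<in> I"
proof (induction rs)
  case Nil
  show ?case by (simp add: I_D(2))
next
  case (Cons r rs)
  let ?T = "dlt [GenT 1]" and ?X1 = "dlt [GenX 1]" and ?X2 = "dlt [GenX 2]"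
  let ?p1 = "pol Q rs 1" and ?p2 = "pol Q rs 2" and ?d = "dpol Q rs"
  define A B C r1 r2 rX :: "hgen list \<Rightarrow> 'k" where defs: "A = ?T \<star> ?p1 - ?p2 \<star> ?T + ?d" "B = (?X2 - ?X1) \<star> ?d - ?p2 + ?p1"
    "C = ?T \<star> ?d - ?d \<star> ?T" "r1 = dlt [GenT 1, GenX 1] - dlt [GenX 2, GenT 1] + dlt []"
    "r2 = dlt [GenT 1, GenX 2] - dlt [GenX 1, GenT 1] - dlt []" "rX = dlt [GenX 1, GenX 2] - dlt [GenX 2, GenX 1]"
  have r: "r1 \<in> I" "r2 \<in> I" "rX \<in> I"
    using I_rels(5)[of 1] I_TX'[of 1] I_rels(4)[of 1 2] assms by (auto simp: numeral_2_eq_2 defs)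
  have ABC: "A \<in> I" "B \<in> I" "C \<in> I" using Cons by (auto simp: defs)
  have mem: "?T \<in> FG" "?X1 \<in> FG" "?X2 \<in> FG" "?p1 \<in> FG" "?p2 \<in> FG" "?d \<in> FG"
    using assms by auto
  have "r1 \<star> ?p1 + (?X2 \<star> A - scl (Q r) A) \<in> I"
    using r ABC mem by (simp add: I_simps)
  moreover have "(?X2 \<star> B - scl (Q r) B) - rX \<star> ?d \<in> I"
    using r ABC mem by (simp add: I_simps)
  moreover have "r2 \<star> ?d + (?X1 \<star> C - scl (Q r) C) + A - B \<star> ?T \<in> I"
    using r ABC mem by (simp add: I_simps)
  ultimately show ?case
    by (simp add: defs conv_norm algebra_simps)
qed

text \<open>With T = T_1 the derivative is TPT\<theta> - T\<theta>TP + PT\<theta>T - \<theta>TPT.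
  Moving T past P exchanges X_1 and X_2 up to \<open>dpol\<close>. As \<theta> commutes with
  polynomials in the X_i and T with \<open>dpol\<close>, all terms cancel. This is the one relation
  whose compatibility with D is not immediate.\<close>

lemma der_theta_relation:
  assumes "2 \<le> d"
  shows "D (dlt [GenT 1, GenTheta, GenT 1, GenTheta] + dlt [GenTheta, GenT 1, GenTheta, GenT 1]) \<in> I"
proof -
  let ?T = "dlt [GenT 1]" and ?th = "dlt [GenTheta]"
  define rs where "rs = [1..<l + 1]"
  let ?p1 = "pol Q rs 1" and ?p2 = "pol Q rs 2" and ?d = "dpol Q rs"
  define A A' C e f tt :: "hgen list \<Rightarrow> 'k" where defs: "A = ?T \<star> ?p1 - ?p2 \<star> ?T + ?d" "A' = ?T \<star> ?p2 - ?p1 \<star> ?T - ?d"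
    "C = ?T \<star> ?d - ?d \<star> ?T" "e = ?th \<star> ?p2 - ?p2 \<star> ?th" "f = ?th \<star> ?d - ?d \<star> ?th"
    "tt = dlt [GenT 1, GenT 1] - dlt []"
  have mem: "?T \<in> FG" "?th \<in> FG" "?p1 \<in> FG" "?p2 \<in> FG" "?d \<in> FG"
    using assms by auto
  have AC: "A \<in> I" "C \<in> I" "tt \<in> I" using dpol_props[OF assms] I_rels(1)[of 1] assms by (auto simp: defs)
  have th: "?th \<star> dlt [GenX i] - dlt [GenX i] \<star> ?th \<in> I" if "i \<in> {1..d}" for i
    using I_D(4)[OF I_rels(8)[OF that]] by simp
  have ef: "e \<in> I" "f \<in> I"
    unfolding defs using assms th by (auto intro!: pol_commute dpol_commute)
  \<comment> \<open>Conjugating \<open>A\<close> by T_1 gives the companion rule \<open>A'\<close>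
    for moving T_1 past P(X_2); here \<open>C\<close> moves T_1 past \<open>dpol\<close>.\<close>
  have "- (?T \<star> A \<star> ?T) + tt \<star> (?p1 \<star> ?T) - ?T \<star> ?p2 \<star> tt + C \<star> ?T + ?d \<star> tt \<in> I"
    using AC mem by (simp add: I_simps)
  then have A': "A' \<in> I"
    by (simp add: defs conv_norm algebra_simps)
  have "(A \<star> (?T \<star> ?th) + ?p2 \<star> tt \<star> ?th) - (?th \<star> A \<star> ?T + ?th \<star> ?p2 \<star> tt)
     + (- (A' \<star> (?th \<star> ?T)) - ?T \<star> e \<star> ?T - ?T \<star> ?th \<star> A + C \<star> ?th + ?T \<star> f) - e + f \<star> ?T \<in> I"
    using AC A' ef mem assms by (simp add: I_simps)
  moreover have "P = ?p1" by (simp only: P_def rs_def)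
  ultimately show ?thesis
    using mem by (simp add: defs der_linear conv_norm algebra_simps)
qed

lemma P_FH: "P \<in> FH" using pol_Fr[of 1 d] d1 by (simp add: P_def del: upt_Suc)

lemma P_fs [simp]: "fs P" using P_FH by (rule Fr_fs)

lemma P_FG [simp]: "P \<in> FG" using Fr_mono[OF hecke_subset_dg P_FH] .

lemma D_in: "f \<in> FG \<Longrightarrow> D f \<in> FG" by (intro der_Fr) auto

lemma D_diffs: "f \<in> dg_diffs d \<Longrightarrow> D f \<in> I"
proof (induction rule: dg_diffs.cases)
  case (hecke f)
  then show ?case using der_hecke[OF hecke_diffs_Fr[OF hecke(2)], of P] by (simp add: I_D(2))
next
  case thth
  have "dlt [GenTheta] \<star> P - P \<star> dlt [GenTheta] \<in> I"
    unfolding P_def using d1 I_D(4)[OF I_rels(8)[of 1]] by (intro pol_commute) auto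
  from I_D(4)[OF this] show ?case using thth by (simp add: der_linear)
next
  case (Xth i)
  have "dlt [GenX i] \<star> P - P \<star> dlt [GenX i] \<in> I"
    unfolding P_def using d1 Xth I_rels(4)[of i 1] by (intro pol_commute) auto
  then show ?case using Xth by (simp add: der_linear)
next
  case (Tth i)
  have "dlt [GenT i] \<star> P - P \<star> dlt [GenT i] \<in> I"
    unfolding P_def using d1 Tth I_rels(6)[of i 1] by (intro pol_commute) auto
  then show ?case using Tth by (simp add: der_linear)
next
  case TthTth
  then show ?case using der_theta_relation by simp
qed

lemma sgi_diffs: "f \<in> dg_diffs d \<Longrightarrow> sgi f = f \<or> sgi f = - f"
proof (induction rule: dg_diffs.cases)
  case (hecke f)
  then show ?case using sgi_hecke[OF hecke_diffs_Fr[OF hecke(2)]] by simp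
qed (auto simp: sgi_linear scl_distribs)

lemma D_ideal: assumes "f \<in> I" shows "D f \<in> I"
proof -
  \<comment> \<open>The condition on \<open>sgi f\<close> makes this set an ideal: the Leibniz rule
    for a product with left factor f contains the term \<open>sgi f\<close> D(g). Relators are
    homogeneous, so \<open>sgi\<close> changes them at most by a sign.\<close>
  let ?K = "{f \<in> I. sgi f \<in> I \<and> D f \<in> I}"
  have "ideal ?K (free_alg (dg_gens d))"
  proof (rule ideal_free_algI, goal_cases)
    case (5 f g)
    then have "fs f" "fs g" "f \<in> FG" "g \<in> FG" "D g \<in> FG" "sgi g \<in> FG"
      using D_in sgi_Fr[of g] by (auto intro: Fr_fs I_D(1) Fr_fs[OF I_D(1)])
    then show ?case
      using 5 by (simp add: I_simps sgi_conv der_conv)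
  next
    case (6 f g)
    then have "fs f" "fs g" "f \<in> FG" "g \<in> FG" "D g \<in> FG" "sgi g \<in> FG"
      using D_in sgi_Fr[of g] by (auto intro: Fr_fs I_D(1) Fr_fs[OF I_D(1)])
    then show ?case
      using 6 by (simp add: I_simps sgi_conv der_conv)
  qed (auto simp: I_D(1-4) der_linear sgi_linear Fr_fs[OF I_D(1)])
  moreover have "dg_diffs d \<subseteq> ?K"
    using sgi_diffs D_diffs by (auto simp: dg_diffs_in_ideal I_D) (metis I_D(4) dg_diffs_in_ideal)
  ultimately show ?thesis using dg_ideal_minimal[of ?K] assms by blast
qed

end

section \<open>Straightening modulo terms of lower weight\<close>

lemma conv_nonzero:
  assumes "(f \<star> g) w \<noteq> 0"
  obtains u v where "w = u @ v" "f u \<noteq> 0" "g v \<noteq> 0"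
proof -
  obtain i where "f (take i w) * g (drop i w) \<noteq> 0"
    using assms unfolding conv_def by (auto elim: sum.not_neutral_contains_not_neutral)
  then show thesis by (intro that[of "take i w" "drop i w"]) auto
qed

text \<open>The words in the \<open>T\<^sub>i\<close> modulo the Coxeter relations. The group of their classes need not be identified with
  the symmetric group; it is enough that it acts by permutations.\<close>

inductive weq :: "nat \<Rightarrow> nat list \<Rightarrow> nat list \<Rightarrow> bool" for d where
  refl: "u \<in> lists {1..<d} \<Longrightarrow> weq d u u"
| sym: "weq d u v \<Longrightarrow> weq d v u"
| trans: "weq d u v \<Longrightarrow> weq d v w \<Longrightarrow> weq d u w"
| sq: "p \<in> lists {1..<d} \<Longrightarrow> q \<in> lists {1..<d} \<Longrightarrow> i \<in> {1..<d} \<Longrightarrow> weq d (p @ [i, i] @ q) (p @ q)"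
| comm: "p \<in> lists {1..<d} \<Longrightarrow> q \<in> lists {1..<d} \<Longrightarrow> i \<in> {1..<d} \<Longrightarrow> j \<in> {1..<d} \<Longrightarrow>
    \<bar>int i - int j\<bar> > 1 \<Longrightarrow> weq d (p @ [i, j] @ q) (p @ [j, i] @ q)"
| braid: "p \<in> lists {1..<d} \<Longrightarrow> q \<in> lists {1..<d} \<Longrightarrow> i \<in> {1..<d} \<Longrightarrow> Suc i \<in> {1..<d} \<Longrightarrow>
    weq d (p @ [i, Suc i, i] @ q) (p @ [Suc i, i, Suc i] @ q)"

text \<open>A choice of class representative. Equivalent words define the same predicate, so
  \<open>SOME\<close> returns the same word for both.\<close>

definition wrep :: "nat \<Rightarrow> nat list \<Rightarrow> nat list" where
  "wrep d u = (SOME v. weq d u v)"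

lemma weq_lists: "weq d u v \<Longrightarrow> u \<in> lists {1..<d} \<and> v \<in> lists {1..<d}"
  by (induction rule: weq.induct) auto

lemma weq_wrep: "u \<in> lists {1..<d} \<Longrightarrow> weq d u (wrep d u)"
  unfolding wrep_def by (rule someI[of _ u]) (rule weq.refl)

lemma wrep_eq: "weq d u v \<Longrightarrow> wrep d u = wrep d v"
  unfolding wrep_def by (rule arg_cong[where f = Eps]) (auto intro: weq.intros)

lemma wrep_wrep: "u \<in> lists {1..<d} \<Longrightarrow> wrep d (wrep d u) = wrep d u"
  using wrep_eq[OF weq_wrep] by metis

lemma weq_Cons: "weq d u v \<Longrightarrow> i \<in> {1..<d} \<Longrightarrow> weq d (i # u) (i # v)"
proof (induction rule: weq.induct)
  case (sq p q j)
  then show ?case using weq.sq[of "i # p" d q j] by auto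
next
  case (comm p q j k)
  then show ?case using weq.comm[of "i # p" d q j k] by auto
next
  case (braid p q j)
  then show ?case using weq.braid[of "i # p" d q j] by auto
next
  case (refl u)
  then show ?case by (intro weq.refl) auto
qed (auto intro: weq.intros)

text \<open>The Coxeter relations are symmetric under reversal. This is needed because the
  representation below stores the letters of a word in reverse order.\<close>

lemma weq_rev: "weq d u v \<Longrightarrow> weq d (rev u) (rev v)"
proof (induction rule: weq.induct)
  case (sq p q j)
  then show ?case using weq.sq[of "rev q" d "rev p" j] by (simp add: in_lists_conv_set)
next
  case (comm p q j k)
  then show ?case using weq.comm[of "rev q" d "rev p" k j] by (simp add: in_lists_conv_set abs_minus_commute)
next
  case (braid p q j)
  then show ?case using weq.braid[of "rev q" d "rev p" j] by (simp add: in_lists_conv_set)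
next
  case (refl u)
  then show ?case by (intro weq.refl) auto
qed (auto intro: weq.intros)

abbreviation adj :: "nat \<Rightarrow> nat \<Rightarrow> nat" where "adj i \<equiv> transpose i (Suc i)"

text \<open>The word \<open>th0 n\<close> stands for \<open>\<theta>\<^sub>n\<^sub>+\<^sub>1\<close>, and \<open>thw j\<close> for \<open>\<theta>\<^sub>j\<close> when \<open>j \<ge> 1\<close>.\<close>

primrec th0 :: "nat \<Rightarrow> hgen list" where
  "th0 0 = [GenTheta]"
| "th0 (Suc n) = GenT (Suc n) # th0 n @ [GenT (Suc n)]"

definition thw :: "nat \<Rightarrow> hgen list" where "thw j = th0 (j - 1)"

definition thws :: "nat list \<Rightarrow> hgen list" where "thws J = concat (map thw J)"

lemma thws_simps [simp]: "thws [] = []" "thws (j # J) = thw j @ thws J" "thws (J @ J') = thws J @ thws J'"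
  by (simp_all add: thws_def)

text \<open>A triple \<open>(J, a, u)\<close> encodes the monomial \<open>\<theta>\<^sub>J X\<^sup>a T\<^sub>u\<close>.\<close>

type_synonym triple = "nat list \<times> nat multiset \<times> nat list"

fun nf :: "triple \<Rightarrow> hgen list" where
  "nf (J, a, u) = thws J @ map GenX (sorted_list_of_multiset a) @ map GenT u"

lemma adj_in: "i \<in> {1..<d} \<Longrightarrow> j \<in> {1..d} \<Longrightarrow> adj i j \<in> {1..d}"
  by (auto simp: transpose_def)

lemma adj_simps [simp]: "adj i i = Suc i" "adj i (Suc i) = i" by (auto simp: transpose_def)

context dg_setting begin

section \<open>The weight filtration modulo the defining ideal\<close>

definition gwt :: "hgen \<Rightarrow> nat" where
  "gwt g = (case g of GenT i \<Rightarrow> 0 | GenX i \<Rightarrow> 1 | GenTheta \<Rightarrow> l)"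

definition wt :: "hgen list \<Rightarrow> nat" where "wt w = sum_list (map gwt w)"

lemma wt_simps [simp]: "wt [] = 0" "wt (u @ v) = wt u + wt v" "wt (GenT i # w) = wt w"
   "wt (GenX i # w) = Suc (wt w)" "wt (GenTheta # w) = l + wt w"
  by (simp_all add: wt_def gwt_def)

definition Low :: "nat \<Rightarrow> (hgen list \<Rightarrow> 'k) set" where
  "Low m = {e \<in> FG. \<forall>w. e w \<noteq> 0 \<longrightarrow> wt w < m}"

text \<open>The preimage in the free algebra of the part of the DG-algebra of weight below m;
  congruence modulo \<open>L m\<close> compares leading terms of weight m.\<close>

definition L :: "nat \<Rightarrow> (hgen list \<Rightarrow> 'k) set" where
  "L m = {g + e | g e. g \<in> I \<and> e \<in> Low m}"

lemma Low_closed: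
  "0 \<in> Low m" "f \<in> Low m \<Longrightarrow> g \<in> Low m \<Longrightarrow> f + g \<in> Low m" "f \<in> Low m \<Longrightarrow> - f \<in> Low m"
  "f \<in> Low m \<Longrightarrow> scl c f \<in> Low m" "f \<in> Low m \<Longrightarrow> m \<le> n \<Longrightarrow> f \<in> Low n"
  unfolding Low_def by (auto simp: fun_applies) (metis add.right_neutral)

lemma Low_dlt [simp]: "dlt w \<in> Low m \<longleftrightarrow> w \<in> WG \<and> wt w < m"
  by (auto simp: Low_def Fr_dlt) (auto simp: dlt_def split: if_splits)

lemma Low_conv:
  assumes "f \<in> Low m" "g \<in> FG" "\<And>w. g w \<noteq> 0 \<Longrightarrow> wt w \<le> k"
  shows "f \<star> g \<in> Low (m + k)" "g \<star> f \<in> Low (m + k)"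
  using assms by (auto simp: Low_def elim!: conv_nonzero) (metis add_less_le_mono add_le_less_mono add.commute)+

lemma I_L: "f \<in> I \<Longrightarrow> f \<in> L m" unfolding L_def using Low_closed(1) by force

lemma Low_L: "f \<in> Low m \<Longrightarrow> f \<in> L m" unfolding L_def using I_D(2) by force

lemma L_closed:
  "0 \<in> L m" "f \<in> L m \<Longrightarrow> g \<in> L m \<Longrightarrow> f + g \<in> L m" "f \<in> L m \<Longrightarrow> - f \<in> L m"
  "f \<in> L m \<Longrightarrow> g \<in> L m \<Longrightarrow> f - g \<in> L m"
  "f \<in> L m \<Longrightarrow> scl c f \<in> L m" "f \<in> L m \<Longrightarrow> m \<le> n \<Longrightarrow> f \<in> L n" "f \<in> L m \<Longrightarrow> f \<in> FG"
proof -
  show "0 \<in> L m" using I_L[OF I_D(2)] .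
  show 2: "f + g \<in> L m" if fg: "f \<in> L m" "g \<in> L m" for f g
  proof -
    obtain a b a' b' where "f = a + b" "g = a' + b'" "a \<in> I" "a' \<in> I" "b \<in> Low m" "b' \<in> Low m"
      using fg unfolding L_def by blast
    then show ?thesis unfolding L_def
      by (intro CollectI exI[of _ "a + a'"] exI[of _ "b + b'"]) (auto simp: Low_closed I_D algebra_simps)
  qed
  show 3: "- f \<in> L m" if f: "f \<in> L m" for f
  proof -
    obtain a b where "f = a + b" "a \<in> I" "b \<in> Low m"
      using f unfolding L_def by blast
    then show ?thesis unfolding L_def
      by (intro CollectI exI[of _ "- a"] exI[of _ "- b"]) (auto simp: Low_closed I_D algebra_simps)
  qed
  show "f - g \<in> L m" if "f \<in> L m" "g \<in> L m" for f g
    using 2[OF that(1) 3[OF that(2)]] by simp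
  show "scl c f \<in> L m" if f: "f \<in> L m"
  proof -
    obtain a b where "f = a + b" "a \<in> I" "b \<in> Low m"
      using f unfolding L_def by blast
    then show ?thesis unfolding L_def
      by (intro CollectI exI[of _ "scl c a"] exI[of _ "scl c b"]) (auto simp: Low_closed I_D scl_distribs)
  qed
  show "f \<in> L m \<Longrightarrow> m \<le> n \<Longrightarrow> f \<in> L n"
    unfolding L_def using Low_closed(5) by blast
  show "f \<in> L m \<Longrightarrow> f \<in> FG"
    unfolding L_def Low_def using I_D(1) by auto
qed

lemma L_sum: "(\<And>i. i \<in> A \<Longrightarrow> f i \<in> L m) \<Longrightarrow> (\<Sum>i\<in>A. f i) \<in> L m"
  by (induction A rule: infinite_finite_induct) (auto simp: L_closed(1,2))

lemma L_conv:
  assumes "f \<in> L m" "g \<in> FG" "\<And>w. g w \<noteq> 0 \<Longrightarrow> wt w \<le> k"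
  shows "f \<star> g \<in> L (m + k)" "g \<star> f \<in> L (m + k)"
proof -
  obtain a b where ab: "f = a + b" "a \<in> I" "b \<in> Low m"
    using assms unfolding L_def by blast
  show "f \<star> g \<in> L (m + k)" "g \<star> f \<in> L (m + k)"
    using ab I_D(7,8)[OF ab(2) assms(2)] Low_conv[OF ab(3) assms(2,3)]
    by (auto simp: L_def conv_distribs)
qed

lemma L_conv_dlt:
  assumes "f \<in> L m" "u \<in> WG"
  shows "f \<star> dlt u \<in> L (m + wt u)" "dlt u \<star> f \<in> L (m + wt u)"
proof -
  have "wt w \<le> wt u" if "dlt u w \<noteq> (0 :: 'k)" for w
    using that by (simp add: dlt_def split: if_splits)
  then show "f \<star> dlt u \<in> L (m + wt u)" "dlt u \<star> f \<in> L (m + wt u)"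
    using L_conv[OF assms(1) Fr_dlt_lists[OF assms(2)]] by blast+
qed

text \<open>With \<open>\<epsilon> = 0\<close> this says that \<open>u\<close> vanishes in the associated graded algebra, and \<open>v\<close> is irrelevant.\<close>

definition rel :: "'k \<Rightarrow> hgen list \<Rightarrow> hgen list \<Rightarrow> bool" where
  "rel \<epsilon> u v \<longleftrightarrow> u \<in> WG \<and> v \<in> WG \<and> (\<epsilon> \<noteq> 0 \<longrightarrow> wt u = wt v) \<and>
     dlt u - scl \<epsilon> (dlt v) \<in> L (wt u)"

lemma rel_refl: "u \<in> WG \<Longrightarrow> rel 1 u u"
  by (simp add: rel_def L_closed)

lemma eqv_sym: "rel 1 u v \<Longrightarrow> rel 1 v u"
  using L_closed(3)[of "dlt u - dlt v" "wt v"] by (auto simp: rel_def)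

lemma rel_trans:
  assumes "rel \<epsilon> u v" "rel \<epsilon>' v w"
  shows "rel (\<epsilon> * \<epsilon>') u w"
proof (cases "\<epsilon> = 0")
  case False
  have "dlt u - scl \<epsilon> (dlt v) + scl \<epsilon> (dlt v - scl \<epsilon>' (dlt w)) \<in> L (wt u)"
    using assms False by (auto simp: rel_def intro!: L_closed(2,5))
  then show ?thesis using assms False by (simp add: rel_def scl_distribs)
qed (use assms in \<open>simp add: rel_def\<close>)

lemma eqv_trans [trans]: "rel 1 u v \<Longrightarrow> rel 1 v w \<Longrightarrow> rel 1 u w"
  "rel \<epsilon> u v \<Longrightarrow> rel 1 v w \<Longrightarrow> rel \<epsilon> u w" "rel 1 u v \<Longrightarrow> rel \<epsilon> v w \<Longrightarrow> rel \<epsilon> u w"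
  using rel_trans[of 1 u v 1 w] rel_trans[of \<epsilon> u v 1 w] rel_trans[of 1 u v \<epsilon> w] by simp_all

lemma rel_context:
  assumes "rel \<epsilon> u v" "p \<in> WG" "q \<in> WG"
  shows "rel \<epsilon> (p @ u @ q) (p @ v @ q)"
proof -
  have "dlt p \<star> (dlt u - scl \<epsilon> (dlt v)) \<star> dlt q \<in> L (wt u + wt p + wt q)"
    using assms by (intro L_conv_dlt) (auto simp: rel_def)
  then show ?thesis using assms by (simp add: rel_def conv_norm ac_simps)
qed

lemma eqv_append: 
  assumes "rel 1 u u'" "rel 1 v v'" shows "rel 1 (u @ v) (u' @ v')"
proof -
  have "rel 1 (u @ v) (u' @ v)" using rel_context[OF assms(1), of "[]" v] assms by (simp add: rel_def)
  also have "rel 1 \<dots> (u' @ v')" using rel_context[OF assms(2), of u' "[]"] assms by (auto simp: rel_def)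
  finally show ?thesis .
qed

lemma eqv_append_left: "p \<in> WG \<Longrightarrow> rel 1 u v \<Longrightarrow> rel 1 (p @ u) (p @ v)"
  by (intro eqv_append rel_refl)

lemma eqv_append_right: "p \<in> WG \<Longrightarrow> rel 1 u v \<Longrightarrow> rel 1 (u @ p) (v @ p)"
  by (intro eqv_append rel_refl)

lemma eqv_TT: "i \<in> {1..<d} \<Longrightarrow> rel 1 [GenT i, GenT i] []"
  using I_L[OF I_rels(1)] by (simp add: rel_def)

lemma eqv_TcT: "i \<in> {1..<d} \<Longrightarrow> j \<in> {1..<d} \<Longrightarrow> \<bar>int i - int j\<bar> > 1 \<Longrightarrow> rel 1 [GenT i, GenT j] [GenT j, GenT i]"
  using I_L[OF I_rels(2)] by (simp add: rel_def)

lemma eqv_braid: "i \<in> {1..<d} \<Longrightarrow> Suc i \<in> {1..<d} \<Longrightarrow>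
    rel 1 ([GenT i, GenT (Suc i), GenT i]) ([GenT (Suc i), GenT i, GenT (Suc i)])"
  using I_L[OF I_rels(3)] by (simp add: rel_def)

lemma eqv_XX: "i \<in> {1..d} \<Longrightarrow> j \<in> {1..d} \<Longrightarrow> rel 1 [GenX i, GenX j] [GenX j, GenX i]"
  using I_L[OF I_rels(4)] by (simp add: rel_def)

text \<open>The correction \<plusminus>1 has weight 0, below the weight 1 of T_i X_j, and disappears
  from the leading term.\<close>

lemma eqv_TX:
  assumes "i \<in> {1..<d}" "j \<in> {1..d}"
  shows "rel 1 [GenT i, GenX j] ([GenX (adj i j), GenT i])"
proof -
  have one: "dlt [] \<in> L (Suc 0)" by (intro Low_L) simp
  consider "j = i" | "j = Suc i" | "j \<noteq> i" "j \<noteq> Suc i" by blast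
  then show ?thesis
  proof cases
    case 1
    then show ?thesis
      using assms L_closed(4)[OF I_L[OF I_rels(5)[OF assms(1)]] one] by (simp add: rel_def)
  next
    case 2
    then show ?thesis
      using assms L_closed(2)[OF I_L[OF I_TX'[OF assms(1)]] one] by (simp add: rel_def)
  next
    case 3
    then show ?thesis
      using assms I_L[OF I_rels(6)[OF assms]] by (simp add: rel_def)
  qed
qed

lemma eqv_XT:
  assumes "i \<in> {1..<d}" "j \<in> {1..d}"
  shows "rel 1 [GenX j, GenT i] ([GenT i, GenX (adj i j)])"
  using eqv_sym[OF eqv_TX[OF assms(1) adj_in[OF assms]]] by simp

lemma eqv_Xth: "i \<in> {1..d} \<Longrightarrow> rel 1 [GenX i, GenTheta] [GenTheta, GenX i]"
  using I_L[OF I_rels(8)] by (simp add: rel_def)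

lemma eqv_Tth: "i \<in> {1..<d} \<Longrightarrow> i > 1 \<Longrightarrow> rel 1 [GenT i, GenTheta] [GenTheta, GenT i]"
  using I_L[OF I_rels(9)] by (simp add: rel_def)

lemma rel_thth: "rel 0 [GenTheta, GenTheta] []"
  using I_L[OF I_rels(7)] by (simp add: rel_def)

lemma rel_TthTth: "1 < d \<Longrightarrow> rel (- 1) [GenT 1, GenTheta, GenT 1, GenTheta] [GenTheta, GenT 1, GenTheta, GenT 1]"
  using I_L[OF I_rels(10)] by (simp add: rel_def scl_distribs)

section \<open>Commutation rules of \<theta>_j with T_i and X_i up to lower weight\<close>

lemma th0_in [simp]: "n < d \<Longrightarrow> th0 n \<in> WG"
  by (induction n) auto

lemma thw_in [simp]: "j \<in> {1..d} \<Longrightarrow> thw j \<in> WG"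
  unfolding thw_def by (rule th0_in) auto

lemma wt_th0 [simp]: "wt (th0 n) = l" by (induction n) auto

lemma thws_in [simp]: "set J \<subseteq> {1..d} \<Longrightarrow> thws J \<in> WG"
  by (induction J) auto

lemma wt_thws [simp]: "wt (thws J) = l * length J" by (induction J) (auto simp: thw_def)

lemma wt_T [simp]: "wt (map GenT u) = 0" by (induction u) auto

lemma wt_X [simp]: "wt (map GenX u) = length u" by (induction u) auto

lemma Xs_in: "set xs \<subseteq> {1..d} \<Longrightarrow> map GenX xs \<in> WG"
  by (induction xs) auto

lemma eqv_T_th0_step:
  assumes "i \<in> {1..<d}" "Suc n \<in> {1..<d}" "\<bar>int i - int (Suc n)\<bar> > 1"
    "rel 1 ([GenT i] @ th0 n) (th0 n @ [GenT i])"
  shows "rel 1 ([GenT i] @ th0 (Suc n)) (th0 (Suc n) @ [GenT i])"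
proof -
  have "rel 1 ([GenT i, GenT (Suc n)] @ th0 n @ [GenT (Suc n)]) ([GenT (Suc n), GenT i] @ th0 n @ [GenT (Suc n)])"
    using assms by (intro eqv_append_right eqv_TcT) auto
  also have "\<dots> = [GenT (Suc n)] @ ([GenT i] @ th0 n) @ [GenT (Suc n)]" by simp
  also have "rel 1 \<dots> ([GenT (Suc n)] @ (th0 n @ [GenT i]) @ [GenT (Suc n)])"
    using assms by (intro eqv_append_left eqv_append_right) auto
  also have "\<dots> = ([GenT (Suc n)] @ th0 n) @ [GenT i, GenT (Suc n)]" by simp
  also have "rel 1 \<dots> (([GenT (Suc n)] @ th0 n) @ [GenT (Suc n), GenT i])"
    using assms by (intro eqv_append_left eqv_TcT) auto
  finally show ?thesis by simp
qed

lemma eqv_T_th0_gt: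
  "i \<in> {1..<d} \<Longrightarrow> i > Suc n \<Longrightarrow> rel 1 ([GenT i] @ th0 n) (th0 n @ [GenT i])"
proof (induction n)
  case 0
  then show ?case using eqv_Tth by simp
next
  case (Suc n)
  then show ?case by (intro eqv_T_th0_step Suc.IH) auto
qed

text \<open>Far from the outer letter, T_i just commutes. In the critical case with a = T_i, b =
  T_(i+1) and z = \<open>th0 k\<close>, use aba = bab, move b through z, and use the braid relation
  backwards: abazab = babzab = bazbab = bazaba.\<close>

lemma eqv_T_th0_lt:
  "1 \<le> i \<Longrightarrow> i < n \<Longrightarrow> n < d \<Longrightarrow> rel 1 ([GenT i] @ th0 n) (th0 n @ [GenT i])"
proof (induction n)
  case (Suc n)
  show ?case
  proof (cases "i < n")
    case True
    then show ?thesis using Suc by (intro eqv_T_th0_step Suc.IH) auto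
  next
    case False
    then obtain k where n: "n = Suc k" and i: "i = Suc k" using Suc.prems False by (intro that[of "n - 1"]) auto
    let ?a = "GenT i" and ?b = "GenT (Suc i)"
    have [simp]: "th0 k \<in> WG" using Suc.prems i by simp
    have "rel 1 ([?a, ?b, ?a] @ th0 k @ [?a, ?b]) ([?b, ?a, ?b] @ th0 k @ [?a, ?b])"
      using Suc.prems i by (intro eqv_append_right eqv_braid) auto
    also have "\<dots> = [?b, ?a] @ ([?b] @ th0 k) @ [?a, ?b]" by simp
    also have "rel 1 \<dots> ([?b, ?a] @ (th0 k @ [?b]) @ [?a, ?b])"
      using Suc.prems i n by (intro eqv_append_left eqv_append_right eqv_T_th0_gt) auto
    also have "\<dots> = ([?b, ?a] @ th0 k) @ [?b, ?a, ?b]" by simp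
    also have "rel 1 \<dots> (([?b, ?a] @ th0 k) @ [?a, ?b, ?a])"
      using Suc.prems i n by (intro eqv_append_left eqv_sym[OF eqv_braid]) auto
    finally show ?thesis by (simp add: n i)
  qed
qed simp

lemma eqv_T_thw:
  assumes "i \<in> {1..<d}" "j \<in> {1..d}"
  shows "rel 1 ([GenT i] @ thw j) (thw (adj i j) @ [GenT i])"
proof -
  obtain n where n: "j = Suc n" using assms by (cases j) auto
  have nd: "n < d" using assms n by auto
  consider "i = Suc n" | "i = n" | "i > Suc n" | "i < n" by linarith
  then show ?thesis
  proof cases
    case 1
    have "rel 1 (([GenT i] @ th0 n) @ [GenT i, GenT i]) (([GenT i] @ th0 n) @ [])"
      using assms nd by (intro eqv_append_left eqv_TT) auto
    from eqv_sym[OF this] show ?thesis using 1 n by (simp add: thw_def)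
  next
    case 2
    then obtain k where k: "n = Suc k" using assms by (cases n) auto
    have "rel 1 ([GenT i, GenT i] @ th0 k @ [GenT i]) ([] @ th0 k @ [GenT i])"
      using assms nd k by (intro eqv_append_right eqv_TT) auto
    then show ?thesis using 2 n k by (simp add: thw_def)
  next
    case 3
    then show ?thesis using eqv_T_th0_gt[OF assms(1), of n] n by (simp add: thw_def transpose_def)
  next
    case 4
    then show ?thesis using eqv_T_th0_lt[of i n] assms n by (simp add: thw_def transpose_def)
  qed
qed

lemma eqv_T_thws:
  assumes "i \<in> {1..<d}"
  shows "set J \<subseteq> {1..d} \<Longrightarrow> rel 1 ([GenT i] @ thws J) (thws (map (adj i) J) @ [GenT i])"
proof (induction J)
  case Nil
  show ?case using assms by (auto intro!: rel_refl)
next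
  case (Cons j J)
  then have j: "j \<in> {1..d}" by auto
  have "rel 1 (([GenT i] @ thw j) @ thws J) ((thw (adj i j) @ [GenT i]) @ thws J)"
    using Cons.prems by (intro eqv_append_right eqv_T_thw assms) auto
  also have "\<dots> = thw (adj i j) @ ([GenT i] @ thws J)" by simp
  also have "rel 1 \<dots> (thw (adj i j) @ (thws (map (adj i) J) @ [GenT i]))"
    using Cons.prems by (intro eqv_append_left Cons.IH thw_in adj_in assms) auto
  finally show ?case by simp
qed

text \<open>The outer T changes the index of X by a transposition on the way in and by the same
  transposition on the way out.\<close>

lemma eqv_X_th0:
  "n < d \<Longrightarrow> j \<in> {1..d} \<Longrightarrow> rel 1 ([GenX j] @ th0 n) (th0 n @ [GenX j])"
proof (induction n arbitrary: j)
  case 0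
  then show ?case using eqv_Xth by simp
next
  case (Suc n)
  have i: "Suc n \<in> {1..<d}" using Suc.prems by auto
  let ?a = "GenT (Suc n)" and ?j = "adj (Suc n) j"
  have j: "?j \<in> {1..d}" using i Suc.prems adj_in by blast
  have "rel 1 ([GenX j, ?a] @ th0 n @ [?a]) ([?a, GenX ?j] @ th0 n @ [?a])"
    using Suc.prems by (intro eqv_append_right eqv_XT) auto
  also have "\<dots> = [?a] @ ([GenX ?j] @ th0 n) @ [?a]" by simp
  also have "rel 1 \<dots> ([?a] @ (th0 n @ [GenX ?j]) @ [?a])"
    using Suc.prems j by (intro eqv_append_left eqv_append_right Suc.IH) auto
  also have "\<dots> = ([?a] @ th0 n) @ [GenX ?j, ?a]" by simp
  also have "rel 1 \<dots> (([?a] @ th0 n) @ [?a, GenX (adj (Suc n) ?j)])"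
    using Suc.prems j by (intro eqv_append_left eqv_XT) auto
  finally show ?case by simp
qed

lemma eqv_X_thws:
  assumes "j \<in> {1..d}"
  shows "set J \<subseteq> {1..d} \<Longrightarrow> rel 1 ([GenX j] @ thws J) (thws J @ [GenX j])"
proof (induction J)
  case Nil
  show ?case using assms by (auto intro!: rel_refl)
next
  case (Cons i J)
  have "rel 1 (([GenX j] @ thw i) @ thws J) ((thw i @ [GenX j]) @ thws J)"
    unfolding thw_def[of i] by (intro eqv_append_right eqv_X_th0 thws_in) (use Cons.prems assms in auto)
  also have "\<dots> = thw i @ ([GenX j] @ thws J)" by simp
  also have "rel 1 \<dots> (thw i @ (thws J @ [GenX j]))"
    using Cons by (intro eqv_append_left) auto
  finally show ?case by simp
qed

lemma eqv_Xs_thws: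
  assumes "set J \<subseteq> {1..d}"
  shows "set xs \<subseteq> {1..d} \<Longrightarrow> rel 1 (map GenX xs @ thws J) (thws J @ map GenX xs)"
proof (induction xs)
  case Nil
  show ?case using rel_refl[OF thws_in[OF assms]] by simp
next
  case (Cons i xs)
  have Xs: "map GenX xs \<in> WG" using Cons.prems by (intro Xs_in) auto
  have "rel 1 ([GenX i] @ (map GenX xs @ thws J)) ([GenX i] @ (thws J @ map GenX xs))"
    using Cons by (intro eqv_append_left Cons.IH) auto
  also have "\<dots> = ([GenX i] @ thws J) @ map GenX xs" by simp
  also have "rel 1 \<dots> ((thws J @ [GenX i]) @ map GenX xs)"
    using Cons.prems by (intro eqv_append_right eqv_X_thws assms Xs) auto
  finally show ?case by simp
qed

lemma eqv_T_Xs: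
  assumes "i \<in> {1..<d}"
  shows "set xs \<subseteq> {1..d} \<Longrightarrow> rel 1 ([GenT i] @ map GenX xs) (map GenX (map (adj i) xs) @ [GenT i])"
proof (induction xs)
  case Nil
  show ?case using assms by (auto intro!: rel_refl)
next
  case (Cons j xs)
  have Xs: "map GenX xs \<in> WG" using Cons.prems by (intro Xs_in) auto
  have "rel 1 ([GenT i, GenX j] @ map GenX xs) ([GenX (adj i j), GenT i] @ map GenX xs)"
    using Cons.prems by (intro eqv_append_right eqv_TX assms Xs) auto
  also have "\<dots> = [GenX (adj i j)] @ ([GenT i] @ map GenX xs)" by simp
  also have "rel 1 \<dots> ([GenX (adj i j)] @ (map GenX (map (adj i) xs) @ [GenT i]))"
    using Cons.prems adj_in[OF assms, of j] by (intro eqv_append_left Cons.IH) auto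
  finally show ?case by simp
qed

lemma eqv_X_Xs:
  assumes "j \<in> {1..d}"
  shows "set xs \<subseteq> {1..d} \<Longrightarrow> rel 1 (map GenX xs @ [GenX j]) ([GenX j] @ map GenX xs)"
proof (induction xs)
  case Nil
  show ?case using assms by (auto intro!: rel_refl)
next
  case (Cons i xs)
  have Xs: "map GenX xs \<in> WG" using Cons.prems by (intro Xs_in) auto
  have "rel 1 ([GenX i] @ (map GenX xs @ [GenX j])) ([GenX i] @ ([GenX j] @ map GenX xs))"
    using Cons by (intro eqv_append_left Cons.IH) auto
  also have "\<dots> = [GenX i, GenX j] @ map GenX xs" by simp
  also have "rel 1 \<dots> ([GenX j, GenX i] @ map GenX xs)"
    using Cons.prems by (intro eqv_append_right eqv_XX assms Xs) auto
  finally show ?case by simp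
qed

lemma eqv_Xs_mset:
  "mset xs = mset ys \<Longrightarrow> set xs \<subseteq> {1..d} \<Longrightarrow> rel 1 (map GenX xs) (map GenX ys)"
proof (induction xs arbitrary: ys)
  case Nil
  then show ?case by (auto intro!: rel_refl)
next
  case (Cons x xs)
  have "x \<in> set ys" using Cons.prems(1) by (metis list.set_intros(1) set_mset_mset)
  then obtain as bs where ys: "ys = as @ x # bs" by (meson split_list)
  have xs: "mset xs = mset (as @ bs)" using Cons.prems(1) ys by simp
  have s: "set as \<subseteq> {1..d}" "set bs \<subseteq> {1..d}" "x \<in> {1..d}"
    using Cons.prems(2) arg_cong[OF Cons.prems(1), of set_mset] ys by auto
  have Bs: "map GenX bs \<in> WG" using s by (intro Xs_in)
  have "rel 1 ([GenX x] @ map GenX xs) ([GenX x] @ map GenX (as @ bs))"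
    using Cons.prems(2) by (intro eqv_append_left Cons.IH xs) auto
  also have "\<dots> = ([GenX x] @ map GenX as) @ map GenX bs" by simp
  also have "rel 1 \<dots> ((map GenX as @ [GenX x]) @ map GenX bs)"
    by (intro eqv_append_right eqv_sym[OF eqv_X_Xs] s Bs)
  finally show ?case by (simp add: ys)
qed

lemma eqv_weq: "weq d u v \<Longrightarrow> rel 1 (map GenT u) (map GenT v)"
proof (induction rule: weq.induct)
  case (sq p q i)
  have "rel 1 (map GenT p @ [GenT i, GenT i] @ map GenT q) (map GenT p @ [] @ map GenT q)"
    using sq by (intro eqv_append_left eqv_append_right eqv_TT) auto
  then show ?case by simp
next
  case (comm p q i j)
  have "rel 1 (map GenT p @ [GenT i, GenT j] @ map GenT q) (map GenT p @ [GenT j, GenT i] @ map GenT q)"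
    using comm by (intro eqv_append_left eqv_append_right eqv_TcT) auto
  then show ?case by simp
next
  case (braid p q i)
  have "rel 1 (map GenT p @ [GenT i, GenT (Suc i), GenT i] @ map GenT q) (map GenT p @ [GenT (Suc i), GenT i, GenT (Suc i)] @ map GenT q)"
    using braid by (intro eqv_append_left eqv_append_right eqv_braid) auto
  then show ?case by simp
next
  case (refl u)
  then show ?case by (intro rel_refl) auto
qed (auto intro: eqv_sym eqv_trans)


lemma eqv_conj:
  assumes "a \<in> {1..<d}" "b \<in> {1..<d}" "set J \<subseteq> {1..d}"
  shows "rel 1 ([GenT a, GenT b] @ thws J @ [GenT b, GenT a]) (thws (map (adj a) (map (adj b) J)))"
proof -
  have J: "set (map (adj b) J) \<subseteq> {1..d}" using assms(3) adj_in[OF assms(2)] by auto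
  then have J': "set (map (adj a) (map (adj b) J)) \<subseteq> {1..d}" using adj_in[OF assms(1)] by auto
  have T: "[GenT a] \<in> WG" "[GenT b] \<in> WG" using assms by auto
  have "rel 1 ([GenT a] @ ([GenT b] @ thws J) @ [GenT b, GenT a]) ([GenT a] @ (thws (map (adj b) J) @ [GenT b]) @ [GenT b, GenT a])"
    using assms by (intro eqv_append_left eqv_append_right eqv_T_thws) auto
  also have "\<dots> = ([GenT a] @ thws (map (adj b) J)) @ [GenT b, GenT b, GenT a]" by simp
  also have "rel 1 \<dots> ((thws (map (adj a) (map (adj b) J)) @ [GenT a]) @ [GenT b, GenT b, GenT a])"
    using assms by (intro eqv_append_right eqv_T_thws J) auto
  also have "\<dots> = (thws (map (adj a) (map (adj b) J)) @ [GenT a]) @ [GenT b, GenT b] @ [GenT a]" by simp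
  also have "rel 1 \<dots> ((thws (map (adj a) (map (adj b) J)) @ [GenT a]) @ [] @ [GenT a])"
    using thws_in[OF J'] T by (intro eqv_append_left eqv_append_right eqv_TT assms) auto
  also have "\<dots> = thws (map (adj a) (map (adj b) J)) @ [GenT a, GenT a]" by simp
  also have "rel 1 \<dots> (thws (map (adj a) (map (adj b) J)) @ [])"
    by (intro eqv_append_left thws_in J' eqv_TT assms)
  finally show ?thesis by simp
qed

text \<open>The case i = 1 is the defining relation between T_1 and \<theta>. Conjugation by T_i
  T_(i+1) carries the pair (i, i+1) to (i+1, i+2). Neighbouring indices suffice, since T_i disturbs
  the order of an increasing list only where i and i+1 both occur.\<close>

lemma rel_anticommute:
  "i \<in> {1..<d} \<Longrightarrow> rel (- 1) (thws [Suc i, i]) (thws [i, Suc i])"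
proof (induction i)
  case (Suc i)
  show ?case
  proof (cases "i = 0")
    case True
    then show ?thesis using rel_TthTth Suc.prems by (simp add: thw_def)
  next
    case False
    let ?b = "Suc i"
    have T: "[GenT i, GenT ?b] \<in> WG" "[GenT ?b, GenT i] \<in> WG"
      using Suc.prems False by auto
    have tr: "adj i (adj ?b i) = Suc i" "adj i (adj ?b (Suc i)) = Suc (Suc i)"
      by (auto simp: transpose_def)
    have "rel 1 (thws [Suc ?b, ?b]) ([GenT i, GenT ?b] @ thws [Suc i, i] @ [GenT ?b, GenT i])"
      using eqv_sym[OF eqv_conj[of i ?b "[Suc i, i]"]] Suc.prems False tr by (simp del: thws_simps)
    also have "rel (- 1) ([GenT i, GenT ?b] @ thws [Suc i, i] @ [GenT ?b, GenT i])
        ([GenT i, GenT ?b] @ thws [i, Suc i] @ [GenT ?b, GenT i])"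
      using Suc False by (intro rel_context T Suc.IH) auto
    also have "rel 1 ([GenT i, GenT ?b] @ thws [i, Suc i] @ [GenT ?b, GenT i]) (thws [?b, Suc ?b])"
      using eqv_conj[of i ?b "[i, Suc i]"] Suc.prems False tr by (simp del: thws_simps)
    finally show ?thesis .
  qed
qed simp

section \<open>Normal forms span the leading terms\<close>

lemma sorted_adj:
  assumes "sorted_wrt (<) J" "\<not> (i \<in> set J \<and> Suc i \<in> set J)"
  shows "sorted_wrt (<) (map (adj i) J)"
  unfolding sorted_wrt_map
proof (rule sorted_wrt_mono_rel[OF _ assms(1)])
  fix x y assume "x \<in> set J" "y \<in> set J" "x < y"
  then show "adj i x < adj i y" using assms(2) by (auto simp: transpose_def)
qed

text \<open>If i and i+1 both occur in the increasing list they are adjacent, and a single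
  anticommutation restores \<open>J\<close>; otherwise the order is preserved.\<close>

lemma sort_adj:
  assumes "sorted_wrt (<) J" "set J \<subseteq> {1..d}" "i \<in> {1..<d}"
  obtains \<epsilon> J' where "sorted_wrt (<) J'" "set J' \<subseteq> {1..d}" "rel \<epsilon> (thws (map (adj i) J)) (thws J')"
proof (cases "i \<in> set J \<and> Suc i \<in> set J")
  case False
  have "set (map (adj i) J) \<subseteq> {1..d}" using assms(2) adj_in[OF assms(3)] by auto
  then show ?thesis using sorted_adj[OF assms(1) False] that rel_refl[OF thws_in] by blast
next
  case True
  then obtain J1 J2 where J: "J = J1 @ i # J2" by (meson split_list)
  have J2: "\<forall>x\<in>set J2. i < x" "\<forall>x\<in>set J1. x < i" and s: "sorted_wrt (<) J2"
    using assms(1) J by (auto simp: sorted_wrt_append)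
  have "Suc i \<in> set J2" using True J J2 by auto
  then obtain y J3 where y: "J2 = y # J3" by (cases J2) auto
  have "y = Suc i" using J2 s \<open>Suc i \<in> set J2\<close> y by force
  have J3: "\<forall>x\<in>set J3. Suc i < x" using s y \<open>y = Suc i\<close> by auto
  have "map (adj i) J = map (adj i) J1 @ [Suc i, i] @ map (adj i) J3" by (simp add: J y \<open>y = Suc i\<close>)
  moreover have "map (adj i) J1 = J1" "map (adj i) J3 = J3" using J2 J3
    by (auto intro!: map_idI simp: transpose_def)
  ultimately have m: "map (adj i) J = J1 @ [Suc i, i] @ J3" by simp
  have "rel (- 1) (thws J1 @ thws [Suc i, i] @ thws J3) (thws J1 @ thws [i, Suc i] @ thws J3)"
    using assms(2) J y by (intro rel_context rel_anticommute assms thws_in) auto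
  then have "rel (- 1) (thws (map (adj i) J)) (thws J)" unfolding m by (simp add: J y \<open>y = Suc i\<close>)
  then show ?thesis using that assms by blast
qed

definition valid :: "triple set" where
  "valid = {(J, a, u). sorted_wrt (<) J \<and> set J \<subseteq> {1..d} \<and> set_mset a \<subseteq> {1..d} \<and>
     u \<in> lists {1..<d} \<and> wrep d u = u}"

lemma validD: "(J, a, u) \<in> valid \<Longrightarrow> sorted_wrt (<) J \<and> set J \<subseteq> {1..d} \<and> set_mset a \<subseteq> {1..d} \<and>
     u \<in> lists {1..<d} \<and> wrep d u = u"
  by (simp add: valid_def)

lemma append_listsI: "u \<in> lists G \<Longrightarrow> v \<in> lists G \<Longrightarrow> u @ v \<in> lists G"
  by simp

lemma Ts_in: "u \<in> lists {1..<d} \<Longrightarrow> map GenT u \<in> WG"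
  by (induction u) auto

lemma nf_in: "t \<in> valid \<Longrightarrow> nf t \<in> WG"
  using Xs_in[of "sorted_list_of_multiset (fst (snd t))"] Ts_in thws_in
  by (cases t) (auto simp: valid_def simp del: in_lists_conv_set intro!: append_listsI)

lemma wt_nf: "wt (nf (J, a, u)) = l * length J + size a"
  by (simp add: size_multiset_eq[symmetric] flip: size_mset)

definition red :: "hgen list \<Rightarrow> bool" where
  "red w \<longleftrightarrow> (\<exists>\<epsilon>. \<exists>t\<in>valid. rel \<epsilon> w (nf t))"

lemma red_eqv: "rel 1 u v \<Longrightarrow> red v \<Longrightarrow> red u"
  unfolding red_def using eqv_trans(3) by blast

lemma red_form:
  assumes "sorted_wrt (<) J" "set J \<subseteq> {1..d}" "set xs \<subseteq> {1..d}" "u \<in> lists {1..<d}"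
  shows "red (thws J @ map GenX xs @ map GenT u)"
proof -
  let ?xs = "sorted_list_of_multiset (mset xs)"
  have "rel 1 (thws J @ (map GenX xs @ map GenT u)) (thws J @ (map GenX ?xs @ map GenT (wrep d u)))"
    using assms by (intro eqv_append_left eqv_append eqv_Xs_mset eqv_weq weq_wrep thws_in) auto
  moreover have "(J, mset xs, wrep d u) \<in> valid"
    using assms weq_lists[OF weq_wrep] wrep_wrep by (auto simp: valid_def simp del: in_lists_conv_set)
  ultimately show ?thesis unfolding red_def by (metis append.assoc nf.simps)
qed

lemma red_step:
  assumes "t \<in> valid" "g \<in> dg_gens d"
  shows "red (g # nf t)"
proof -
  obtain J a u where t: "t = (J, a, u)" by (cases t)
  note v = validD[OF assms(1)[unfolded t]]
  let ?xs = "sorted_list_of_multiset a"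
  have xs: "set ?xs \<subseteq> {1..d}" using v by simp
  have u: "map GenT u \<in> WG" using v Ts_in by blast
  have Jin: "thws J \<in> WG" using v by (intro thws_in) auto
  show ?thesis
  proof (cases g)
    case (GenT i)
    then have i: "i \<in> {1..<d}" using assms by simp
    obtain \<epsilon> J' where J': "sorted_wrt (<) J'" "set J' \<subseteq> {1..d}" "rel \<epsilon> (thws (map (adj i) J)) (thws J')"
      using v i sort_adj by metis
    let ?ys = "map (adj i) ?xs"
    have ys: "set ?ys \<subseteq> {1..d}" using xs adj_in[OF i] by auto
    have Ti: "[GenT i] \<in> WG" using i by simp
    have "[GenT i] @ (thws J @ map GenX ?xs @ map GenT u) = ([GenT i] @ thws J) @ (map GenX ?xs @ map GenT u)" by simp
    also have "rel 1 \<dots> ((thws (map (adj i) J) @ [GenT i]) @ (map GenX ?xs @ map GenT u))"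
      using v Xs_in[OF xs] u by (intro eqv_append_right eqv_T_thws i append_listsI) auto
    also have "\<dots> = [] @ thws (map (adj i) J) @ ([GenT i] @ map GenX ?xs @ map GenT u)" by simp
    also have "rel \<epsilon> ([] @ thws (map (adj i) J) @ ([GenT i] @ map GenX ?xs @ map GenT u))
          ([] @ thws J' @ ([GenT i] @ map GenX ?xs @ map GenT u))"
      using Xs_in[OF xs] u Ti by (intro rel_context J' append_listsI) auto
    also have "[] @ thws J' @ ([GenT i] @ map GenX ?xs @ map GenT u) = thws J' @ ([GenT i] @ map GenX ?xs) @ map GenT u" by simp
    also have "rel 1 \<dots> (thws J' @ (map GenX ?ys @ [GenT i]) @ map GenT u)"
      by (intro eqv_append_left eqv_append_right eqv_T_Xs u thws_in J' xs i)
    also have "\<dots> = thws J' @ map GenX ?ys @ map GenT (i # u)" by simp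
    finally have *: "rel \<epsilon> (GenT i # nf t) (thws J' @ map GenX ?ys @ map GenT (i # u))" by (simp add: t)
    have "red (thws J' @ map GenX ?ys @ map GenT (i # u))"
      using v i by (intro red_form J' ys) auto
    then show ?thesis unfolding GenT red_def using rel_trans[OF *] by blast
  next
    case (GenX i)
    then have i: "i \<in> {1..d}" using assms by simp
    have "rel 1 (([GenX i] @ thws J) @ (map GenX ?xs @ map GenT u)) ((thws J @ [GenX i]) @ (map GenX ?xs @ map GenT u))"
      using v Xs_in[OF xs] u by (intro eqv_append_right eqv_X_thws i append_listsI) auto
    then have "rel 1 (GenX i # nf t) (thws J @ map GenX (i # ?xs) @ map GenT u)" by (simp add: t)
    moreover have "red (thws J @ map GenX (i # ?xs) @ map GenT u)"
      using v i xs by (intro red_form) auto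
    ultimately show ?thesis using red_eqv GenX by blast
  next
    case GenTheta
    show ?thesis
    proof (cases "1 \<in> set J")
      case False
      then have "sorted_wrt (<) (1 # J)" "set (1 # J) \<subseteq> {1..d}"
      proof -
        have "1 < x" if "x \<in> set J" for x
        proof -
          have "x \<in> {1..d}" "x \<noteq> 1" using that v False by auto
          then show ?thesis by simp
        qed
        then show "sorted_wrt (<) (1 # J)" "set (1 # J) \<subseteq> {1..d}" using v d1 by auto
      qed
      from red_form[OF this xs, of u] show ?thesis using v by (simp add: t GenTheta thw_def)
    next
      case True
      obtain y J' where J: "J = y # J'" using True by (cases J) auto
      have "y = 1" using True J v by force
      have J'in: "thws J' \<in> WG" using v J by (intro thws_in) auto
      \<comment> \<open>As J is increasing it starts with 1, so the word starts with
        \<theta>\<theta>. The coefficient is 0, and dropping \<theta>\<theta> merely provides some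
        valid triple on the right.\<close>
      have "rel 0 ([] @ [GenTheta, GenTheta] @ (thws J' @ map GenX ?xs @ map GenT u))
          ([] @ [] @ (thws J' @ map GenX ?xs @ map GenT u))"
        using J'in Xs_in[OF xs] u by (intro rel_context rel_thth append_listsI) auto
      then have *: "rel 0 (g # nf t) (thws J' @ map GenX ?xs @ map GenT u)"
        by (simp add: t GenTheta J \<open>y = 1\<close> thw_def)
      have "red (thws J' @ map GenX ?xs @ map GenT u)"
        using v J xs by (intro red_form) auto
      then show ?thesis unfolding red_def using rel_trans[OF *] by blast
    qed
  qed
qed

lemma red_all: "w \<in> WG \<Longrightarrow> red w"
proof (induction w)
  case Nil
  show ?case using red_form[of "[]" "[]" "[]"] by simp
next
  case (Cons g w)
  then obtain \<epsilon> t where t: "t \<in> valid" "rel \<epsilon> w (nf t)" unfolding red_def by auto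
  have "rel \<epsilon> ([g] @ w @ []) ([g] @ nf t @ [])"
    using t Cons.prems by (intro rel_context) auto
  then have *: "rel \<epsilon> (g # w) (g # nf t)" by simp
  have "red (g # nf t)" using red_step t Cons.prems by simp
  then show ?case unfolding red_def using rel_trans[OF *] by blast
qed

definition valid_at :: "nat \<Rightarrow> (triple \<Rightarrow> 'k) \<Rightarrow> bool" where
  "valid_at m c \<longleftrightarrow> fs c \<and> (\<forall>t. c t \<noteq> 0 \<longrightarrow> t \<in> valid \<and> wt (nf t) = m)"

definition Nf :: "(triple \<Rightarrow> 'k) \<Rightarrow> hgen list \<Rightarrow> 'k" where
  "Nf = lin (\<lambda>t. dlt (nf t))"

lemma valid_at_closed: "valid_at m 0" "valid_at m c \<Longrightarrow> valid_at m c' \<Longrightarrow> valid_at m (c + c')"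
   "valid_at m c \<Longrightarrow> valid_at m (scl x c)" "t \<in> valid \<Longrightarrow> wt (nf t) = m \<Longrightarrow> valid_at m (dlt t)"
  unfolding valid_at_def
proof -
  show "fs 0 \<and> (\<forall>t. (0 :: triple \<Rightarrow> 'k) t \<noteq> 0 \<longrightarrow> t \<in> valid \<and> wt (nf t) = m)"
    by (simp add: zero_fun_apply)
  assume c: "fs c \<and> (\<forall>t. c t \<noteq> 0 \<longrightarrow> t \<in> valid \<and> wt (nf t) = m)"
  then show "fs (scl x c) \<and> (\<forall>t. scl x c t \<noteq> 0 \<longrightarrow> t \<in> valid \<and> wt (nf t) = m)"
    by (auto simp: scl_apply simp del: split_paired_All nf.simps)
  assume c': "fs c' \<and> (\<forall>t. c' t \<noteq> 0 \<longrightarrow> t \<in> valid \<and> wt (nf t) = m)"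
  have "c t \<noteq> 0 \<or> c' t \<noteq> 0" if "(c + c') t \<noteq> 0" for t
    using that by (auto simp: plus_fun_apply)
  then show "fs (c + c') \<and> (\<forall>t. (c + c') t \<noteq> 0 \<longrightarrow> t \<in> valid \<and> wt (nf t) = m)"
    using c c' fs_add[of c c'] by blast
next
  assume t: "t \<in> valid" "wt (nf t) = m"
  have "t' = t" if "dlt t t' \<noteq> (0 :: 'k)" for t'
    using that by (auto simp: dlt_def split: if_splits)
  then show "fs (dlt t) \<and> (\<forall>t'. dlt t t' \<noteq> (0 :: 'k) \<longrightarrow> t' \<in> valid \<and> wt (nf t') = m)"
    using t fs_dlt[of t] by metis
qed

text \<open>Words of weight m are replaced by multiples of normal forms of the same weight, and
  lighter words are absorbed in \<open>L m\<close>. Hence the lower terms produced by straightening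
  need not be followed.\<close>

lemma spanning:
  assumes "f \<in> FG" "\<And>w. f w \<noteq> 0 \<Longrightarrow> wt w \<le> m"
  obtains c where "valid_at m c" "f - Nf c \<in> L m"
proof -
  have "fs f" using assms(1) by (rule Fr_fs)
  then have "\<exists>c. valid_at m c \<and> f - Nf c \<in> L m"
  proof (induction rule: fs_induct)
    case zero
    then show ?case by (intro exI[of _ 0]) (simp add: valid_at_closed L_closed Nf_def)
  next
    case (add g w x)
    then obtain c where c: "valid_at m c" "g - Nf c \<in> L m" by blast
    have w: "w \<in> WG" "wt w \<le> m" using add assms by (auto simp: Fr_iff)
    have "\<exists>c. valid_at m c \<and> dlt w - Nf c \<in> L m"
    proof (cases "wt w = m")
      case False
      then show ?thesis using w by (intro exI[of _ 0]) (auto simp: Nf_def valid_at_closed intro!: Low_L)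
    next
      case True
      obtain \<epsilon> t where t: "t \<in> valid" "rel \<epsilon> w (nf t)" using red_all[OF w(1)] unfolding red_def by blast
      show ?thesis
      proof (cases "\<epsilon> = 0")
        case True
        then show ?thesis using t \<open>wt w = m\<close>
          by (intro exI[of _ 0]) (auto simp: Nf_def valid_at_closed rel_def)
      next
        case False
        then show ?thesis using t \<open>wt w = m\<close>
          by (intro exI[of _ "scl \<epsilon> (dlt t)"]) (auto simp: Nf_def valid_at_closed rel_def)
      qed
    qed
    then obtain c' where c': "valid_at m c'" "dlt w - Nf c' \<in> L m" by blast
    have "scl x (dlt w - Nf c') + (g - Nf c) \<in> L m" using c c' by (intro L_closed(2,5))
    moreover have "Nf (scl x c' + c) = scl x (Nf c') + Nf c"
      using c c' by (simp add: Nf_def lin_add valid_at_def)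
    ultimately show ?case using c c' valid_at_closed
      by (intro exI[of _ "scl x c' + c"]) (auto simp: scl_distribs algebra_simps)
  qed
  then show thesis using that by blast
qed

section \<open>The leading part of the differential\<close>

definition rmk :: "nat \<Rightarrow> nat list \<Rightarrow> nat list" where
  "rmk k J = take k J @ drop (Suc k) J"

lemma rmk_simps [simp]: "rmk 0 (j # J) = J" "rmk (Suc k) (j # J) = j # rmk k J"
  by (simp_all add: rmk_def)

text \<open>The Koszul differential on exponents: \<theta>_j at position k becomes X_j^l, with the
  sign of passing the k factors before it.\<close>

definition d0 :: "triple \<Rightarrow> triple \<Rightarrow> 'k" where
  "d0 t = (case t of (J, a, u) \<Rightarrow> \<Sum>k<length J. scl ((- 1) ^ k) (dlt (rmk k J, a + replicate_mset l (J ! k), u)))"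

lemma Low_conv_dlt:
  assumes "f \<in> Low m" "u \<in> WG"
  shows "dlt u \<star> f \<in> Low (m + wt u)"
proof -
  have "wt w \<le> wt u" if "dlt u w \<noteq> (0 :: 'k)" for w
    using that by (simp add: dlt_def split: if_splits)
  then show ?thesis
    using Low_conv(2)[OF assms(1) Fr_dlt_lists[OF assms(2)]] by blast
qed

lemma pol_top: "pol Q rs 1 - dlt (replicate (length rs) (GenX 1)) \<in> Low (length rs)"
proof (induction rs)
  case (Cons r rs)
  let ?n = "length rs"
  have wr: "wt (replicate n (GenX 1)) = n" for n by (induction n) auto
  have in': "replicate n (GenX 1) \<in> WG" for n using d1 by (induction n) auto
  have "dlt [GenX 1] \<star> (pol Q rs 1 - dlt (replicate ?n (GenX 1))) \<in> Low (?n + 1)"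
    using Low_conv_dlt[OF Cons, of "[GenX 1]"] d1 by simp
  moreover have "- scl (Q r) (pol Q rs 1 - dlt (replicate ?n (GenX 1))) \<in> Low (?n + 1)"
    using Cons by (intro Low_closed(3,4) Low_closed(5)[OF Cons]) auto
  moreover have "- scl (Q r) (dlt (replicate ?n (GenX 1))) \<in> Low (?n + 1)"
    using in' wr by (intro Low_closed(3,4)) auto
  ultimately have "dlt [GenX 1] \<star> (pol Q rs 1 - dlt (replicate ?n (GenX 1))) +
    (- scl (Q r) (pol Q rs 1 - dlt (replicate ?n (GenX 1))) +
     - scl (Q r) (dlt (replicate ?n (GenX 1)))) \<in> Low (?n + 1)"
    using Low_closed(2) by blast
  then show ?case by (simp add: conv_norm algebra_simps)
qed (simp add: Low_closed)

lemma P_top_Low: "P - dlt (replicate l (GenX 1)) \<in> Low l"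
  using pol_top[of "[1..<l + 1]"] unfolding P_def by (simp del: upt_Suc)

lemmas P_top = Low_L[OF P_top_Low]

lemma P_wt:
  assumes "P w \<noteq> 0" shows "wt w \<le> l"
proof (cases "w = replicate l (GenX 1)")
  case True
  then have "w = map GenX (replicate l 1)" by (simp add: map_replicate_const)
  then show ?thesis by (simp only: wt_X) simp
next
  case False
  then have "(P - dlt (replicate l (GenX 1))) w \<noteq> 0" using assms by (simp add: fun_applies dlt_def)
  then show ?thesis using P_top_Low unfolding Low_def by fastforce
qed

text \<open>This is where the weight of \<theta> is dictated: P has weight l, so replacing \<theta>
  by P does not raise the weight.\<close>

lemma derw_wt: "derw P w v \<noteq> 0 \<Longrightarrow> wt v \<le> wt w"
proof (induction w arbitrary: v)
  case (Cons g w)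
  show ?case
  proof (cases "g = GenTheta")
    case True
    have "(P \<star> dlt w) v \<noteq> 0 \<or> (dlt [GenTheta] \<star> derw P w) v \<noteq> 0"
      using Cons.prems True by (auto simp: fun_applies)
    then show ?thesis
    proof
      assume "(P \<star> dlt w) v \<noteq> 0"
      then obtain x y where "v = x @ y" "P x \<noteq> 0" "dlt w y \<noteq> (0 :: 'k)" by (rule conv_nonzero)
      then show ?thesis using P_wt[of x] True by (simp add: dlt_def split: if_splits)
    next
      assume "(dlt [GenTheta] \<star> derw P w) v \<noteq> 0"
      then obtain x y where "v = x @ y" "dlt [GenTheta] x \<noteq> (0 :: 'k)" "derw P w y \<noteq> 0" by (rule conv_nonzero)
      then show ?thesis using Cons.IH[of y] True by (simp add: dlt_def split: if_splits)
    qed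
  next
    case False
    then have "(dlt [g] \<star> derw P w) v \<noteq> 0" using Cons.prems by (cases g) auto
    then obtain x y where "v = x @ y" "dlt [g] x \<noteq> (0 :: 'k)" "derw P w y \<noteq> 0" by (rule conv_nonzero)
    then show ?thesis using Cons.IH[of y] by (cases g) (simp_all add: dlt_def split: if_splits)
  qed
qed (simp add: fun_applies)

lemma D_wt: 
  assumes "D f v \<noteq> 0" obtains w where "f w \<noteq> 0" "wt v \<le> wt w"
proof -
  obtain w where "f w * derw P w v \<noteq> 0"
    using assms unfolding der_def lin_def by (auto elim: sum.not_neutral_contains_not_neutral)
  then show thesis using derw_wt that[of w] by auto
qed

lemma D_Low: "f \<in> Low m \<Longrightarrow> D f \<in> Low m"
  unfolding Low_def using D_in by (auto elim!: D_wt)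

lemma D_L: 
  assumes "f \<in> L m" shows "D f \<in> L m"
proof -
  obtain g e where "f = g + e" "g \<in> I" "e \<in> Low m" using assms unfolding L_def by blast
  moreover from this have "D f = D g + D e"
    using Fr_fs[OF I_D(1)[of g]] Fr_fs[of e] by (auto simp: der_linear Low_def)
  ultimately show ?thesis using D_ideal[of g] D_Low[of e m] unfolding L_def by blast
qed

text \<open>The differential commutes with conjugation by T, and conjugation by T_(n+1) turns
  X_(n+1)^l into X_(n+2)^l up to lower weight.\<close>

lemma derw_th0_top:
  "n < d \<Longrightarrow> derw P (th0 n) - dlt (replicate l (GenX (Suc n))) \<in> L l"
proof (induction n)
  case 0
  then show ?case using P_top by simp
next
  case (Suc n)
  let ?T = "GenT (Suc n)"
  have T: "[?T] \<in> WG" using Suc.prems by auto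
  have X: "set (replicate l (Suc n)) \<subseteq> {1..d}" using Suc.prems by auto
  have "dlt [?T] \<star> (derw P (th0 n) - dlt (replicate l (GenX (Suc n)))) \<star> dlt [?T] \<in> L (l + wt [?T] + wt [?T])"
    using Suc T by (intro L_conv_dlt) auto
  then have 1: "derw P (th0 (Suc n)) - dlt ([?T] @ replicate l (GenX (Suc n)) @ [?T]) \<in> L l"
    by (simp add: derw_append conv_norm)
  have "rel 1 (([?T] @ map GenX (replicate l (Suc n))) @ [?T]) ((map GenX (map (adj (Suc n)) (replicate l (Suc n))) @ [?T]) @ [?T])"
    using Suc.prems by (intro eqv_append_right eqv_T_Xs T X) auto
  also have "\<dots> = map GenX (replicate l (Suc (Suc n))) @ [?T, ?T]" by (simp add: map_replicate_const)
  also have "rel 1 \<dots> (map GenX (replicate l (Suc (Suc n))) @ [])"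
    using Suc.prems by (intro eqv_append_left eqv_TT Xs_in) auto
  finally have "dlt ([?T] @ replicate l (GenX (Suc n)) @ [?T]) - dlt (replicate l (GenX (Suc (Suc n)))) \<in> L l"
    using wt_X[of "replicate l (Suc n)"] unfolding rel_def by (auto simp: map_replicate_const simp del: wt_X)
  from L_closed(2)[OF 1 this] show ?case by simp
qed


lemma sgw_thw [simp]: "sgw (thw j) = - 1"
proof -
  have "sgw (th0 n) = - 1" for n by (induction n) auto
  then show ?thesis by (simp add: thw_def)
qed

lemma derw_thws:
  assumes "GenTheta \<notin> set R"
  shows "derw P (thws J @ R) = (\<Sum>k<length J. scl ((- 1) ^ k)
    (dlt (thws (take k J)) \<star> derw P (thw (J ! k)) \<star> dlt (thws (drop (Suc k) J) @ R)))"
proof (induction J)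
  case Nil
  show ?case using assms by (simp add: derw_hecke)
next
  case (Cons j J)
  have "derw P (thws (j # J) @ R) = derw P (thw j) \<star> dlt (thws J @ R) -
      dlt (thw j) \<star> derw P (thws J @ R)"
    using derw_append[of P "thw j" "thws J @ R"] by (simp add: scl_distribs)
  also have "dlt (thw j) \<star> derw P (thws J @ R) = (\<Sum>k<length J. scl ((- 1) ^ k)
    (dlt (thws (take (Suc k) (j # J))) \<star> derw P (thw (J ! k)) \<star> dlt (thws (drop (Suc k) J) @ R)))"
    unfolding Cons.IH conv_sum by (simp add: conv_norm)
  finally show ?case
    by (simp add: sum.lessThan_Suc_shift scl_distribs sum_negf del: sum.lessThan_Suc)
qed

lemma valid_rmk:
  assumes "(J, a, u) \<in> valid" "k < length J"
  shows "(rmk k J, a + replicate_mset l (J ! k), u) \<in> valid"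
    "wt (nf (rmk k J, a + replicate_mset l (J ! k), u)) = wt (nf (J, a, u))"
proof -
  note v = validD[OF assms(1)]
  have "sorted_wrt (<) (take k J @ J ! k # drop (Suc k) J)"
    using v assms(2) by (simp add: id_take_nth_drop[symmetric])
  then have "sorted_wrt (<) (rmk k J)" by (auto simp: rmk_def sorted_wrt_append)
  moreover have "set (rmk k J) \<subseteq> {1..d}"
    using v set_take_subset[of k J] set_drop_subset[of "Suc k" J] by (auto simp: rmk_def)
  moreover have "J ! k \<in> {1..d}" using v assms(2) nth_mem by blast
  ultimately show "(rmk k J, a + replicate_mset l (J ! k), u) \<in> valid"
    using v by (auto simp: valid_def simp del: in_lists_conv_set split: if_splits)
  have "length (rmk k J) = length J - 1" using assms(2) by (simp add: rmk_def)
  then show "wt (nf (rmk k J, a + replicate_mset l (J ! k), u)) = wt (nf (J, a, u))"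
    using assms(2) unfolding wt_nf by (cases "length J") (auto simp: algebra_simps)
qed

lemma valid_at_sum: "(\<And>i. i \<in> A \<Longrightarrow> valid_at m (c i)) \<Longrightarrow> valid_at m (\<Sum>i\<in>A. c i)"
  by (induction A rule: infinite_finite_induct) (auto simp: valid_at_closed(1,2))

lemma valid_at_lin: "(\<And>t. c t \<noteq> 0 \<Longrightarrow> valid_at m (\<phi> t)) \<Longrightarrow> valid_at m (lin \<phi> c)"
  unfolding lin_eq_sum by (rule valid_at_sum) (simp add: valid_at_closed(3))

lemma valid_at_d0: "t \<in> valid \<Longrightarrow> valid_at (wt (nf t)) (d0 t)"
  unfolding d0_def by (cases t) (auto simp del: nf.simps intro!: valid_at_sum valid_at_closed(3,4) valid_rmk)

lemma eqv_d0_term: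
  assumes "(J, a, u) \<in> valid" "k < length J"
  shows "rel 1 (thws (take k J) @ map GenX (replicate l (J ! k)) @ thws (drop (Suc k) J) @
      map GenX (sorted_list_of_multiset a) @ map GenT u)
    (nf (rmk k J, a + replicate_mset l (J ! k), u))"
proof -
  note v = validD[OF assms(1)]
  let ?xs = "replicate l (J ! k)" and ?ys = "sorted_list_of_multiset a"
  have Jk: "J ! k \<in> {1..d}" using v assms(2) nth_mem by blast
  then have xs: "set ?xs \<subseteq> {1..d}" by auto
  have ys: "set ?ys \<subseteq> {1..d}" using v by simp
  have T: "thws (take k J) \<in> WG" "thws (drop (Suc k) J) \<in> WG"
    using v set_take_subset[of k J] set_drop_subset[of "Suc k" J] by (auto intro!: thws_in simp del: in_lists_conv_set)
  have D: "set (drop (Suc k) J) \<subseteq> {1..d}" using v set_drop_subset[of "Suc k" J] by auto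
  have u: "map GenT u \<in> WG" using v Ts_in by blast
  have "rel 1 (thws (take k J) @ (map GenX ?xs @ thws (drop (Suc k) J)) @ (map GenX ?ys @ map GenT u))
     (thws (take k J) @ (thws (drop (Suc k) J) @ map GenX ?xs) @ (map GenX ?ys @ map GenT u))"
    by (intro eqv_append_left eqv_append_right eqv_Xs_thws T u Xs_in ys xs D append_listsI)
  also have "\<dots> = (thws (take k J) @ thws (drop (Suc k) J)) @ map GenX (?xs @ ?ys) @ map GenT u" by simp
  also have "rel 1 \<dots> ((thws (take k J) @ thws (drop (Suc k) J)) @
      map GenX (sorted_list_of_multiset (a + replicate_mset l (J ! k))) @ map GenT u)"
    using xs ys by (intro eqv_append_left eqv_append_right eqv_Xs_mset T u append_listsI) (auto simp: ac_simps)
  finally show ?thesis by (simp add: rmk_def)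
qed

lemma eqv_L: "rel 1 u v \<Longrightarrow> wt v = m \<Longrightarrow> dlt u - dlt v \<in> L m"
  by (auto simp: rel_def)

text \<open>In each Leibniz term, replace the derivative of \<theta>_j by X_j^l where it stands,
  then move these variables to the right with \<open>eqv_d0_term\<close>; both changes stay within
  \<open>L (wt (nf t))\<close>.\<close>

lemma D_nf:
  assumes "t \<in> valid"
  shows "D (dlt (nf t)) - Nf (d0 t) \<in> L (wt (nf t))"
proof -
  obtain J a u where t: "t = (J, a, u)" by (cases t)
  note v = validD[OF assms[unfolded t]]
  let ?R = "map GenX (sorted_list_of_multiset a) @ map GenT u"
  let ?t = "\<lambda>k. (rmk k J, a + replicate_mset l (J ! k), u)"
  let ?E = "\<lambda>k. dlt (thws (take k J)) \<star> derw P (thw (J ! k)) \<star> dlt (thws (drop (Suc k) J) @ ?R)"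
  have "D (dlt (nf t)) = (\<Sum>k<length J. scl ((- 1) ^ k) (?E k))"
    unfolding der_linear t nf.simps by (rule derw_thws) auto
  moreover have "Nf (d0 t) = (\<Sum>k<length J. scl ((- 1) ^ k) (dlt (nf (?t k))))"
    unfolding d0_def Nf_def t by (simp add: lin_sum)
  ultimately have "D (dlt (nf t)) - Nf (d0 t) = (\<Sum>k<length J. scl ((- 1) ^ k) (?E k - dlt (nf (?t k))))"
    by (simp add: scl_distribs sum_subtractf)
  moreover have "?E k - dlt (nf (?t k)) \<in> L (wt (nf t))" if k: "k < length J" for k
  proof -
    let ?X = "map GenX (replicate l (J ! k))"
    have Jk: "J ! k \<in> {1..d}" using v k nth_mem by blast
    then obtain n where n: "J ! k = Suc n" "n < d" by (cases "J ! k") auto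
    have T: "thws (take k J) \<in> WG" "thws (drop (Suc k) J) @ ?R \<in> WG"
      using v set_take_subset[of k J] set_drop_subset[of "Suc k" J] Xs_in[of "sorted_list_of_multiset a"] Ts_in[of u]
      by (auto intro!: thws_in append_listsI simp del: in_lists_conv_set)
    have "derw P (thw (J ! k)) - dlt ?X \<in> L l"
      using derw_th0_top[OF n(2)] by (simp add: thw_def n)
    then have "dlt (thws (take k J)) \<star> (derw P (thw (J ! k)) - dlt ?X) \<star> dlt (thws (drop (Suc k) J) @ ?R)
      \<in> L (l + wt (thws (take k J)) + wt (thws (drop (Suc k) J) @ ?R))"
      by (intro L_conv_dlt T)
    moreover have "l + wt (thws (take k J)) + wt (thws (drop (Suc k) J) @ ?R) = wt (nf t)"
    proof -
      have "wt (nf t) = wt (thws (take k J @ J ! k # drop (Suc k) J) @ ?R)"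
        using k by (simp add: t id_take_nth_drop[symmetric])
      also have "\<dots> = l + wt (thws (take k J)) + wt (thws (drop (Suc k) J) @ ?R)"
        by (simp add: thw_def)
      finally show ?thesis by simp
    qed
    ultimately have 1: "?E k - dlt (thws (take k J) @ ?X @ thws (drop (Suc k) J) @ ?R) \<in> L (wt (nf t))"
      by (simp add: conv_distribs)
    have r: "rel 1 (thws (take k J) @ ?X @ thws (drop (Suc k) J) @ ?R) (nf (?t k))"
      using eqv_d0_term[OF assms[unfolded t] k] by simp
    have "wt (nf (?t k)) = wt (nf t)" using valid_rmk(2)[OF assms[unfolded t] k] t by blast
    then have "dlt (thws (take k J) @ ?X @ thws (drop (Suc k) J) @ ?R) - dlt (nf (?t k)) \<in> L (wt (nf t))"
      using eqv_L[OF r] by simp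
    from L_closed(2)[OF 1 this] show ?thesis by simp
  qed
  ultimately show ?thesis by (auto intro!: L_sum L_closed(5))
qed

lemma D_Nf:
  assumes "valid_at m c"
  shows "D (Nf c) - Nf (lin d0 c) \<in> L m"
proof -
  have c: "fs c" "\<And>t. c t \<noteq> 0 \<Longrightarrow> t \<in> valid \<and> wt (nf t) = m" using assms unfolding valid_at_def by auto
  have "D (Nf c) = lin (\<lambda>t. D (dlt (nf t))) c"
    unfolding der_def Nf_def by (rule lin_lin) simp
  moreover have "Nf (lin d0 c) = lin (\<lambda>t. Nf (d0 t)) c"
    unfolding Nf_def using c valid_at_d0 unfolding valid_at_def by (intro lin_lin) blast
  ultimately have "D (Nf c) - Nf (lin d0 c) = lin (\<lambda>t. D (dlt (nf t)) - Nf (d0 t)) c"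
    by (simp add: lin_fun_diff)
  also have "\<dots> \<in> L m"
    unfolding lin_eq_sum by (intro L_sum L_closed(5)) (metis (mono_tags) c(2) D_nf mem_Collect_eq)
  finally show ?thesis .
qed

section \<open>The Koszul homotopy\<close>

text \<open>The homotopy multiplies a monomial by \<open>\<theta>\<^sub>i X\<^sub>i\<^sup>-\<^sup>\<ell>\<close> for the least \<open>i\<close> with \<open>i \<in> J\<close> or \<open>a\<^sub>i \<ge> \<ell>\<close>, and is zero if this \<open>i\<close>
  lies in \<open>J\<close>. As \<open>i\<close> is smaller than all of \<open>J\<close>, no signs arise.\<close>

definition piv :: "nat list \<Rightarrow> nat multiset \<Rightarrow> nat set" where
  "piv J a = {i. l \<le> count a i \<and> (\<forall>j\<in>set J. i < j)}"

definition htp :: "triple \<Rightarrow> triple \<Rightarrow> 'k" where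
  "htp t = (case t of (J, a, u) \<Rightarrow> if piv J a = {} then 0 else
     dlt (Min (piv J a) # J, a - replicate_mset l (Min (piv J a)), u))"

text \<open>Projection to the monomials with empty J and all exponents below l, those that survive
  in the homology of \<open>d0\<close>.\<close>

definition htp_res :: "triple \<Rightarrow> triple \<Rightarrow> 'k" where
  "htp_res t = (case t of (J, a, u) \<Rightarrow> if J = [] \<and> piv J a = {} then dlt t else 0)"

lemma finite_piv: "finite (piv J a)"
proof (rule finite_subset)
  \<comment> \<open>Because l is positive, an exponent of at least l forces the variable to occur in
    \<open>a\<close>.\<close>
  show "piv J a \<subseteq> set_mset a" using l1 by (auto simp: piv_def simp flip: count_greater_zero_iff)
qed simp

text \<open>If there is a pivot i, then a term of \<open>d0\<close> only removes some j > i from J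
  and raises the exponent of j, so the pivot stays i. All terms of \<open>d0\<close> after
  \<open>htp\<close> except the first cancel against \<open>htp\<close> after \<open>d0\<close>, and
  the first restores the monomial. If there is no pivot and J starts with i, only the term of
  \<open>d0\<close> that removes i acquires a pivot, namely i, and \<open>htp\<close> undoes it. If
  J is also empty, the monomial is residual.\<close>

lemma homotopy:
  assumes "sorted_wrt (<) J"
  shows "lin d0 (htp (J, a, u)) + lin htp (d0 (J, a, u)) + htp_res (J, a, u) = dlt (J, a, u)"
proof -
  have lin_hd: "lin htp (d0 (J, a, u)) = 
      (\<Sum>k<length J. scl ((- 1) ^ k) (htp (rmk k J, a + replicate_mset l (J ! k), u)))"
    unfolding d0_def by (simp add: lin_sum)
  have rm: "set (rmk k J) \<subseteq> set J" for k J
    using set_take_subset[of k J] set_drop_subset[of "Suc k" J] by (auto simp: rmk_def)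
  show ?thesis
  proof (cases "piv J a = {}")
    case False
    let ?i = "Min (piv J a)"
    have i: "?i \<in> piv J a" using Min_in[OF finite_piv False] .
    have imin: "?i \<le> x" if lx: "l \<le> count a x" for x
    proof (cases "x \<in> piv J a")
      case True
      then show ?thesis by (simp add: finite_piv)
    next
      case False
      then obtain j where "j \<in> set J" "j \<le> x" using lx by (auto simp: piv_def not_less)
      then show ?thesis using i by (fastforce simp: piv_def)
    qed
    have iJ: "?i < j" if "j \<in> set J" for j using i that by (auto simp: piv_def)
    have ai: "replicate_mset l ?i \<subseteq># a" using i by (simp add: piv_def count_le_replicate_mset_subset_eq)
    have h: "htp (rmk k J, a + replicate_mset l (J ! k), u) =
        dlt (?i # rmk k J, a - replicate_mset l ?i + replicate_mset l (J ! k), u)" if k: "k < length J" for k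
    proof -
      let ?S = "piv (rmk k J) (a + replicate_mset l (J ! k))"
      have Jk: "J ! k \<in> set J" using k by simp
      have iS: "?i \<in> ?S" using i rm[of k J] by (auto simp: piv_def)
      have "?i \<le> x" if "x \<in> ?S" for x
      proof (cases "x = J ! k")
        case True
        then show ?thesis using iJ[OF Jk] by simp
      next
        case False
        then show ?thesis using that imin by (auto simp: piv_def)
      qed
      then have "Min ?S = ?i" using iS by (intro Min_eqI finite_piv)
      moreover have "a + replicate_mset l (J ! k) - replicate_mset l ?i = a - replicate_mset l ?i + replicate_mset l (J ! k)"
        using ai by (simp add: subset_mset.add_diff_assoc2)
      ultimately show ?thesis using iS by (auto simp: htp_def)
    qed
    have "lin d0 (htp (J, a, u)) = d0 (?i # J, a - replicate_mset l ?i, u)"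
      using False by (simp add: htp_def)
    also have "\<dots> = dlt (J, a, u) - (\<Sum>k<length J. scl ((- 1) ^ k)
        (dlt (?i # rmk k J, a - replicate_mset l ?i + replicate_mset l (J ! k), u)))"
      using ai by (simp add: d0_def sum.lessThan_Suc_shift scl_distribs sum_negf subset_mset.diff_add del: sum.lessThan_Suc)
    also have "(\<Sum>k<length J. scl ((- 1) ^ k)
        (dlt (?i # rmk k J, a - replicate_mset l ?i + replicate_mset l (J ! k), u))) = lin htp (d0 (J, a, u))"
      unfolding lin_hd using h by (intro sum.cong) auto
    finally show ?thesis using False by (simp add: htp_res_def)
  next
    case True
    show ?thesis
    proof (cases J)
      case Nil
      then show ?thesis using True by (simp add: htp_def htp_res_def d0_def)
    next
      case (Cons i J')
      have i: "\<forall>j\<in>set J'. i < j" using assms Cons by auto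
      have small: "count a x < l" if "x < i" for x
        using True that i by (fastforce simp: piv_def Cons)
      have "htp (J', a + replicate_mset l i, u) = dlt (J, a, u)"
      proof -
        let ?S = "piv J' (a + replicate_mset l i)"
        have iS: "i \<in> ?S" using i by (auto simp: piv_def)
        have "i \<le> x" if "x \<in> ?S" for x
        proof (rule ccontr)
          assume "\<not> i \<le> x"
          then show False using small[of x] that by (auto simp: piv_def)
        qed
        then have "Min ?S = i" using iS by (intro Min_eqI finite_piv)
        then show ?thesis using iS by (auto simp: htp_def Cons)
      qed
      moreover have "htp (i # rmk k J', a + replicate_mset l (J' ! k), u) = 0" if k: "k < length J'" for k
      proof -
        have "J' ! k \<in> set J'" using k by simp
        then have "piv (i # rmk k J') (a + replicate_mset l (J' ! k)) = {}"
          using small i by (fastforce simp: piv_def)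
        then show ?thesis by (simp add: htp_def)
      qed
      ultimately have "lin htp (d0 (J, a, u)) = dlt (J, a, u)"
        unfolding lin_hd by (simp add: Cons sum.lessThan_Suc_shift del: sum.lessThan_Suc)
      then show ?thesis using True Cons by (simp add: htp_def htp_res_def)
    qed
  qed
qed

lemma valid_at_htp:
  assumes "t \<in> valid"
  shows "valid_at (wt (nf t)) (htp t)"
proof -
  obtain J a u where t: "t = (J, a, u)" by (cases t)
  note v = validD[OF assms[unfolded t]]
  show ?thesis
  proof (cases "piv J a = {}")
    case True
    then show ?thesis by (simp add: t htp_def valid_at_closed del: nf.simps)
  next
    case False
    let ?i = "Min (piv J a)"
    have i: "?i \<in> piv J a" using Min_in[OF finite_piv False] .
    have "x \<in># a" if "x \<in> piv J a" for x
      using that l1 by (auto simp: piv_def simp flip: count_greater_zero_iff)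
    then have "?i \<in> {1..d}" using v i by blast
    moreover have sub: "replicate_mset l ?i \<subseteq># a" using i by (simp add: piv_def count_le_replicate_mset_subset_eq)
    moreover have "\<forall>j\<in>set J. ?i < j" using i by (auto simp: piv_def)
    moreover have "set_mset (a - replicate_mset l ?i) \<subseteq> {1..d}" using v in_diffD by fast
    ultimately have "(?i # J, a - replicate_mset l ?i, u) \<in> valid"
      using v by (simp add: valid_def del: in_lists_conv_set)
    moreover have "wt (nf (?i # J, a - replicate_mset l ?i, u)) = wt (nf (J, a, u))"
      unfolding wt_nf using sub size_mset_mono[OF sub] by (simp add: size_Diff_submset)
    ultimately have "valid_at (wt (nf (J, a, u))) (dlt (?i # J, a - replicate_mset l ?i, u))"
      by (intro valid_at_closed(4))
    then show ?thesis using False by (simp add: t htp_def del: nf.simps)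
  qed
qed

lemma homotopy_lin:
  assumes "valid_at m c"
  shows "lin d0 (lin htp c) + lin htp (lin d0 c) + lin htp_res c = c"
proof -
  have c: "fs c" "\<And>t. c t \<noteq> 0 \<Longrightarrow> t \<in> valid \<and> wt (nf t) = m" using assms unfolding valid_at_def by auto
  have "lin d0 (lin htp c) = lin (\<lambda>t. lin d0 (htp t)) c"
    using c valid_at_htp unfolding valid_at_def by (intro lin_lin) blast
  moreover have "lin htp (lin d0 c) = lin (\<lambda>t. lin htp (d0 t)) c"
    using c valid_at_d0 unfolding valid_at_def by (intro lin_lin) blast
  ultimately have "lin d0 (lin htp c) + lin htp (lin d0 c) + lin htp_res c =
      lin (\<lambda>t. lin d0 (htp t) + lin htp (d0 t) + htp_res t) c"
    by (simp add: lin_fun_add)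
  also have "\<dots> = lin dlt c"
  proof (rule lin_cong)
    fix t assume "c t \<noteq> 0"
    then show "lin d0 (htp t) + lin htp (d0 t) + htp_res t = dlt t"
      using c(2)[of t] homotopy by (cases t) (auto simp: valid_def)
  qed
  finally show ?thesis using c by simp
qed

end

section \<open>A representation detecting leading terms\<close>

text \<open>A function on the points \<open>(m, x, js, v)\<close> is a formal series \<open>\<Sum>\<^sub>m F\<^sub>m \<lambda>\<^sup>m\<close> of functions of a tuple \<open>x\<close> of scalars, with values
  in the tensor product of alternating forms (evaluated on \<open>js\<close>) and functions on the classes of words \<open>v\<close>. The
  generator \<open>\<theta>\<close> acts by contraction, which anticommutes without any signs in its formula. The variable \<open>\<lambda>\<close> records
  degrees: an element of weight \<open>n\<close> raises the degree in \<open>\<lambda>\<close> by at most \<open>n\<close>, and its leading term by exactly \<open>n\<close>.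
  The words \<open>v\<close> make the leading part of \<open>T\<^sub>u\<close> remember the class of \<open>u\<close>. The formula for \<open>T\<^sub>i\<close> is that of the module induced
  from the subalgebra generated by the \<open>T\<^sub>i\<close>; the relations hold only at tuples with distinct entries.\<close>

type_synonym 'k pt = "int \<times> (nat \<Rightarrow> 'k) \<times> nat list \<times> nat list"

fun gact :: "nat \<Rightarrow> hgen \<Rightarrow> ('k::field pt \<Rightarrow> 'k) \<Rightarrow> 'k pt \<Rightarrow> 'k" where
  "gact l (GenT i) F (m, x, js, v) = F (m, x \<circ> adj i, map (adj i) js, i # v) +
     inverse (x (Suc i) - x i) * (F (m + 1, x, js, v) - F (m + 1, x \<circ> adj i, map (adj i) js, v))"
| "gact l (GenX i) F (m, x, js, v) = x i * F (m - 1, x, js, v)"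
| "gact l GenTheta F (m, x, js, v) = F (m - int l, x, 1 # js, v)"

definition actw :: "nat \<Rightarrow> hgen list \<Rightarrow> ('k::field pt \<Rightarrow> 'k) \<Rightarrow> 'k pt \<Rightarrow> 'k" where
  "actw l w F = foldr (gact l) w F"

definition act :: "nat \<Rightarrow> (hgen list \<Rightarrow> 'k::field) \<Rightarrow> ('k pt \<Rightarrow> 'k) \<Rightarrow> 'k pt \<Rightarrow> 'k" where
  "act l f F = lin (\<lambda>w. actw l w F) f"

text \<open>Vanishing on a repeated neighbour is a separate condition because antisymmetry does not
  imply it in characteristic 2; it gives \<theta>^2 = 0.\<close>

definition altmod :: "nat \<Rightarrow> ('k::field pt \<Rightarrow> 'k) set" where
  "altmod d = {F. (\<forall>m x us a b vs v. F (m, x, us @ a # b # vs, v) = - F (m, x, us @ b # a # vs, v)) \<and>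
     (\<forall>m x us a vs v. F (m, x, us @ a # a # vs, v) = 0) \<and>
     (\<forall>m x js u v. weq d u v \<longrightarrow> F (m, x, js, u) = F (m, x, js, v))}"

definition gpts :: "nat \<Rightarrow> 'k pt set" where
  "gpts d = {(m, x, js, v). inj_on x {1..d} \<and> v \<in> lists {1..<d}}"

lemma actw_simps [simp]: "actw l [] F = F" "actw l (g # w) F = gact l g (actw l w F)"
  "actw l (u @ v) F = actw l u (actw l v F)"
  by (simp_all add: actw_def)

lemma gact_linear: "gact l g (F + G) = gact l g F + gact l g G" "gact l g (scl c F) = scl c (gact l g F)"
    "gact l g 0 = 0"
proof -
  show "gact l g (F + G) = gact l g F + gact l g G"
  proof
    fix p show "gact l g (F + G) p = (gact l g F + gact l g G) p"
      by (cases g; cases p) (auto simp: fun_applies algebra_simps)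
  qed
  show "gact l g (scl c F) = scl c (gact l g F)"
  proof
    fix p show "gact l g (scl c F) p = scl c (gact l g F) p"
      by (cases g; cases p) (auto simp: fun_applies algebra_simps)
  qed
  show "gact l g 0 = 0"
  proof
    fix p show "gact l g 0 p = 0 p"
      by (cases g; cases p) (auto simp: fun_applies)
  qed
qed

lemma actw_linear: "actw l w (F + G) = actw l w F + actw l w G" "actw l w (scl c F) = scl c (actw l w F)"
    "actw l w 0 = 0"
  by (induction w) (auto simp: gact_linear)

lemma act_linear: "fs f \<Longrightarrow> fs g \<Longrightarrow> act l (f + g) F = act l f F + act l g F"
    "fs f \<Longrightarrow> fs g \<Longrightarrow> act l (f - g) F = act l f F - act l g F"
    "act l (scl c f) F = scl c (act l f F)" "act l (- f) F = - act l f F" "act l 0 F = 0"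
    "act l (dlt w) F = actw l w F"
  by (simp_all add: act_def lin_add lin_diff)

lemma actw_act: "fs f \<Longrightarrow> actw l w (act l f F) = lin (\<lambda>v. actw l w (actw l v F)) f"
proof (induction rule: fs_induct)
  case (add g a c)
  then show ?case by (simp add: act_linear actw_linear lin_add)
qed (simp add: act_linear actw_linear)

lemma act_conv:
  assumes "fs f" "fs g" shows "act l (f \<star> g) F = act l f (act l g F)"
  unfolding act_def[of l "f \<star> g"] using assms
  by (subst lin_conv) (auto simp: actw_act[symmetric] act_def[of l f] simp flip: actw_act)

lemma altmodD:
  assumes "F \<in> altmod d"
  shows "F (m, x, us @ a # b # vs, v) = - F (m, x, us @ b # a # vs, v)"
    "F (m, x, us @ a # a # vs, v) = 0" "weq d u v \<Longrightarrow> F (m, x, js, u) = F (m, x, js, v)"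
  using assms unfolding altmod_def by blast+

lemma altmodI:
  assumes "\<And>m x us a b vs v. F (m, x, us @ a # b # vs, v) = - F (m, x, us @ b # a # vs, v)"
    "\<And>m x us a vs v. F (m, x, us @ a # a # vs, v) = 0" 
    "\<And>m x js u v. weq d u v \<Longrightarrow> F (m, x, js, u) = F (m, x, js, v)"
  shows "F \<in> altmod d"
  using assms unfolding altmod_def by blast

lemma altmod_gact:
  assumes F: "F \<in> altmod d" and g: "g \<in> dg_gens d"
  shows "gact l g F \<in> altmod d"
proof (rule altmodI)
  fix m x us a b vs v
  show "gact l g F (m, x, us @ a # b # vs, v) = - gact l g F (m, x, us @ b # a # vs, v)"
  proof (cases g)
    case (GenT i)
    then show ?thesis
      using altmodD(1)[OF F, of _ _ "map (adj i) us" "adj i a" "adj i b" "map (adj i) vs"]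
        altmodD(1)[OF F, of _ _ us a b vs] by (simp add: algebra_simps)
  next
    case (GenX i)
    then show ?thesis using altmodD(1)[OF F, of _ _ us a b vs] by simp
  next
    case GenTheta
    then show ?thesis using altmodD(1)[OF F, of _ _ "1 # us" a b vs] by simp
  qed
next
  fix m x us a vs v
  show "gact l g F (m, x, us @ a # a # vs, v) = 0"
  proof (cases g)
    case (GenT i)
    then show ?thesis
      using altmodD(2)[OF F, of _ _ "map (adj i) us" "adj i a" "map (adj i) vs"]
        altmodD(2)[OF F, of _ _ us a vs] by simp
  next
    case (GenX i)
    then show ?thesis using altmodD(2)[OF F, of _ _ us a vs] by simp
  next
    case GenTheta
    then show ?thesis using altmodD(2)[OF F, of _ _ "1 # us" a vs] by simp
  qed
next
  fix m x js u v assume w: "weq d u v"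
  show "gact l g F (m, x, js, u) = gact l g F (m, x, js, v)"
  proof (cases g)
    case (GenT i)
    then have "weq d (i # u) (i # v)" using weq_Cons[OF w] g by simp
    then show ?thesis using altmodD(3)[OF F w] altmodD(3)[OF F \<open>weq d (i # u) (i # v)\<close>] GenT by simp
  qed (use altmodD(3)[OF F w] in simp_all)
qed

lemma altmod_actw: "F \<in> altmod d \<Longrightarrow> w \<in> lists (dg_gens d) \<Longrightarrow> actw l w F \<in> altmod d"
  by (induction w) (auto intro: altmod_gact)

lemma altmod_0: "0 \<in> altmod d" by (rule altmodI) (auto simp: fun_applies)

lemma altmod_lincomb:
  assumes "F \<in> altmod d" "G \<in> altmod d" shows "scl c F + G \<in> altmod d"
proof (rule altmodI)
  fix m x us a b vs v
  show "(scl c F + G) (m, x, us @ a # b # vs, v) = - (scl c F + G) (m, x, us @ b # a # vs, v)"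
    using altmodD(1)[OF assms(1), of m x us a b vs v] altmodD(1)[OF assms(2), of m x us a b vs v]
    by (simp add: fun_applies)
qed (use altmodD(2,3)[OF assms(1)] altmodD(2,3)[OF assms(2)] in \<open>simp_all add: fun_applies\<close>)

lemma altmod_act: 
  assumes "F \<in> altmod d" "f \<in> Fr (dg_gens d)" shows "act l f F \<in> altmod d"
proof -
  have "fs f" using assms by (simp add: Fr_fs)
  then show ?thesis
  proof (induction rule: fs_induct)
    case zero
    then show ?case by (simp add: act_linear altmod_0)
  next
    case (add g w c)
    then have "w \<in> lists (dg_gens d)" using assms(2) by (auto simp: Fr_iff)
    then show ?case using add assms by (simp add: act_linear altmod_lincomb altmod_actw)
  qed
qed

text \<open>The value at a point of \<open>gpts\<close> involves only points of \<open>gpts\<close>: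
  permuting a tuple keeps its entries distinct, and prepending an admissible letter keeps the word
  admissible.\<close>

lemma gact_vanish:
  assumes "\<And>p. p \<in> gpts d \<Longrightarrow> F p = 0" "g \<in> dg_gens d" "p \<in> gpts d"
  shows "gact l g F p = 0"
proof -
  obtain m x js v where p: "p = (m, x, js, v)" by (cases p)
  have x: "inj_on x {1..d}" and v: "v \<in> lists {1..<d}" using assms(3) by (auto simp: gpts_def p)
  have F: "F (m, x, js, v) = 0" for m js using assms(1) x v by (simp add: gpts_def)
  show ?thesis
  proof (cases g)
    case (GenT i)
    then have i: "i \<in> {1..<d}" using assms by simp
    have "adj i ` {1..d} \<subseteq> {1..d}" using adj_in[OF i] by auto
    then have "inj_on (x \<circ> adj i) {1..d}"
      using x by (intro comp_inj_on) (auto intro: inj_on_subset)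
    then have "F (m, x \<circ> adj i, js, v) = 0" "F (m, x \<circ> adj i, js, i # v) = 0" for m js
      using assms(1) v i by (auto simp: gpts_def)
    then show ?thesis using F by (simp add: p GenT)
  qed (use F in \<open>simp_all add: p\<close>)
qed

lemma actw_vanish:
  "(\<And>p. p \<in> gpts d \<Longrightarrow> F p = 0) \<Longrightarrow> w \<in> lists (dg_gens d) \<Longrightarrow> p \<in> gpts d \<Longrightarrow> actw l w F p = 0"
proof (induction w arbitrary: p)
  case (Cons g w)
  have g: "g \<in> dg_gens d" and w: "w \<in> lists (dg_gens d)" using Cons.prems(2) by auto
  have "actw l w F q = 0" if "q \<in> gpts d" for q
    by (rule Cons.IH[OF _ w that]) (rule Cons.prems(1))
  from gact_vanish[OF this g Cons.prems(3)] show ?case by simp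
qed simp

lemma act_vanish:
  assumes "\<And>p. p \<in> gpts d \<Longrightarrow> F p = 0" "f \<in> Fr (dg_gens d)" "p \<in> gpts d"
  shows "act l f F p = 0"
  unfolding act_def lin_def using assms(2)
  by (intro sum.neutral) (auto simp: Fr_iff intro!: actw_vanish assms(1,3) simp del: in_lists_conv_set)

lemma adj_simps2 [simp]: "adj i (Suc (Suc i)) = Suc (Suc i)" "adj (Suc i) i = i"
   "adj (Suc i) (Suc (Suc i)) = Suc i" "adj (Suc i) (Suc i) = Suc (Suc i)"
  by (auto simp: transpose_def)

lemma adj_comp [simp]: "adj i \<circ> adj i = id" "f \<circ> adj i \<circ> adj i = f" "adj i \<circ> (adj i \<circ> h) = h"
  by (auto simp: fun_eq_iff)

lemma adj_braid: "adj (Suc i) \<circ> adj i \<circ> adj (Suc i) = adj i \<circ> adj (Suc i) \<circ> adj i"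
  by (auto simp: fun_eq_iff transpose_def)

lemma adj_commute: "Suc i < j \<or> Suc j < i \<Longrightarrow> adj j \<circ> adj i = adj i \<circ> adj j"
  by (auto simp: fun_eq_iff transpose_def)

lemma adj_commute': "Suc i < j \<or> Suc j < i \<Longrightarrow> f \<circ> adj j \<circ> adj i = f \<circ> adj i \<circ> adj j"
  using adj_commute[of i j] by (metis comp_assoc)

lemma gact_braid:
  fixes F :: "'k::field pt \<Rightarrow> 'k"
  assumes F: "F \<in> altmod d" and i: "i \<in> {1..<d}" "Suc i \<in> {1..<d}" and p: "p \<in> gpts d"
  shows "actw l [GenT i, GenT (Suc i), GenT i] F p = actw l [GenT (Suc i), GenT i, GenT (Suc i)] F p"
proof -
  obtain m x js v where pp: "p = (m, x, js, v)" by (cases p)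
  have x: "inj_on x {1..d}" and v: "v \<in> lists {1..<d}" using p by (auto simp: gpts_def pp)
  let ?j = "Suc i"
  have ne: "x (Suc i) \<noteq> x i" "x (Suc (Suc i)) \<noteq> x (Suc i)" "x (Suc (Suc i)) \<noteq> x i"
    using x i by (auto dest!: inj_onD)
  define \<alpha> \<beta> \<gamma> where abc: "\<alpha> = inverse (x (Suc i) - x i)" "\<beta> = inverse (x (Suc (Suc i)) - x (Suc i))"
    "\<gamma> = inverse (x (Suc (Suc i)) - x i)"
  have neg: "inverse (x i - x (Suc i)) = - \<alpha>" "inverse (x (Suc i) - x (Suc (Suc i))) = - \<beta>"
    "inverse (x i - x (Suc (Suc i))) = - \<gamma>"
    unfolding abc by (metis inverse_minus_eq minus_diff_eq)+
  \<comment> \<open>Partial fractions for three distinct entries; this identity is what makes the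
    braid relation hold.\<close>
  have key: "\<alpha> * \<beta> = \<gamma> * (\<alpha> + \<beta>)" unfolding abc using ne by (simp add: field_simps)
  have w: "F (m, y, ks, i # i # v) = F (m, y, ks, v)" "F (m, y, ks, ?j # ?j # v) = F (m, y, ks, v)"
     "F (m, y, ks, ?j # i # ?j # v) = F (m, y, ks, i # ?j # i # v)" for m y ks
    using altmodD(3)[OF F weq.sq[of "[]" d v i]] altmodD(3)[OF F weq.sq[of "[]" d v ?j]]
       altmodD(3)[OF F weq.braid[of "[]" d v i]] v i by auto
  have br: "x \<circ> adj ?j \<circ> adj i \<circ> adj ?j = x \<circ> adj i \<circ> adj ?j \<circ> adj i"
    using adj_braid[of i] by (metis comp_assoc)
  have br': "adj ?j \<circ> (adj i \<circ> adj ?j) = adj i \<circ> (adj ?j \<circ> adj i)"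
    using adj_braid[of i] by (metis comp_assoc)
  let ?x = "x \<circ> adj i \<circ> adj ?j \<circ> adj i" and ?J = "map (adj i \<circ> (adj ?j \<circ> adj i)) js"
  \<comment> \<open>The purely permuting terms agree by the braid relations for transpositions and
    for words; everything else has the factor that \<open>key\<close> makes zero.\<close>
  have "actw l [GenT i, GenT ?j, GenT i] F p - actw l [GenT ?j, GenT i, GenT ?j] F p =
    (\<alpha> * \<beta> - \<gamma> * (\<alpha> + \<beta>)) *
    (F (2 + m, x \<circ> adj i, map (adj i) js, i # v) - F (2 + m, x \<circ> adj ?j, map (adj ?j) js, ?j # v)
     - F (2 + m, ?x, ?J, i # v) + F (2 + m, ?x, ?J, ?j # v) + (\<alpha> - \<beta>) * F (3 + m, x, js, v)
     + \<beta> * F (3 + m, x \<circ> adj ?j, map (adj ?j) js, v) - \<alpha> * F (3 + m, x \<circ> adj i, map (adj i) js, v))"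
    by (simp add: pp w br br' neg abc[symmetric]) (simp add: algebra_simps)
  then show ?thesis using key by simp
qed

lemma gact_dg_diffs:
  fixes F :: "'k::field pt \<Rightarrow> 'k"
  assumes F: "F \<in> altmod d" and p: "p \<in> gpts d" and f: "f \<in> dg_diffs d"
  shows "act l f F p = 0"
proof -
  obtain m x js v where pp: "p = (m, x, js, v)" by (cases p)
  have x: "inj_on x {1..d}" and v: "v \<in> lists {1..<d}" using p by (auto simp: gpts_def pp)
  have w: "weq d u u' \<Longrightarrow> F (m, y, ks, u) = F (m, y, ks, u')" for m y ks u u'
    using altmodD(3)[OF F] .
  have ne: "x i \<noteq> x j" if "i \<in> {1..d}" "j \<in> {1..d}" "i \<noteq> j" for i j
    using inj_onD[OF x, of i j] that by blast
  have neg: "inverse (a - b) = - inverse (b - a)" for a b :: 'k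
    by (metis inverse_minus_eq minus_diff_eq)
  note act = act_linear fun_applies pp
  from f show ?thesis
  proof cases
    case hecke
    then show ?thesis
    proof cases
      case (TT i)
      have "F (m, y, ks, i # i # v) = F (m, y, ks, v)" for m y ks
        using w[OF weq.sq[of "[]" d v i]] v TT by simp
      then show ?thesis using neg[of "x i" "x (Suc i)"] by (simp add: TT act algebra_simps)
    next
      case (TcT i j)
      have F': "F (m, y, ks, i # j # v) = F (m, y, ks, j # i # v)" for m y ks
        using w[OF weq.comm[of "[]" d v i j]] v TcT by simp
      have ij: "Suc i < j \<or> Suc j < i" using TcT by auto
      then have a: "adj i j = j" "adj i (Suc j) = Suc j" "adj j i = i" "adj j (Suc i) = Suc i"
        by (auto simp: transpose_def)
      show ?thesis using ij
        by (simp add: TcT act F' a adj_commute[OF ij] adj_commute'[OF ij] algebra_simps)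
    next
      case (TTT i)
      then show ?thesis using gact_braid[OF F TTT(2,3) p, of l] by (simp add: act_linear fun_applies del: actw_simps)
    next
      case (XX i j)
      then show ?thesis by (simp add: act)
    next
      case (TX i)
      have "x (Suc i) - x i \<noteq> 0" using ne[of "Suc i" i] TX by simp
      then show ?thesis by (simp add: TX act field_simps)
    next
      case (TcX i j)
      then have "adj i j = j" by (simp add: transpose_def)
      then show ?thesis by (simp add: TcX act algebra_simps)
    qed
  next
    case thth
    then show ?thesis using altmodD(2)[OF F, of _ _ "[]"] by (simp add: act)
  next
    case (Xth i)
    show ?thesis by (simp add: Xth act algebra_simps)
  next
    case (Tth i)
    then have "adj i (Suc 0) = Suc 0" by (simp add: transpose_def)
    then show ?thesis by (simp add: Tth act algebra_simps)
  next
    case TthTth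
    have a: "adj (Suc 0) (Suc 0) = Suc (Suc 0)" "adj (Suc 0) (Suc (Suc 0)) = Suc 0" by auto
    have "F (m, y, ks, 1 # 1 # v) = F (m, y, ks, v)" for m y ks
      using w[OF weq.sq[of "[]" d v 1]] v TthTth by simp
    moreover have "F (m, y, Suc (Suc 0) # Suc 0 # ks, u) = - F (m, y, Suc 0 # Suc (Suc 0) # ks, u)" 
        "F (m, y, j # j # ks, u) = 0" for m y ks u j
      using altmodD(1)[OF F, of m y "[]" "Suc (Suc 0)" "Suc 0" ks u] altmodD(2)[OF F, of m y "[]" j ks u] by simp_all
    ultimately show ?thesis using neg[of "x (Suc 0)" "x (Suc (Suc 0))"] by (simp add: TthTth act a algebra_simps)
  qed
qed

text \<open>Closure under left factors uses that vanishing on \<open>gpts\<close> is preserved by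
  the action, closure under right factors that \<open>altmod d\<close> is preserved. Hence the
  vanishing is required for all F in \<open>altmod d\<close> at once.\<close>

lemma act_dg_ideal:
  fixes F :: "'k::field pt \<Rightarrow> 'k"
  assumes "f \<in> dg_ideal d" "F \<in> altmod d" "p \<in> gpts d"
  shows "act l f F p = 0"
proof -
  let ?K = "{f \<in> Fr (dg_gens d). \<forall>F\<in>altmod d. \<forall>p\<in>gpts d. act l f F p = (0 :: 'k)}"
  have "ideal ?K (free_alg (dg_gens d))"
  proof (rule ideal_free_algI, goal_cases)
    case (5 f g)
    then have fs: "fs f" "fs g" by (auto intro: Fr_fs)
    have "act l (g \<star> f) F p = 0" if F: "F \<in> altmod d" and p: "p \<in> gpts d" for F p
    proof -
      have "act l g (act l f F) p = 0" by (rule act_vanish[OF _ 5(2) p]) (use 5(1) F in blast)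
      then show ?thesis using fs by (simp add: act_conv)
    qed
    then show ?case using 5 by simp
  next
    case (6 f g)
    then have fs: "fs f" "fs g" by (auto intro: Fr_fs)
    then show ?case using 6 by (simp add: act_conv altmod_act)
  qed (auto simp: act_linear Fr_fs[of _ "dg_gens d"] fun_applies)
  moreover have "dg_diffs d \<subseteq> ?K" using gact_dg_diffs dg_diffs_Fr by blast
  ultimately show ?thesis using dg_ideal_minimal assms by blast
qed

section \<open>Independence of monomials as functions on tuples of distinct scalars\<close>

text \<open>Over a finite field the product of all X - a, plus 1, is a nonconstant polynomial
  without roots.\<close>

lemma infinite_alg_closed: "infinite (UNIV :: 'a::alg_closed_field set)"
proof
  assume fin: "finite (UNIV :: 'a set)"
  let ?p = "(\<Prod>a\<in>(UNIV :: 'a set). [:- a, 1:]) + 1"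
  have "degree (\<Prod>a\<in>(UNIV :: 'a set). [:- a, 1:]) = card (UNIV :: 'a set)"
    by (subst degree_prod_eq_sum_degree) auto
  moreover have "card (UNIV :: 'a set) > 0" using fin by (simp add: card_gt_0_iff)
  ultimately have "degree ?p > 0" by (subst degree_add_eq_left) auto
  then obtain x where "poly ?p x = 0" using alg_closed_imp_poly_has_root by blast
  moreover have "poly (\<Prod>a\<in>(UNIV :: 'a set). [:- a, 1:]) x = 0"
    using fin by (auto simp: poly_prod intro!: prod_zero bexI[of _ x])
  ultimately show False by simp
qed

definition mon :: "(nat \<Rightarrow> 'k::comm_monoid_mult) \<Rightarrow> nat multiset \<Rightarrow> 'k" where
  "mon x a = prod_mset (image_mset x a)"

lemma mon_cong: "(\<And>i. i \<in># a \<Longrightarrow> x i = y i) \<Longrightarrow> mon x a = mon y a"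
  unfolding mon_def by (metis image_mset_cong)

lemma mon_add [simp]: "mon x (a + b) = mon x a * mon x b" "mon x (replicate_mset n i) = x i ^ n"
  "mon x {#} = 1"
  by (simp_all add: mon_def)

text \<open>Induction on the number of variables. For fixed distinct x_1, ..., x_n the relation is a
  polynomial in the last variable.\<close>

lemma monomials_independent:
  fixes c :: "nat multiset \<Rightarrow> 'k::alg_closed_field"
  assumes "finite A" "\<And>a. a \<in> A \<Longrightarrow> set_mset a \<subseteq> {1..n}"
    "\<And>x. inj_on x {1..n} \<Longrightarrow> (\<Sum>a\<in>A. c a * mon x a) = 0" "b \<in> A"
  shows "c b = 0"
  using assms
proof (induction n arbitrary: A c b)
  case 0
  then have A: "A \<subseteq> {{#}}" "b = {#}" by auto
  then have "A = {{#}}" using 0 by auto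
  then show ?case using 0(3)[of "\<lambda>_. 0"] A by simp
next
  case (Suc n)
  let ?s = "Suc n"
  define r :: "nat multiset \<Rightarrow> nat multiset" where "r a = filter_mset (\<lambda>i. i \<noteq> ?s) a" for a
  have split: "a = r a + replicate_mset (count a ?s) ?s" for a
    unfolding r_def by (rule multiset_eqI) auto
  have r_in: "set_mset (r a) \<subseteq> {1..n}" if "a \<in> A" for a
    using Suc.prems(2)[OF that] by (fastforce simp: r_def le_Suc_eq)
  let ?k = "count b ?s"
  define A' where "A' = {a \<in> A. count a ?s = ?k}"
  have inj: "inj_on r A'"
  proof (rule inj_onI)
    fix x y assume "x \<in> A'" "y \<in> A'" "r x = r y"
    then have "r x + replicate_mset (count x ?s) ?s = r y + replicate_mset (count y ?s) ?s"
      by (simp add: A'_def)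
    then show "x = y" unfolding split[symmetric] .
  qed
  have "(\<Sum>a\<in>r ` A'. c (a + replicate_mset ?k ?s) * mon x a) = 0" if x: "inj_on x {1..n}" for x
  proof -
    define p where "p = (\<Sum>a\<in>A. Polynomial.monom (c a * mon x (r a)) (count a ?s))"
    have "poly p z = 0" if z: "z \<notin> x ` {1..n}" for z
    proof -
      define y where "y = x(?s := z)"
      have "{1..?s} = insert ?s {1..n}" by auto
      then have "inj_on y {1..?s}" using x z by (simp add: y_def inj_on_fun_updI fun_upd_image)
      then have "(\<Sum>a\<in>A. c a * mon y a) = 0" by (rule Suc.prems(3))
      moreover have "mon y a = mon x (r a) * z ^ count a ?s" for a
      proof -
        have "mon y (r a) = mon x (r a)" by (rule mon_cong) (auto simp: y_def r_def)
        then show ?thesis using arg_cong[OF split[of a], of "mon y"] by (simp add: y_def)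
      qed
      ultimately show ?thesis by (simp add: p_def poly_sum poly_monom mult.assoc)
    qed
    \<comment> \<open>The last entry only has to avoid n values, so the polynomial has infinitely
      many roots; the coefficient at the exponent occurring in b then yields a relation in n
      variables.\<close>
    then have "- x ` {1..n} \<subseteq> {z. poly p z = 0}" by auto
    moreover have "infinite (- x ` {1..n} :: 'k set)"
      using infinite_alg_closed by (metis Compl_eq_Diff_UNIV Diff_infinite_finite finite_atLeastAtMost finite_imageI)
    ultimately have "p = 0" using poly_roots_finite[of p] finite_subset by blast
    then have "Polynomial.coeff p ?k = 0" by simp
    then have "(\<Sum>a\<in>A. if count a ?s = ?k then c a * mon x (r a) else 0) = 0"
      by (simp add: p_def coeff_sum)
    then have "(\<Sum>a\<in>A'. c a * mon x (r a)) = 0"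
      using Suc.prems(1) by (simp add: A'_def sum.inter_filter)
    moreover have "(\<Sum>a\<in>A'. c a * mon x (r a)) = (\<Sum>a\<in>A'. c (r a + replicate_mset ?k ?s) * mon x (r a))"
    proof (rule sum.cong)
      fix a assume "a \<in> A'"
      then have "r a + replicate_mset ?k ?s = a" using split[of a] by (simp add: A'_def)
      then show "c a * mon x (r a) = c (r a + replicate_mset ?k ?s) * mon x (r a)" by simp
    qed simp
    ultimately show ?thesis by (simp add: sum.reindex[OF inj])
  qed
  moreover have "finite (r ` A')" "\<And>a. a \<in> r ` A' \<Longrightarrow> set_mset a \<subseteq> {1..n}" "r b \<in> r ` A'"
    using Suc.prems(1,4) r_in by (auto simp: A'_def)
  ultimately have "c (r b + replicate_mset ?k ?s) = 0"
    using Suc.IH[of "r ` A'" "\<lambda>a. c (a + replicate_mset ?k ?s)" "r b"] by blast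
  then show ?case using split[of b] by simp
qed

section \<open>Linear independence of leading terms\<close>

primrec invs :: "nat list \<Rightarrow> nat" where
  "invs [] = 0"
| "invs (a # js) = length (filter (\<lambda>b. b < a) js) + invs js"

text \<open>The basis alternating form belonging to the index set K, with value the sign of the
  permutation that sorts the arguments.\<close>

definition altf :: "nat set \<Rightarrow> nat list \<Rightarrow> 'k::field" where
  "altf K js = (if distinct js \<and> set js = K then (- 1) ^ invs js else 0)"

lemma invs_swap:
  "a \<noteq> b \<Longrightarrow> (- 1 :: 'k::field) ^ invs (us @ a # b # vs) = - ((- 1) ^ invs (us @ b # a # vs))"
proof (induction us)
  case Nil
  then show ?case by (cases "a < b") (auto simp: power_add)
next
  case (Cons u us)
  have "length (filter (\<lambda>c. c < u) (us @ a # b # vs)) = length (filter (\<lambda>c. c < u) (us @ b # a # vs))" by simp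
  then show ?case using Cons by (simp add: power_add)
qed

lemma altf_swap: "altf K (us @ a # b # vs) = - (altf K (us @ b # a # vs) :: 'k::field)"
proof (cases "a = b")
  case False
  have s: "set (us @ a # b # vs) = set (us @ b # a # vs)" by auto
  have d: "distinct (us @ a # b # vs) \<longleftrightarrow> distinct (us @ b # a # vs)" by auto
  show ?thesis unfolding altf_def s d using invs_swap[OF False, where 'k = 'k] by auto
qed (simp add: altf_def)

text \<open>A test vector: it sits in \<lambda>-degree 0, does not depend on the tuple, and picks
  out one index set K and one class of words.\<close>

definition detf :: "nat \<Rightarrow> nat set \<Rightarrow> nat list \<Rightarrow> 'k::field pt \<Rightarrow> 'k" where
  "detf d K w = (\<lambda>(m, x, js, v). if m = 0 \<and> weq d v w then altf K js else 0)"

lemma detf_altmod: "(detf d K w :: 'k::field pt \<Rightarrow> 'k) \<in> altmod d"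
proof (rule altmodI)
  fix m x js u v assume "weq d u v"
  then have "weq d u w \<longleftrightarrow> weq d v w" using weq.sym weq.trans by blast
  then show "detf d K w (m, x, js, u) = (detf d K w (m, x, js, v) :: 'k)" by (simp add: detf_def)
next
  fix m x us a b vs v
  show "detf d K w (m, x, us @ a # b # vs, v) = (- detf d K w (m, x, us @ b # a # vs, v) :: 'k)"
    using altf_swap[of K us a b vs, where 'k = 'k] by (simp add: detf_def)
qed (simp add: detf_def altf_def)

text \<open>The permutation applied to form arguments by the leading part of T_u; the first letter
  of u acts on the arguments first.\<close>

primrec prm :: "nat list \<Rightarrow> nat \<Rightarrow> nat" where
  "prm [] = id"
| "prm (i # u) = prm u \<circ> adj i"

lemma inj_prm: "inj (prm u)"
proof (induction u)
  case (Cons i u)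
  have "inj (adj i)" by (rule inj_on_inverseI[of _ "adj i"]) simp
  with Cons show ?case unfolding prm.simps by (rule inj_compose)
qed simp

definition lowdeg :: "int \<Rightarrow> ('k::field pt \<Rightarrow> 'k) \<Rightarrow> bool" where
  "lowdeg k F \<longleftrightarrow> (\<forall>m x js v. k < m \<longrightarrow> F (m, x, js, v) = 0)"

context dg_setting begin

text \<open>To compute degree m, T_i reads its argument in degrees m and m + 1, X_i in degree m - 1
  and \<theta> in degree m - l. So the top degree rises by at most the weight.\<close>

lemma lowdeg_gact: "lowdeg k F \<Longrightarrow> lowdeg (k + int (gwt g)) (gact l g F)"
  by (cases g) (auto simp: lowdeg_def gwt_def)

lemma lowdeg_actw: "lowdeg k F \<Longrightarrow> lowdeg (k + int (wt w)) (actw l w F)"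
proof (induction w)
  case (Cons g w)
  from lowdeg_gact[OF Cons.IH[OF Cons.prems], of g] show ?case
    by (simp add: wt_def algebra_simps)
qed simp

text \<open>In degree k the divided difference reads degree k + 1, where F vanishes, so only the
  permuting part survives. The permuted tuple may stay anonymous because \<open>detf\<close> ignores
  it.\<close>

lemma actw_Ts:
  "lowdeg k F \<Longrightarrow> \<exists>y. actw l (map GenT u) F (k, x, js, v) = F (k, y, map (prm u) js, rev u @ v)"
proof (induction u arbitrary: x js v)
  case (Cons i u)
  have "lowdeg k (actw l (map GenT u) F)" using lowdeg_actw[OF Cons.prems, of "map GenT u"] by simp
  then have "actw l (map GenT (i # u)) F (k, x, js, v) = actw l (map GenT u) F (k, x \<circ> adj i, map (adj i) js, i # v)"
    by (simp add: lowdeg_def)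
  moreover obtain y where
    "actw l (map GenT u) F (k, x \<circ> adj i, map (adj i) js, i # v) = F (k, y, map (prm u) (map (adj i) js), rev u @ i # v)"
    using Cons.IH[OF Cons.prems] by blast
  ultimately show ?case
    by (intro exI[of _ y]) (simp only: rev.simps prm.simps map_map append_assoc append.simps)
qed auto

lemma actw_Xs: "actw l (map GenX xs) F (m + int (length xs), x, js, v) = mon x (mset xs) * F (m, x, js, v)"
  by (induction xs) (auto simp: mon_def algebra_simps)

text \<open>In top degree the outer two T permute the tuple and the old arguments back to their
  place, and the doubled letter cancels modulo \<open>weq\<close>. The contraction index alone moves
  from n to n + 1 in the step.\<close>

lemma actw_th0:
  "lowdeg k F \<Longrightarrow> F \<in> altmod d \<Longrightarrow> n < d \<Longrightarrow> v \<in> lists {1..<d} \<Longrightarrow>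
    actw l (th0 n) F (k + int l, x, js, v) = F (k, x, Suc n # js, v)"
proof (induction n arbitrary: x js v F)
  case (Suc n)
  let ?g = "GenT (Suc n)" and ?i = "Suc n"
  let ?G = "gact l ?g F"
  have G: "lowdeg k ?G" using lowdeg_gact[OF Suc.prems(1), of ?g] by (simp add: gwt_def)
  have Gm: "?G \<in> altmod d" using Suc.prems by (intro altmod_gact) auto
  have low: "lowdeg (k + int l) (actw l (th0 n) ?G)" using lowdeg_actw[OF G, of "th0 n"] by simp
  have iv: "?i # v \<in> lists {1..<d}" using Suc.prems by simp
  have "actw l (th0 (Suc n)) F (k + int l, x, js, v) =
      actw l (th0 n) ?G (k + int l, x \<circ> adj ?i, map (adj ?i) js, ?i # v)"
    using low by (simp add: lowdeg_def)
  also have "\<dots> = ?G (k, x \<circ> adj ?i, ?i # map (adj ?i) js, ?i # v)"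
    using Suc.prems iv by (intro Suc.IH G Gm) auto
  also have "\<dots> = F (k, x, Suc ?i # js, ?i # ?i # v)"
    using Suc.prems(1) by (simp add: lowdeg_def)
  also have "\<dots> = F (k, x, Suc ?i # js, v)"
    using altmodD(3)[OF Suc.prems(2) weq.sq[of "[]" d v ?i]] Suc.prems by simp
  finally show ?case .
qed simp

lemma actw_thws:
  assumes F: "lowdeg k F" "F \<in> altmod d" and v: "v \<in> lists {1..<d}"
  shows "set J \<subseteq> {1..d} \<Longrightarrow> actw l (thws J) F (k + int (l * length J), x, js, v) = F (k, x, rev J @ js, v)"
proof (induction J arbitrary: js)
  case (Cons j J)
  let ?G = "actw l (thws J) F"
  have low: "lowdeg (k + int (l * length J)) ?G" using lowdeg_actw[OF F(1), of "thws J"] by simp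
  have G: "?G \<in> altmod d" using Cons.prems by (intro altmod_actw F thws_in) auto
  obtain n where n: "j = Suc n" "n < d" using Cons.prems by (cases j) auto
  have "actw l (thws (j # J)) F (k + int (l * length J) + int l, x, js, v) = ?G (k + int (l * length J), x, Suc n # js, v)"
    using actw_th0[OF low G n(2) v] n by (simp add: thw_def)
  then show ?case using Cons n by (simp add: algebra_simps)
qed simp

lemma actw_nf:
  fixes x :: "nat \<Rightarrow> 'k"
  assumes t: "(J, a, u) \<in> valid"
  shows "actw l (nf (J, a, u)) (detf d K w) (int (wt (nf (J, a, u))), x, [], []) =
    (if weq d (rev u) w then mon x a * altf K (map (prm u) (rev J)) else 0)"
proof -
  note v = validD[OF t]
  let ?xs = "sorted_list_of_multiset a" and ?F = "detf d K w :: 'k pt \<Rightarrow> 'k"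
  have F: "lowdeg 0 ?F" by (simp add: lowdeg_def detf_def)
  let ?F1 = "actw l (map GenT u) ?F"
  have F1: "lowdeg 0 ?F1" "?F1 \<in> altmod d"
    using lowdeg_actw[OF F, of "map GenT u"] v Ts_in by (auto intro!: altmod_actw detf_altmod simp del: in_lists_conv_set)
  let ?F2 = "actw l (map GenX ?xs) ?F1"
  have l2: "length ?xs = size a" by (metis mset_sorted_list_of_multiset size_mset)
  have F2: "lowdeg (int (size a)) ?F2" "?F2 \<in> altmod d"
    using lowdeg_actw[OF F1(1), of "map GenX ?xs"] v l2
    by (auto intro!: altmod_actw F1 Xs_in simp del: in_lists_conv_set)
  have "actw l (nf (J, a, u)) ?F (int (wt (nf (J, a, u))), x, [], []) = ?F2 (int (size a), x, rev J @ [], [])"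
    using actw_thws[OF F2, of "[]" J x "[]"] v unfolding wt_nf by (simp add: add.commute)
  also have "\<dots> = mon x a * ?F1 (0, x, rev J, [])"
    using actw_Xs[of ?xs ?F1 0 x "rev J" "[]"] l2 by simp
  also have "?F1 (0, x, rev J, []) = (if weq d (rev u) w then altf K (map (prm u) (rev J)) else 0)"
    using actw_Ts[OF F, of u x "rev J" "[]"] by (auto simp: detf_def)
  finally show ?thesis by simp
qed

lemma strict_sorted_set_eq:
  fixes J J' :: "nat list"
  shows "sorted_wrt (<) J \<Longrightarrow> sorted_wrt (<) J' \<Longrightarrow> set J = set J' \<Longrightarrow> J = J'"
  by (simp add: strict_sorted_equal)

text \<open>Test the combination at a nonzero coefficient. In degree m the ideal acts by zero and
  words of weight below m do not reach that degree. The test vector isolates the triples with the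
  given J and u, leaving a polynomial that vanishes at all tuples of distinct scalars.\<close>

lemma valid_at_L:
  assumes c: "valid_at m c" and L: "Nf c \<in> L m"
  shows "c = 0"
proof (rule ccontr)
  assume "c \<noteq> 0"
  then obtain J0 a0 u0 where t0: "c (J0, a0, u0) \<noteq> 0" by (auto simp: fun_eq_iff zero_fun_apply)
  have fin: "fs c" and val: "\<And>t. c t \<noteq> 0 \<Longrightarrow> t \<in> valid \<and> wt (nf t) = m"
    using c by (auto simp: valid_at_def)
  note v0 = validD[OF val[OF t0, THEN conjunct1]]
  \<comment> \<open>The leading part of T_u transports contraction indices by \<open>prm u0\<close>
    and pushes letters in front of v one by one, hence this image and the reversed word in the test
    vector.\<close>
  define K where "K = prm u0 ` set J0"
  let ?F = "detf d K (rev u0) :: 'k pt \<Rightarrow> 'k"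
  have zero: "act l (Nf c) ?F (int m, x, [], []) = 0" if x: "inj_on x {1..d}" for x
  proof -
    obtain g e where ge: "Nf c = g + e" "g \<in> I" "e \<in> Low m" using L unfolding L_def by blast
    have p: "(int m, x, [], []) \<in> gpts d" using x by (simp add: gpts_def)
    have fg: "fs g" "fs e" using ge by (auto simp: Low_def intro: Fr_fs I_D(1))
    have "act l g ?F (int m, x, [], []) = 0"
      by (rule act_dg_ideal[OF ge(2) detf_altmod p])
    moreover have "act l e ?F (int m, x, [], []) = 0"
      unfolding act_def lin_def
    proof (rule sum.neutral, safe)
      fix w assume "e w \<noteq> 0"
      then have "wt w < m" using ge(3) by (auto simp: Low_def)
      moreover have "lowdeg 0 ?F" by (simp add: lowdeg_def detf_def)
      ultimately show "e w * actw l w ?F (int m, x, [], []) = 0"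
        using lowdeg_actw[of 0 ?F w] by (simp add: lowdeg_def)
    qed
    ultimately show ?thesis using fg by (simp add: ge(1) act_linear plus_fun_apply)
  qed
  let ?s = "altf K (map (prm u0) (rev J0)) :: 'k"
  have s: "?s \<noteq> 0"
    using v0 inj_prm[of u0] by (auto simp: altf_def K_def distinct_map strict_sorted_iff intro: inj_on_subset)
  define A where "A = {a. c (J0, a, u0) \<noteq> 0}"
  have supp: "finite {t. c t \<noteq> 0}" using fin by (simp add: fs_def)
  have inj: "inj_on (\<lambda>a. (J0, a, u0)) A" by (auto simp: inj_on_def)
  have img: "(\<lambda>a. (J0, a, u0)) ` A = {t. c t \<noteq> 0 \<and> fst t = J0 \<and> snd (snd t) = u0}"
    by (auto simp: A_def)
  have "finite ((\<lambda>a. (J0, a, u0)) ` A)" unfolding img by (rule finite_subset[OF _ supp]) auto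
  then have finA: "finite A" using inj by (rule finite_imageD)
  have trm: "c t * actw l (nf t) ?F (int m, x, [], []) =
     (if fst t = J0 \<and> snd (snd t) = u0 then c t * mon x (fst (snd t)) * ?s else 0)" if t: "c t \<noteq> 0" for t x
  proof -
    obtain J a u where tt: "t = (J, a, u)" by (cases t)
    have tv: "(J, a, u) \<in> valid" "wt (nf (J, a, u)) = m" using val[OF t] tt by auto
    note v = validD[OF tv(1)]
    \<comment> \<open>Words of valid triples are their own representatives, so equivalence forces
      equality.\<close>
    have "weq d (rev u) (rev u0) \<longleftrightarrow> u = u0"
    proof
      assume "weq d (rev u) (rev u0)"
      then have "weq d u u0" using weq_rev by fastforce
      then show "u = u0" using wrep_eq v v0 by metis
    qed (use v0 in \<open>auto intro!: weq.refl\<close>)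
    moreover have "altf K (map (prm u0) (rev J)) = (0 :: 'k)" if "J \<noteq> J0"
    proof -
      have "set J \<noteq> set J0" using strict_sorted_set_eq[of J J0] v v0 that by blast
      then have "prm u0 ` set J \<noteq> K" unfolding K_def using inj_prm by (simp add: inj_image_eq_iff)
      then show ?thesis by (simp add: altf_def)
    qed
    ultimately show ?thesis using actw_nf[OF tv(1), of K "rev u0" x] unfolding tv(2) tt by auto
  qed
  have "(\<Sum>a\<in>A. c (J0, a, u0) * mon x a) = 0" if x: "inj_on x {1..d}" for x
  proof -
    have "act l (Nf c) ?F = lin (\<lambda>t. actw l (nf t) ?F) c"
      unfolding act_def Nf_def by (subst lin_lin) auto
    then have "0 = (\<Sum>t | c t \<noteq> 0. c t * actw l (nf t) ?F (int m, x, [], []))"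
      using zero[OF x] by (simp add: lin_def)
    also have "\<dots> = (\<Sum>t | c t \<noteq> 0. if fst t = J0 \<and> snd (snd t) = u0 then c t * mon x (fst (snd t)) * ?s else 0)"
      using trm by (intro sum.cong) auto
    also have "\<dots> = (\<Sum>t\<in>(\<lambda>a. (J0, a, u0)) ` A. c t * mon x (fst (snd t)) * ?s)"
      unfolding img using supp by (simp add: sum.inter_filter[symmetric] conj_assoc)
    also have "\<dots> = (\<Sum>a\<in>A. c (J0, a, u0) * mon x a) * ?s"
      by (subst sum.reindex[OF inj]) (simp add: sum_distrib_right)
    finally show ?thesis using s by simp
  qed
  moreover have "set_mset a \<subseteq> {1..d}" if "a \<in> A" for a
    using that validD[OF conjunct1[OF val], of J0 a u0] by (simp add: A_def)
  moreover have "a0 \<in> A" using t0 by (simp add: A_def)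
  ultimately have "c (J0, a0, u0) = 0"
    using monomials_independent[OF finA, of d "\<lambda>a. c (J0, a, u0)" a0] by blast
  then show False using t0 by simp
qed

section \<open>Acyclicity\<close>

lemma valid_atD: "valid_at m c \<Longrightarrow> c t \<noteq> 0 \<Longrightarrow> t \<in> valid \<and> wt (nf t) = m"
  unfolding valid_at_def by blast

lemma Nf_in: "valid_at m c \<Longrightarrow> Nf c \<in> FG"
  unfolding Nf_def by (rule Fr_lin) (auto simp: valid_at_def nf_in simp del: in_lists_conv_set nf.simps)

lemma Nf_res: "valid_at m c \<Longrightarrow> Nf (lin htp_res c) \<in> FH \<and> valid_at m (lin htp_res c)"
proof
  assume c: "valid_at m c"
  have r: "valid_at m (htp_res t) \<and> Nf (htp_res t) \<in> FH" if "c t \<noteq> 0" for t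
  proof -
    obtain J a u where t: "t = (J, a, u)" by (cases t)
    have tv: "t \<in> valid" "wt (nf t) = m" using valid_atD[OF c that] by auto
    show ?thesis
    proof (cases "J = [] \<and> piv J a = {}")
      case True
      note v = validD[OF tv(1)[unfolded t]]
      have "map GenX (sorted_list_of_multiset a) @ map GenT u \<in> lists (hecke_gens d)"
        using v by (fastforce simp: in_lists_conv_set)
      then show ?thesis using True tv by (simp add: htp_res_def t Nf_def valid_at_closed)
    next
      case False
      then show ?thesis by (auto simp: htp_res_def t Nf_def valid_at_closed)
    qed
  qed
  then show "valid_at m (lin htp_res c)" by (intro valid_at_lin) blast
  have "Nf (lin htp_res c) = lin (\<lambda>t. Nf (htp_res t)) c"
    unfolding Nf_def using r by (intro lin_lin) (auto simp: valid_at_def)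
  then show "Nf (lin htp_res c) \<in> FH" using r by (auto intro!: Fr_lin)
qed

text \<open>Induction on the weight bound: the homotopy writes the leading combination as a boundary
  of \<open>d0\<close> plus residual monomials, and lifting both to the free algebra cancels the
  leading term of f modulo the ideal.\<close>

lemma acyclic:
  assumes "f \<in> Low m" "D f \<in> I"
  shows "\<exists>y\<in>FG. \<exists>h\<in>FH. f - D y - h \<in> I"
  using assms
proof (induction m arbitrary: f)
  case 0
  then have "f = 0" by (auto simp: Low_def fun_eq_iff zero_fun_apply)
  then show ?case by (intro bexI[of _ 0]) (auto simp: der_linear I_D)
next
  case (Suc m)
  have f: "f \<in> FG" "\<And>w. f w \<noteq> 0 \<Longrightarrow> wt w \<le> m" using Suc.prems(1) by (auto simp: Low_def)
  obtain c where c: "valid_at m c" "f - Nf c \<in> L m" using spanning[OF f] by blast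
  have fsf: "fs f" "fs (Nf c)" using f(1) Nf_in[OF c(1)] by (auto intro: Fr_fs)
  have ct: "\<And>t. c t \<noteq> 0 \<Longrightarrow> t \<in> valid \<and> wt (nf t) = m" using c(1) by (auto simp: valid_at_def)
  have d0c: "valid_at m (lin d0 c)" using ct valid_at_d0 by (intro valid_at_lin) blast
  have htpc: "valid_at m (lin htp c)" using ct valid_at_htp by (intro valid_at_lin) blast
  have "D f - D (Nf c) \<in> L m" using D_L[OF c(2)] fsf by (simp add: der_linear)
  \<comment> \<open>The sum telescopes to the leading part of D f, which is thus of lower weight
    modulo the ideal; independence then makes the coefficients zero.\<close>
  then have "D f - (D f - D (Nf c)) - (D (Nf c) - Nf (lin d0 c)) \<in> L m"
    by (intro L_closed(4)[OF L_closed(4)] I_L[OF Suc.prems(2)] D_Nf c(1))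
  then have "Nf (lin d0 c) \<in> L m" by simp
  then have "lin d0 c = 0" using valid_at_L d0c by blast
  then have c_eq: "c = lin d0 (lin htp c) + lin htp_res c" using homotopy_lin[OF c(1)] by simp
  have htp_res: "Nf (lin htp_res c) \<in> FH" "valid_at m (lin htp_res c)" using Nf_res[OF c(1)] by auto
  have d0h: "valid_at m (lin d0 (lin htp c))" using htpc valid_at_d0
    by (intro valid_at_lin) (auto simp: valid_at_def simp del: nf.simps split_paired_All)
  let ?y = "Nf (lin htp c)" and ?h = "Nf (lin htp_res c)"
  have y: "?y \<in> FG" using Nf_in htpc by blast
  have N: "Nf c = Nf (lin d0 (lin htp c)) + ?h"
    using c_eq d0h htp_res(2) unfolding Nf_def valid_at_def by (metis lin_add)
  have "(f - Nf c) - (D ?y - Nf (lin d0 (lin htp c))) \<in> L m"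
    by (rule L_closed(4)[OF c(2) D_Nf[OF htpc]])
  moreover have "(f - Nf c) - (D ?y - Nf (lin d0 (lin htp c))) = f - D ?y - ?h"
    unfolding N by (simp add: algebra_simps)
  ultimately have "f - D ?y - ?h \<in> L m" by metis
  then obtain g e where ge: "f - D ?y - ?h = g + e" "g \<in> I" "e \<in> Low m" unfolding L_def by blast
  \<comment> \<open>The remainder is again a cycle modulo the ideal: D kills D y and the
    \<theta>-free h, and it preserves the ideal.\<close>
  have e: "e = f - D ?y - ?h - g" using ge(1) by (simp add: algebra_simps)
  have "fs ?y" "fs ?h" "fs g" using y htp_res(1) ge(2) by (auto intro: Fr_fs I_D(1))
  then have "D e = D f - D g" unfolding e using fsf der_hecke[OF htp_res(1)] der_der[OF _ P_FH]
    by (simp add: der_linear)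
  then have "D e \<in> I" using Suc.prems(2) D_ideal[OF ge(2)] I_D(5) by simp
  then obtain y' h' where yh: "y' \<in> FG" "h' \<in> FH" "e - D y' - h' \<in> I" using Suc.IH[OF ge(3)] by blast
  have "f - D (?y + y') - (?h + h') = g + (e - D y' - h')"
    using ge(1) \<open>fs ?y\<close> Fr_fs[OF yh(1)] by (simp add: der_linear algebra_simps)
  then have "f - D (?y + y') - (?h + h') \<in> I" using I_D(3)[OF ge(2) yh(3)] by metis
  then show ?case using y yh htp_res by (intro bexI[of _ "?y + y'"] bexI[of _ "?h + h'"]) auto
qed

lemma cycle_decomposition:
  assumes "f \<in> FG" "D f \<in> I"
  obtains y h where "y \<in> FG" "h \<in> FH" "f - D y - h \<in> I"
proof -
  have "finite {w. f w \<noteq> 0}" using Fr_fs[OF assms(1)] by (simp add: fs_def)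
  then have "f w \<noteq> 0 \<Longrightarrow> wt w < Suc (Max (wt ` {w. f w \<noteq> 0}))" for w
    by (simp add: less_Suc_eq_le)
  then have "f \<in> Low (Suc (Max (wt ` {w. f w \<noteq> 0})))" using assms(1) by (simp add: Low_def)
  from acyclic[OF this assms(2)] that show thesis by blast
qed

end

section \<open>Quotients of algebras\<close>

lemma alg_quot_carrier: "carrier (alg_quot R K) = {K +>\<^bsub>R\<^esub> x | x. x \<in> carrier R}"
  by (auto simp: alg_quot_simps FactRing_simps)

lemma alg_quot_ops:
  assumes "ideal K R"
  shows "x \<in> carrier R \<Longrightarrow> y \<in> carrier R \<Longrightarrow>
      (K +>\<^bsub>R\<^esub> x) \<otimes>\<^bsub>alg_quot R K\<^esub> (K +>\<^bsub>R\<^esub> y) = K +>\<^bsub>R\<^esub> (x \<otimes>\<^bsub>R\<^esub> y)"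
    "x \<in> carrier R \<Longrightarrow> y \<in> carrier R \<Longrightarrow>
      (K +>\<^bsub>R\<^esub> x) \<oplus>\<^bsub>alg_quot R K\<^esub> (K +>\<^bsub>R\<^esub> y) = K +>\<^bsub>R\<^esub> (x \<oplus>\<^bsub>R\<^esub> y)"
    "\<one>\<^bsub>alg_quot R K\<^esub> = K +>\<^bsub>R\<^esub> \<one>\<^bsub>R\<^esub>" "\<zero>\<^bsub>alg_quot R K\<^esub> = K"
    "x \<in> carrier R \<Longrightarrow> K +>\<^bsub>R\<^esub> x \<in> carrier (alg_quot R K)"
  using ideal.rcos_ring_hom[OF assms] unfolding alg_quot_simps
  by (auto simp: ring_hom_def FactRing_def Pi_iff)

lemma alg_quot_eq_iff:
  assumes "ideal K R" "x \<in> carrier R" "y \<in> carrier R"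
  shows "K +>\<^bsub>R\<^esub> x = K +>\<^bsub>R\<^esub> y \<longleftrightarrow> x \<ominus>\<^bsub>R\<^esub> y \<in> K"
  using ring.quotient_eq_iff_same_a_r_cos[OF _ assms] assms(1) ideal.axioms(2) by blast

lemma alg_quot_zero_iff:
  assumes "ideal K R" "x \<in> carrier R"
  shows "K +>\<^bsub>R\<^esub> x = K \<longleftrightarrow> x \<in> K"
proof -
  interpret ideal K R by fact
  show ?thesis
    using quotient_eq_iff_same_a_r_cos[OF assms zero_closed] assms(2) a_coset_add_zero[OF a_subset] 
    by (simp add: minus_eq)
qed

text \<open>Scaling any two members of a coset gives the same coset, so the union in the definition
  of \<open>alg_quot\<close> is a union of equal sets.\<close>

lemma alg_quot_smult:
  assumes K: "ideal K R" and x: "x \<in> carrier R"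
    and c: "\<And>y. y \<in> carrier R \<Longrightarrow> c \<odot>\<^bsub>R\<^esub> y \<in> carrier R"
      "\<And>y z. y \<in> carrier R \<Longrightarrow> z \<in> carrier R \<Longrightarrow> c \<odot>\<^bsub>R\<^esub> (y \<oplus>\<^bsub>R\<^esub> z) = c \<odot>\<^bsub>R\<^esub> y \<oplus>\<^bsub>R\<^esub> c \<odot>\<^bsub>R\<^esub> z"
      "\<And>y. y \<in> K \<Longrightarrow> c \<odot>\<^bsub>R\<^esub> y \<in> K"
  shows "c \<odot>\<^bsub>alg_quot R K\<^esub> (K +>\<^bsub>R\<^esub> x) = K +>\<^bsub>R\<^esub> (c \<odot>\<^bsub>R\<^esub> x)"
proof -
  interpret ideal K R by fact
  have "K +>\<^bsub>R\<^esub> (c \<odot>\<^bsub>R\<^esub> y) = K +>\<^bsub>R\<^esub> (c \<odot>\<^bsub>R\<^esub> x)" if y: "y \<in> K +>\<^bsub>R\<^esub> x" for y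
  proof -
    obtain k where k: "k \<in> K" "y = k \<oplus>\<^bsub>R\<^esub> x" using y by (auto simp: a_r_coset_def')
    then have "k \<in> carrier R" using a_subset by auto
    then have "K +>\<^bsub>R\<^esub> (c \<odot>\<^bsub>R\<^esub> y) = K +>\<^bsub>R\<^esub> (c \<odot>\<^bsub>R\<^esub> k \<oplus>\<^bsub>R\<^esub> c \<odot>\<^bsub>R\<^esub> x)"
      using k x c by simp
    also have "\<dots> = K +>\<^bsub>R\<^esub> (c \<odot>\<^bsub>R\<^esub> x)"
      using k x c \<open>k \<in> carrier R\<close> by (simp add: alg_quot_eq_iff[OF K] minus_eq a_assoc r_neg)
    finally show ?thesis .
  qed
  moreover have "x \<in> K +>\<^bsub>R\<^esub> x" using a_rcos_self[OF x] by simp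
  ultimately show ?thesis unfolding alg_quot_simps(6) by blast
qed

locale free_quot =
  fixes G :: "hgen set" and K :: "(hgen list \<Rightarrow> 'k::field) set"
  assumes K: "ideal K (free_alg G)"
begin

abbreviation A :: "('k, (hgen list \<Rightarrow> 'k) set) module" where "A \<equiv> alg_quot (free_alg G) K"

definition cl :: "(hgen list \<Rightarrow> 'k) \<Rightarrow> (hgen list \<Rightarrow> 'k) set" where
  "cl f = K +>\<^bsub>free_alg G\<^esub> f"

lemma ring_A: "ring A" using K by (rule ring_alg_quot)

lemma cl_carrier: "carrier A = cl ` Fr G"
  unfolding alg_quot_carrier cl_def by blast

lemma cl_in: "f \<in> Fr G \<Longrightarrow> cl f \<in> carrier A" by (simp add: cl_carrier)

lemma cl_simps:
  "f \<in> Fr G \<Longrightarrow> g \<in> Fr G \<Longrightarrow> cl f \<otimes>\<^bsub>A\<^esub> cl g = cl (f \<star> g)"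
  "f \<in> Fr G \<Longrightarrow> g \<in> Fr G \<Longrightarrow> cl f \<oplus>\<^bsub>A\<^esub> cl g = cl (f + g)"
  "\<one>\<^bsub>A\<^esub> = cl (dlt [])" "\<zero>\<^bsub>A\<^esub> = K"
  using alg_quot_ops[OF K] unfolding cl_def by (simp_all add: free_alg_ops)

lemma cl_eq_iff: "f \<in> Fr G \<Longrightarrow> g \<in> Fr G \<Longrightarrow> cl f = cl g \<longleftrightarrow> f - g \<in> K"
  unfolding cl_def using alg_quot_eq_iff[OF K] by (simp add: free_alg_diff)

lemma cl_zero_iff: "f \<in> Fr G \<Longrightarrow> cl f = K \<longleftrightarrow> f \<in> K"
  unfolding cl_def using alg_quot_zero_iff[OF K] by simp

lemma cl_0: "cl 0 = K"
  using cl_zero_iff[of 0] ideal_free_algD(2)[OF K] by simp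

lemma cl_self: "f \<in> Fr G \<Longrightarrow> f \<in> cl f"
proof -
  assume "f \<in> Fr G"
  then have "0 \<oplus>\<^bsub>free_alg G\<^esub> f \<in> cl f"
    unfolding cl_def a_r_coset_def' using ideal_free_algD(2)[OF K] by blast
  then show ?thesis by (simp add: free_alg_ops)
qed

lemma cl_mem: "f \<in> Fr G \<Longrightarrow> g \<in> cl f \<Longrightarrow> g \<in> Fr G \<and> g - f \<in> K"
  using ideal_free_algD(1)[OF K] by (auto simp: cl_def a_r_coset_def' free_alg_ops)

lemma cl_smult: "f \<in> Fr G \<Longrightarrow> c \<odot>\<^bsub>A\<^esub> cl f = cl (scl c f)"
  unfolding cl_def using alg_quot_smult[OF K, of f c] ideal_free_algD(6)[OF K]
  by (simp add: free_alg_ops scl_distribs)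

lemma cl_uminus: "f \<in> Fr G \<Longrightarrow> \<ominus>\<^bsub>A\<^esub> cl f = cl (- f)"
proof -
  interpret A: ring A by (rule ring_A)
  assume f: "f \<in> Fr G"
  then have "cl (- f) \<oplus>\<^bsub>A\<^esub> cl f = \<zero>\<^bsub>A\<^esub>" by (simp add: cl_simps cl_0)
  then show ?thesis using f by (intro A.minus_equality) (auto simp: cl_in)
qed

lemma cl_diff: "f \<in> Fr G \<Longrightarrow> g \<in> Fr G \<Longrightarrow> cl f \<ominus>\<^bsub>A\<^esub> cl g = cl (f - g)"
  by (simp add: a_minus_def cl_uminus cl_simps)

lemma ideal_image:
  assumes K': "ideal K' (free_alg G)"
  shows "ideal (cl ` K') A"
proof -
  interpret A: ring A by (rule ring_A)
  note D = ideal_free_algD[OF K']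
  show ?thesis
  proof (rule idealI[OF ring_A])
    show "subgroup (cl ` K') (add_monoid A)"
      by (rule A.add.subgroupI) (use D in \<open>auto simp: cl_in cl_uminus cl_simps simp flip: a_inv_def\<close>)
  qed (use D in \<open>auto simp: cl_carrier cl_simps\<close>)
qed

lemma ideal_preimage:
  assumes K': "ideal K' A"
  shows "ideal {f \<in> Fr G. cl f \<in> K'} (free_alg G)"
proof -
  interpret A: ideal K' A by (rule K')
  show ?thesis
  proof (rule ideal_free_algI, goal_cases)
    case 2
    then show ?case using additive_subgroup.zero_closed[OF A.is_additive_subgroup] by (simp add: cl_simps cl_0)
  next
    case (3 f g)
    then show ?case using additive_subgroup.a_closed[OF A.is_additive_subgroup, of "cl f" "cl g"] by (simp add: cl_simps)
  next
    case (4 f)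
    then show ?case using additive_subgroup.a_inv_closed[OF A.is_additive_subgroup, of "cl f"] by (simp add: cl_uminus)
  next
    case (5 f g)
    then show ?case using A.I_l_closed[of "cl f" "cl g"] by (simp add: cl_simps cl_in)
  next
    case (6 f g)
    then show ?case using A.I_r_closed[of "cl f" "cl g"] by (simp add: cl_simps cl_in)
  qed simp
qed

lemma cl_cyclotomic_prod:
  assumes "GenX i \<in> G"
  shows "cyclotomic_prod A (cl (dlt [GenX i])) n Q = cl (pol Q [1..<n + 1] i)"
proof -
  have "foldr (\<lambda>r p. (cl (dlt [GenX i]) \<ominus>\<^bsub>A\<^esub> (Q r \<odot>\<^bsub>A\<^esub> \<one>\<^bsub>A\<^esub>)) \<otimes>\<^bsub>A\<^esub> p) rs \<one>\<^bsub>A\<^esub> = cl (pol Q rs i) \<and>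
     pol Q rs i \<in> Fr G" for rs
    using assms by (induction rs) (auto simp: cl_simps cl_smult cl_diff)
  then show ?thesis unfolding cyclotomic_prod_def by blast
qed

end

section \<open>The differential on the quotient\<close>

text \<open>The algebra homomorphism that sets \<theta> to 0, realised by discarding all words that
  contain \<theta>.\<close>

definition rth :: "(hgen list \<Rightarrow> 'k::field) \<Rightarrow> hgen list \<Rightarrow> 'k" where
  "rth f = (\<lambda>w. if GenTheta \<in> set w then 0 else f w)"

lemma rth_linear: "rth (f + g) = rth f + rth g" "rth (f - g) = rth f - rth g" "rth (- f) = - rth f"
    "rth (scl c f) = scl c (rth f)" "rth 0 = 0"
    "rth (dlt w) = (if GenTheta \<in> set w then 0 else dlt w)" for f g :: "hgen list \<Rightarrow> 'k::field"
  by (auto simp: rth_def fun_eq_iff fun_applies dlt_def)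

lemma rth_conv: "rth (f \<star> g) = rth f \<star> rth g"
proof
  fix w :: "hgen list"
  have s: "set w = set (take i w) \<union> set (drop i w)" for i by (metis append_take_drop_id set_append)
  show "rth (f \<star> g) w = (rth f \<star> rth g) w"
  proof (cases "GenTheta \<in> set w")
    case True
    then have "rth f (take i w) * rth g (drop i w) = 0" for i
      using s[of i] by (auto simp: rth_def)
    then have "(rth f \<star> rth g) w = 0" unfolding conv_def by (intro sum.neutral) blast
    then show ?thesis using True by (simp add: rth_def[of "f \<star> g"])
  next
    case False
    then have "rth f (take i w) = f (take i w) \<and> rth g (drop i w) = g (drop i w)" for i
      using s[of i] by (auto simp: rth_def)
    then show ?thesis using False unfolding conv_def by (simp add: rth_def)
  qed
qed

lemma rth_Fr:
  assumes "f \<in> Fr (dg_gens d)" shows "rth f \<in> Fr (hecke_gens d)"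
proof -
  have "fs (rth f)" using Fr_fs[OF assms] unfolding fs_def
    by (rule rev_finite_subset) (auto simp: rth_def)
  then show ?thesis using assms
    by (fastforce simp: Fr_iff rth_def dg_gens_def in_lists_conv_set split: if_splits)
qed

lemma rth_hecke: "f \<in> Fr (hecke_gens d) \<Longrightarrow> rth f = f"
  using Fr_hecke_theta by (fastforce simp: rth_def fun_eq_iff)

context dg_setting begin

sublocale dg: free_quot "dg_gens d" I
  by (rule free_quot.intro) (rule ideal_dg)

sublocale aff: free_quot "hecke_gens d" "affine_ideal d :: (hgen list \<Rightarrow> 'k) set"
  by (rule free_quot.intro) (rule ideal_affine)

lemma A_eq: "dg_hecke d = dg.A" by (simp add: dg_hecke_def)

lemma dg_gen_cl: "dg_gen d v = dg.cl (dlt [v])"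
  by (simp add: dg_gen_def dg.cl_def free_gen_dlt)

lemma FH_FG: "f \<in> FH \<Longrightarrow> f \<in> FG" by (rule Fr_mono[OF hecke_subset_dg])

lemma affine_ideal_sub: "f \<in> affine_ideal d \<Longrightarrow> f \<in> I"
proof -
  have "ideal {f \<in> FH. f \<in> I} (free_alg (hecke_gens d))"
    by (rule ideal_free_algI) (auto simp: I_D(2-4) FH_FG intro: I_D)
  moreover have "hecke_diffs d \<subseteq> {f \<in> FH. f \<in> I}"
    by (auto intro: hecke_diffs_Fr dg_diffs_in_ideal dg_diffs.hecke)
  ultimately show "f \<in> affine_ideal d \<Longrightarrow> f \<in> I" using affine_ideal_minimal by blast
qed

text \<open>Every term of a relator involving \<theta> contains \<theta>, and the other relators are
  fixed. With \<open>affine_ideal_sub\<close> this makes the affine Hecke algebra a retract of the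
  DG-algebra.\<close>

lemma rth_ideal: "f \<in> I \<Longrightarrow> rth f \<in> affine_ideal d"
proof -
  note aff_D = ideal_free_algD[OF ideal_affine[where ?'k = 'k and d = d]]
  let ?K = "{f \<in> FG. rth f \<in> affine_ideal d}"
  have "ideal ?K (free_alg (dg_gens d))"
    by (rule ideal_free_algI) (auto simp: rth_linear rth_conv aff_D(2-4) rth_Fr intro: aff_D)
  moreover have "dg_diffs d \<subseteq> ?K"
  proof
    fix f :: "hgen list \<Rightarrow> 'k" assume "f \<in> dg_diffs d"
    then show "f \<in> ?K"
    proof cases
      case hecke
      then show ?thesis using hecke_diffs_in_ideal[OF hecke] FH_FG[OF hecke_diffs_Fr[OF hecke]]
          rth_hecke[OF hecke_diffs_Fr[OF hecke]] by simp
    qed (auto simp: rth_linear aff_D(2))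
  qed
  ultimately show "f \<in> I \<Longrightarrow> rth f \<in> affine_ideal d" using dg_ideal_minimal by blast
qed

text \<open>The chosen representative is immaterial because D preserves the ideal. Restriction to
  the carrier gives the value \<open>undefined\<close> elsewhere that
  \<open>\<rightarrow>\<^sub>E\<close> demands.\<close>

definition \<delta>0 :: "(hgen list \<Rightarrow> 'k) set \<Rightarrow> (hgen list \<Rightarrow> 'k) set" where
  "\<delta>0 = (\<lambda>C\<in>carrier dg.A. dg.cl (D (SOME f. f \<in> C)))"

lemma \<delta>0_cl: 
  assumes "f \<in> FG" shows "\<delta>0 (dg.cl f) = dg.cl (D f)"
proof -
  let ?g = "SOME g. g \<in> dg.cl f"
  have "?g \<in> dg.cl f" using dg.cl_self[OF assms] by (rule someI[of "\<lambda>g. g \<in> dg.cl f"])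
  then have g: "?g \<in> FG" "?g - f \<in> I" using dg.cl_mem[OF assms] by auto
  then have "D ?g - D f \<in> I" using D_ideal[OF g(2)] assms by (simp add: der_linear Fr_fs[of _ "dg_gens d"])
  then show ?thesis using assms g by (simp add: \<delta>0_def dg.cl_in dg.cl_eq_iff D_in)
qed

lemma P_cl: "cyclotomic_prod dg.A (dg_gen d (GenX 1)) l Q = dg.cl P"
  unfolding dg_gen_cl P_def by (rule dg.cl_cyclotomic_prod) (use d1 in simp)

lemma subalg_hecke:
  assumes "x \<in> subalg_generated dg.A (dg_gen d ` hecke_gens d)"
  obtains f where "f \<in> FH" "x = dg.cl f"
proof -
  interpret A: ring dg.A by (rule dg.ring_A)
  have "subring (dg.cl ` FH) dg.A"
    by (rule A.subringI) (auto simp: dg.cl_in FH_FG dg.cl_simps dg.cl_uminus)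
  moreover have "\<forall>c. \<forall>x\<in>dg.cl ` FH. c \<odot>\<^bsub>dg.A\<^esub> x \<in> dg.cl ` FH"
    by (auto simp: dg.cl_smult FH_FG)
  moreover have "dg_gen d ` hecke_gens d \<subseteq> dg.cl ` FH"
    by (auto simp: dg_gen_cl)
  ultimately have "subalg_generated dg.A (dg_gen d ` hecke_gens d) \<subseteq> dg.cl ` FH"
    unfolding subalg_generated_def by blast
  then show thesis using assms that by blast
qed

lemma sgi_homogeneous:
  assumes "\<And>w. f w \<noteq> 0 \<Longrightarrow> count_list w GenTheta = n" "fs f"
  shows "sgi f = scl ((- 1) ^ n) f"
proof -
  have "sgi f = lin (\<lambda>w. scl ((- 1) ^ n) (dlt w)) f"
    unfolding sgi_def by (rule lin_cong) (simp add: assms(1) sgw_def)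
  also have "\<dots> = scl ((- 1) ^ n) (lin dlt f)"
    unfolding lin_eq_sum by (simp add: scl_sum mult.commute)
  finally show ?thesis using assms(2) by simp
qed

lemma \<delta>0_differential: "is_dg_differential d l Q \<delta>0"
  unfolding is_dg_differential_def Let_def A_eq
proof (intro conjI ballI allI)
  show "\<delta>0 \<in> carrier dg.A \<rightarrow>\<^sub>E carrier dg.A"
  proof (rule PiE_I)
    fix x assume "x \<in> carrier dg.A"
    then show "\<delta>0 x \<in> carrier dg.A" by (auto simp: dg.cl_carrier \<delta>0_cl D_in)
  qed (simp add: \<delta>0_def)
next
  fix x y assume "x \<in> carrier dg.A" "y \<in> carrier dg.A"
  then show "\<delta>0 (x \<oplus>\<^bsub>dg.A\<^esub> y) = \<delta>0 x \<oplus>\<^bsub>dg.A\<^esub> \<delta>0 y"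
    by (auto simp: dg.cl_carrier dg.cl_simps \<delta>0_cl D_in der_linear Fr_fs[of _ "dg_gens d"])
next
  fix c x assume "x \<in> carrier dg.A"
  then show "\<delta>0 (c \<odot>\<^bsub>dg.A\<^esub> x) = c \<odot>\<^bsub>dg.A\<^esub> \<delta>0 x"
    by (auto simp: dg.cl_carrier dg.cl_smult \<delta>0_cl D_in der_linear)
next
  fix x assume "x \<in> subalg_generated dg.A (dg_gen d ` hecke_gens d)"
  then obtain f where f: "f \<in> FH" "x = dg.cl f" by (rule subalg_hecke)
  then show "\<delta>0 x = \<zero>\<^bsub>dg.A\<^esub>" by (simp add: \<delta>0_cl FH_FG der_hecke dg.cl_0 dg.cl_simps)
next
  show "\<delta>0 (dg_gen d GenTheta) = cyclotomic_prod dg.A (dg_gen d (GenX 1)) l Q"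
    unfolding P_cl unfolding dg_gen_cl by (simp add: \<delta>0_cl der_linear)
next
  fix n and a b :: "(hgen list \<Rightarrow> 'k) set" assume a: "a \<in> dg_part d n" and b: "b \<in> carrier dg.A"
  obtain f where f: "a = dg.cl f" "f \<in> FG" "\<And>w. f w \<noteq> 0 \<Longrightarrow> count_list w GenTheta = n"
    using a unfolding dg_part_def dg.cl_def by blast
  obtain g where g: "b = dg.cl g" "g \<in> FG" using b by (auto simp: dg.cl_carrier)
  have "fs f" "fs g" using f g by (auto intro: Fr_fs)
  then have "D (f \<star> g) = D f \<star> g + scl ((- 1) ^ n) (f \<star> D g)"
    using sgi_homogeneous[OF f(3) \<open>fs f\<close>] by (simp add: der_conv conv_distribs)
  then show "\<delta>0 (a \<otimes>\<^bsub>dg.A\<^esub> b) = \<delta>0 a \<otimes>\<^bsub>dg.A\<^esub> b \<oplus>\<^bsub>dg.A\<^esub> (- 1) ^ n \<odot>\<^bsub>dg.A\<^esub> (a \<otimes>\<^bsub>dg.A\<^esub> \<delta>0 b)"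
    using f(2) g(2) by (simp add: f(1) g(1) dg.cl_simps dg.cl_smult \<delta>0_cl D_in)
qed

text \<open>Generators are homogeneous, so the Leibniz rule can be applied with the first letter of
  a word as left factor; values on generators then determine values on words, and linearity does the
  rest.\<close>

lemma differential_unique:
  assumes "is_dg_differential d l Q \<delta>"
  shows "\<delta> = \<delta>0"
proof -
  interpret A: ring dg.A by (rule dg.ring_A)
  note d = assms[unfolded is_dg_differential_def Let_def A_eq]
  have \<delta>: "\<delta> \<in> carrier dg.A \<rightarrow>\<^sub>E carrier dg.A" using d by blast
  have dadd: "\<delta> (x \<oplus>\<^bsub>dg.A\<^esub> y) = \<delta> x \<oplus>\<^bsub>dg.A\<^esub> \<delta> y" if "x \<in> carrier dg.A" "y \<in> carrier dg.A" for x y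
    using d that by blast
  have sm: "\<delta> (c \<odot>\<^bsub>dg.A\<^esub> x) = c \<odot>\<^bsub>dg.A\<^esub> \<delta> x" if "x \<in> carrier dg.A" for c x
    using d that by blast
  have sub: "\<delta> x = \<zero>\<^bsub>dg.A\<^esub>" if "x \<in> subalg_generated dg.A (dg_gen d ` hecke_gens d)" for x
    using d that by blast
  have th: "\<delta> (dg.cl (dlt [GenTheta])) = dg.cl P"
    using d unfolding P_cl unfolding dg_gen_cl by blast
  have leib: "\<delta> (a \<otimes>\<^bsub>dg.A\<^esub> b) = \<delta> a \<otimes>\<^bsub>dg.A\<^esub> b \<oplus>\<^bsub>dg.A\<^esub> (- 1) ^ n \<odot>\<^bsub>dg.A\<^esub> (a \<otimes>\<^bsub>dg.A\<^esub> \<delta> b)"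
    if "a \<in> dg_part d n" "b \<in> carrier dg.A" for a b n using d that by blast
  have one: "\<delta> (dg.cl (dlt [])) = dg.cl 0"
  proof -
    have "\<one>\<^bsub>dg.A\<^esub> \<in> subalg_generated dg.A (dg_gen d ` hecke_gens d)"
      unfolding subalg_generated_def using subringE(3) by blast
    from sub[OF this] show ?thesis by (simp add: dg.cl_simps dg.cl_0)
  qed
  have gen: "\<delta> (dg.cl (dlt [g])) = dg.cl 0" if "g \<in> hecke_gens d" for g
  proof -
    have "dg_gen d g \<in> subalg_generated dg.A (dg_gen d ` hecke_gens d)"
      unfolding subalg_generated_def using that by blast
    from sub[OF this] show ?thesis by (simp add: dg_gen_cl dg.cl_simps dg.cl_0)
  qed
  have part: "dg.cl (dlt [g]) \<in> dg_part d (count_list [g] GenTheta)" if "g \<in> dg_gens d" for g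
  proof -
    have "dlt [g] \<in> FG" using that by simp
    moreover have "\<forall>w. dlt [g] w \<noteq> (0 :: 'k) \<longrightarrow> count_list w GenTheta = count_list [g] GenTheta"
      by (simp add: dlt_def)
    ultimately show ?thesis unfolding dg_part_def dg.cl_def by blast
  qed
  have word: "\<delta> (dg.cl (dlt w)) = dg.cl (derw P w)" if "w \<in> lists (dg_gens d)" for w
    using that
  proof (induction w)
    case (Cons g w)
    then have w: "w \<in> lists (dg_gens d)" and g: "g \<in> dg_gens d" by auto
    have dw: "derw P w \<in> FG" using derw_Fr[OF P_FG w] .
    have "\<delta> (dg.cl (dlt (g # w))) = \<delta> (dg.cl (dlt [g]) \<otimes>\<^bsub>dg.A\<^esub> dg.cl (dlt w))"
      using w g by (simp add: dg.cl_simps)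
    also have "\<dots> = \<delta> (dg.cl (dlt [g])) \<otimes>\<^bsub>dg.A\<^esub> dg.cl (dlt w) \<oplus>\<^bsub>dg.A\<^esub>
        (- 1) ^ count_list [g] GenTheta \<odot>\<^bsub>dg.A\<^esub> (dg.cl (dlt [g]) \<otimes>\<^bsub>dg.A\<^esub> dg.cl (derw P w))"
      using leib[OF part[OF g], of "dg.cl (dlt w)"] w Cons.IH by (simp add: dg.cl_in)
    also have "\<dots> = dg.cl (derw P (g # w))"
    proof (cases "g = GenTheta")
      case True
      then show ?thesis using w g dw
        by (simp add: th dg.cl_simps dg.cl_smult scl_distribs)
    next
      case False
      then have "g \<in> hecke_gens d" using g by (simp add: dg_gens_def)
      then show ?thesis using gen w g dw False
        by (cases g) (simp_all add: dg.cl_simps dg.cl_smult del: conv_dlt_dlt)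
    qed
    finally show ?case .
  qed (simp add: one)
  have all: "\<delta> (dg.cl f) = dg.cl (D f)" if f: "f \<in> FG" for f
    using Fr_fs[OF f]
  proof (induction rule: fs_induct)
    case zero
    \<comment> \<open>Additivity and scaling are known only as algebra operations, so the value at
      zero is found by scaling with 0.\<close>
    have "\<delta> (0 \<odot>\<^bsub>dg.A\<^esub> dg.cl 0) = 0 \<odot>\<^bsub>dg.A\<^esub> \<delta> (dg.cl 0)" by (rule sm) (simp add: dg.cl_in)
    moreover have "\<delta> (dg.cl 0) \<in> carrier dg.A" using \<delta> by (auto simp: dg.cl_in)
    then obtain g where "g \<in> FG" "\<delta> (dg.cl 0) = dg.cl g" by (auto simp: dg.cl_carrier)
    ultimately show ?case by (simp add: dg.cl_smult der_linear)
  next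
    case (add g w c)
    have w: "w \<in> lists (dg_gens d)" and g: "g \<in> FG" using add(1-3) f by (auto simp: Fr_iff)
    have dw: "derw P w \<in> FG" using derw_Fr[OF P_FG w] .
    have "\<delta> (dg.cl (scl c (dlt w) + g)) = \<delta> (c \<odot>\<^bsub>dg.A\<^esub> dg.cl (dlt w) \<oplus>\<^bsub>dg.A\<^esub> dg.cl g)"
      using w g by (simp add: dg.cl_simps dg.cl_smult)
    also have "\<dots> = c \<odot>\<^bsub>dg.A\<^esub> \<delta> (dg.cl (dlt w)) \<oplus>\<^bsub>dg.A\<^esub> \<delta> (dg.cl g)"
      using w g dadd[of "c \<odot>\<^bsub>dg.A\<^esub> dg.cl (dlt w)" "dg.cl g"] sm[of "dg.cl (dlt w)" c]
      by (simp add: dg.cl_in dg.cl_smult)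
    also have "\<dots> = dg.cl (D (scl c (dlt w) + g))"
      using w g dw add(1) add.IH word[OF w] by (simp add: dg.cl_simps dg.cl_smult der_linear D_in)
    finally show ?case .
  qed
  show ?thesis
  proof
    fix C show "\<delta> C = \<delta>0 C"
    proof (cases "C \<in> carrier dg.A")
      case True
      then show ?thesis using all by (auto simp: dg.cl_carrier \<delta>0_cl)
    next
      case False
      then show ?thesis using PiE_arb[OF \<delta>] by (simp add: \<delta>0_def)
    qed
  qed
qed

lemma dg_differential_eq: "dg_differential d l Q = \<delta>0"
  unfolding dg_differential_def using \<delta>0_differential differential_unique by (rule the_equality)

section \<open>The homology\<close>

text \<open>D lowers the number of \<theta> by one, so the degree 0 part of D f is D of the degree 1
  part of f.\<close>

lemma rth_D: "f \<in> FG \<Longrightarrow> \<exists>y\<in>FG. rth (D f) = D y"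
proof -
  assume f: "f \<in> FG"
  have w: "w \<in> lists (dg_gens d) \<Longrightarrow> \<exists>y\<in>FG. rth (derw P w) = D y" for w
  proof (induction w)
    case Nil
    show ?case by (intro bexI[of _ 0]) (auto simp: rth_linear der_linear)
  next
    case (Cons g w)
    then obtain y where y: "y \<in> FG" "rth (derw P w) = D y" by auto
    show ?case
    proof (cases "g = GenTheta")
      case True
      have "rth (derw P (g # w)) = P \<star> rth (dlt w)"
        using True rth_hecke[OF P_FH] by (simp add: rth_linear rth_conv)
      also have "\<dots> = D (dlt [GenTheta] \<star> rth (dlt w))"
        by (auto simp: rth_linear der_linear derw_hecke)
      finally have "rth (derw P (g # w)) = D (dlt [GenTheta] \<star> rth (dlt w))" .
      moreover have "dlt [GenTheta] \<star> rth (dlt w) \<in> FG" using Cons.prems by (auto simp: rth_linear)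
      ultimately show ?thesis by blast
    next
      case False
      then have g: "g \<in> hecke_gens d" using Cons.prems by (auto simp: dg_gens_def)
      have "rth (derw P (g # w)) = dlt [g] \<star> D y"
        using False y(2) by (cases g) (simp_all add: rth_linear rth_conv)
      also have "\<dots> = D (dlt [g] \<star> y)"
        using g y(1) by (cases g) (simp_all add: der_conv der_linear sgi_linear Fr_fs[OF y(1)])
      finally show ?thesis using Cons.prems y(1) by auto
    qed
  qed
  show ?thesis using Fr_fs[OF f]
  proof (induction rule: fs_induct)
    case zero
    show ?case by (intro bexI[of _ 0]) (auto simp: rth_linear der_linear)
  next
    case (add g u c)
    then obtain y where y: "y \<in> FG" "rth (D g) = D y" by blast
    have "u \<in> lists (dg_gens d)" using add f by (auto simp: Fr_iff)
    then obtain y' where y': "y' \<in> FG" "rth (derw P u) = D y'" using w by blast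
    have "rth (D (scl c (dlt u) + g)) = D (scl c y' + y)"
      using add y y' by (simp add: der_linear rth_linear Fr_fs[OF y(1)] Fr_fs[OF y'(1)])
    then show ?case using y y' by (intro bexI[of _ "scl c y' + y"]) auto
  qed
qed

text \<open>A cycle of positive degree has no \<theta>-free part. Setting \<theta> = 0 in its
  decomposition as D y + h therefore shows that h is itself a boundary modulo the ideal.\<close>

lemma homology_part_zero:
  assumes "n \<noteq> 0" "f \<in> FG" "\<And>w. f w \<noteq> 0 \<Longrightarrow> count_list w GenTheta = n" "D f \<in> I"
  shows "\<exists>y\<in>FG. f - D y \<in> I"
proof -
  obtain y h where yh: "y \<in> FG" "h \<in> FH" "f - D y - h \<in> I" using cycle_decomposition[OF assms(2,4)] .
  obtain y' where y': "y' \<in> FG" "rth (D y) = D y'" using rth_D[OF yh(1)] by blast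
  have "f w = 0" if "GenTheta \<notin> set w" for w
  proof (rule ccontr)
    assume "f w \<noteq> 0"
    then show False using assms(1,3) that by (metis count_list_0_iff)
  qed
  then have "rth f = 0" by (auto simp: rth_def fun_eq_iff zero_fun_apply)
  then have "rth (f - D y - h) = - D y' - h"
    using y' rth_hecke[OF yh(2)] by (simp add: rth_linear)
  then have "- D y' - h \<in> I" using affine_ideal_sub[OF rth_ideal[OF yh(3)]] by simp
  from I_D(5)[OF yh(3) this] have "f - D (y - y') \<in> I"
    using Fr_fs[OF yh(1)] Fr_fs[OF y'(1)] by (simp add: der_linear algebra_simps)
  then show ?thesis using yh y' by (intro bexI[of _ "y - y'"]) auto
qed

section \<open>Comparison with the cyclotomic quotient\<close>

definition Kc :: "(hgen list \<Rightarrow> 'k) set set" where "Kc = Idl\<^bsub>aff.A\<^esub> {aff.cl P}"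

abbreviation cyc :: "('k, (hgen list \<Rightarrow> 'k) set set) module" where "cyc \<equiv> alg_quot aff.A Kc"

lemma cyc_eq: "cyclotomic_hecke d l Q = cyc"
proof -
  have "affine_gen d (GenX 1) = aff.cl (dlt [GenX 1])"
    by (simp add: affine_gen_def aff.cl_def free_gen_dlt)
  moreover have "cyclotomic_prod aff.A (aff.cl (dlt [GenX 1])) l Q = aff.cl P"
    unfolding P_def by (rule aff.cl_cyclotomic_prod) (use d1 in simp)
  ultimately show ?thesis by (simp add: cyclotomic_hecke_def affine_hecke_def Kc_def)
qed

lemma ideal_Kc: "ideal Kc aff.A"
  unfolding Kc_def using P_FH by (intro ring.genideal_ideal aff.ring_A) (auto simp: aff.cl_in)

lemma aff_P_Kc: "aff.cl P \<in> Kc"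
  unfolding Kc_def using P_FH by (intro ring.genideal_self' aff.ring_A) (auto simp: aff.cl_in)

lemmas pre_D = ideal_free_algD[OF aff.ideal_preimage[OF ideal_Kc]]

text \<open>A \<theta>-free term arises only when a single \<theta> is replaced by P, which leaves a
  two-sided multiple of P.\<close>

lemma rth_D_Kc:
  assumes f: "f \<in> FG" shows "aff.cl (rth (D f)) \<in> Kc"
proof -
  let ?K = "{h \<in> FH. aff.cl h \<in> Kc}"
  have w: "w \<in> lists (dg_gens d) \<Longrightarrow> rth (derw P w) \<in> ?K" for w
  proof (induction w)
    case Nil
    show ?case using pre_D(2) by (simp add: rth_linear)
  next
    case (Cons g w)
    then have IH: "rth (derw P w) \<in> ?K" by simp
    have w: "rth (dlt w) \<in> FH" using Cons.prems by (intro rth_Fr) auto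
    show ?case
    proof (cases "g = GenTheta")
      case True
      then have "rth (derw P (g # w)) = P \<star> rth (dlt w)"
        using rth_hecke[OF P_FH] by (simp add: rth_linear rth_conv)
      then show ?thesis using pre_D(8)[OF _ w, of P] aff_P_Kc P_FH by simp
    next
      case False
      then have g: "dlt [g] \<in> FH" using Cons.prems by (auto simp: dg_gens_def)
      have "rth (derw P (g # w)) = dlt [g] \<star> rth (derw P w)"
        using False by (cases g) (simp_all add: rth_linear rth_conv)
      then show ?thesis using pre_D(7)[OF IH g] by simp
    qed
  qed
  have "rth (D f) \<in> ?K" using Fr_fs[OF f]
  proof (induction rule: fs_induct)
    case zero
    show ?case using pre_D(2) by (simp add: rth_linear der_linear)
  next
    case (add g u c)
    have "u \<in> lists (dg_gens d)" using add f by (auto simp: Fr_iff)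
    from pre_D(3)[OF pre_D(6)[OF w[OF this]] add.IH] show ?case
      using add(1) by (simp add: der_linear rth_linear)
  qed
  then show ?thesis by simp
qed

text \<open>Multiplication by \<theta>-free elements on either side commutes with D, so the
  \<theta>-free elements that are boundaries modulo I form an ideal; it contains P =
  D(\<theta>).\<close>

lemma Kc_boundary:
  assumes "h \<in> FH" "aff.cl h \<in> Kc"
  shows "\<exists>y\<in>FG. h - D y \<in> I"
proof -
  let ?E = "{h \<in> FH. \<exists>y\<in>FG. h - D y \<in> I}"
  have "ideal ?E (free_alg (hecke_gens d))"
  proof (rule ideal_free_algI, goal_cases)
    case 2
    show ?case by (auto simp: der_linear I_D(2) intro!: bexI[of _ 0])
  next
    case (3 f g)
    then obtain y y' where y: "y \<in> FG" "y' \<in> FG" "f - D y \<in> I" "g - D y' \<in> I" by auto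
    have "(f + g) - D (y + y') = (f - D y) + (g - D y')"
      using y by (simp add: der_linear Fr_fs[of _ "dg_gens d"])
    then have "(f + g) - D (y + y') \<in> I" using I_D(3)[OF y(3,4)] by metis
    then show ?case by (intro CollectI conjI bexI[of _ "y + y'"]) (use 3 y in auto)
  next
    case (4 f)
    then obtain y where y: "y \<in> FG" "f - D y \<in> I" by auto
    then show ?case using 4 I_D(4)[OF y(2)] by (auto simp: der_linear intro!: bexI[of _ "- y"])
  next
    case (5 f g)
    then obtain y where y: "y \<in> FG" "f - D y \<in> I" by auto
    have "g \<star> f - D (g \<star> y) = g \<star> (f - D y)"
      using 5 y by (simp add: der_conv der_hecke sgi_hecke conv_distribs Fr_fs[of _ "dg_gens d"] FH_FG)
    then show ?case using 5 y I_D(7)[OF y(2), of g] by (auto simp: FH_FG intro!: bexI[of _ "g \<star> y"])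
  next
    case (6 f g)
    then obtain y where y: "y \<in> FG" "f - D y \<in> I" by auto
    have "f \<star> g - D (y \<star> g) = (f - D y) \<star> g"
      using 6 y by (simp add: der_conv der_hecke conv_distribs Fr_fs[of _ "dg_gens d"] FH_FG)
    then show ?case using 6 y I_D(8)[OF y(2), of g] by (auto simp: FH_FG intro!: bexI[of _ "y \<star> g"])
  qed auto
  then have "ideal (aff.cl ` ?E) aff.A" by (rule aff.ideal_image)
  moreover have "P \<in> ?E"
    using P_FH by (auto simp: der_linear I_D(2) intro!: bexI[of _ "dlt [GenTheta]"])
  ultimately have "Kc \<subseteq> aff.cl ` ?E"
    unfolding Kc_def by (intro ring.genideal_minimal aff.ring_A) auto
  then obtain h' y where h': "h' \<in> FH" "y \<in> FG" "h' - D y \<in> I" "aff.cl h = aff.cl h'"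
    using assms(2) by blast
  then have "h - h' \<in> I" using assms(1) by (intro affine_ideal_sub) (simp add: aff.cl_eq_iff)
  from I_D(3)[OF this h'(3)] show ?thesis using h'(2) by auto
qed

definition toCyc :: "(hgen list \<Rightarrow> 'k) set \<Rightarrow> (hgen list \<Rightarrow> 'k) set set" where
  "toCyc C = Kc +>\<^bsub>aff.A\<^esub> aff.cl (rth (SOME f. f \<in> C))"

lemma toCyc_cl: 
  assumes "f \<in> FG" shows "toCyc (dg.cl f) = Kc +>\<^bsub>aff.A\<^esub> aff.cl (rth f)"
proof -
  let ?g = "SOME g. g \<in> dg.cl f"
  have "?g \<in> dg.cl f" using dg.cl_self[OF assms] by (rule someI[of "\<lambda>g. g \<in> dg.cl f"])
  then have g: "?g \<in> FG" "?g - f \<in> I" using dg.cl_mem[OF assms] by auto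
  then have "aff.cl (rth ?g) = aff.cl (rth f)"
    using rth_ideal[OF g(2)] assms by (simp add: aff.cl_eq_iff rth_Fr rth_linear)
  then show ?thesis by (simp add: toCyc_def)
qed

text \<open>Injectivity on homology: write the cycle as D y + h with h free of \<theta>. As
  \<open>rth (D y)\<close> always lies in the cyclotomic ideal, vanishing of the image puts h there,
  and \<open>Kc_boundary\<close> makes h a boundary.\<close>

lemma toCyc_zero_iff:
  assumes "f \<in> FG" "D f \<in> I"
  shows "toCyc (dg.cl f) = Kc \<longleftrightarrow> (\<exists>y\<in>FG. f - D y \<in> I)"
proof -
  let ?K = "{h \<in> FH. aff.cl h \<in> Kc}"
  have rK: "rth (D y) \<in> ?K" if "y \<in> FG" for y using rth_D_Kc[OF that] rth_Fr[OF D_in[OF that]] by simp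
  have aK: "g \<in> ?K" if "g \<in> affine_ideal d" for g
  proof -
    have g: "g \<in> FH" using ideal_free_algD(1)[OF ideal_affine that] .
    then have "aff.cl g = aff.cl 0" using that by (simp add: aff.cl_eq_iff)
    then show ?thesis using g pre_D(2) by simp
  qed
  have "toCyc (dg.cl f) = Kc \<longleftrightarrow> rth f \<in> ?K"
    using assms rth_Fr[OF assms(1)] by (simp add: toCyc_cl alg_quot_zero_iff[OF ideal_Kc] aff.cl_in)
  also have "\<dots> \<longleftrightarrow> (\<exists>y\<in>FG. f - D y \<in> I)"
  proof
    assume r: "rth f \<in> ?K"
    obtain y h where yh: "y \<in> FG" "h \<in> FH" "f - D y - h \<in> I" using cycle_decomposition[OF assms] .
    have "rth (f - D y - h) \<in> ?K" by (rule aK[OF rth_ideal[OF yh(3)]])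
    then have "rth f - rth (D y) - h \<in> ?K" using rth_hecke[OF yh(2)] by (simp only: rth_linear)
    from pre_D(5)[OF pre_D(5)[OF r rK[OF yh(1)]] this] have "aff.cl h \<in> Kc" by simp
    then obtain y' where y': "y' \<in> FG" "h - D y' \<in> I" using Kc_boundary yh(2) by blast
    have "f - D (y + y') = (f - D y - h) + (h - D y')"
      using yh(1) y'(1) by (simp add: der_linear Fr_fs[of _ "dg_gens d"])
    then have "f - D (y + y') \<in> I" using I_D(3)[OF yh(3) y'(2)] by metis
    moreover have "y + y' \<in> FG" using yh(1) y'(1) by simp
    ultimately show "\<exists>y\<in>FG. f - D y \<in> I" by blast
  next
    assume "\<exists>y\<in>FG. f - D y \<in> I"
    then obtain y where y: "y \<in> FG" "f - D y \<in> I" by blast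
    from pre_D(3)[OF aK[OF rth_ideal[OF y(2)]] rK[OF y(1)]] show "rth f \<in> ?K"
      by (simp add: rth_linear)
  qed
  finally show ?thesis .
qed

definition cycles :: "(hgen list \<Rightarrow> 'k) set set" where
  "cycles = {x \<in> carrier dg.A. \<delta>0 x = \<zero>\<^bsub>dg.A\<^esub>}"

definition bounds :: "(hgen list \<Rightarrow> 'k) set set" where
  "bounds = \<delta>0 ` carrier dg.A"

abbreviation cycle_alg :: "('k, (hgen list \<Rightarrow> 'k) set) module" where
  "cycle_alg \<equiv> dg.A\<lparr>carrier := cycles\<rparr>"

lemma cycles_eq: "cycles = dg.cl ` {f \<in> FG. D f \<in> I}"
proof -
  have "\<delta>0 (dg.cl f) = \<zero>\<^bsub>dg.A\<^esub> \<longleftrightarrow> D f \<in> I" if "f \<in> FG" for f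
    using that by (simp add: \<delta>0_cl dg.cl_simps dg.cl_zero_iff D_in)
  then show ?thesis unfolding cycles_def dg.cl_carrier by blast
qed

lemma bounds_eq: "bounds = dg.cl ` D ` FG"
  by (auto simp: bounds_def dg.cl_carrier \<delta>0_cl image_iff)

lemma ring_cycle_alg: "ring cycle_alg"
proof -
  interpret A: ring dg.A by (rule dg.ring_A)
  have "subring cycles dg.A"
  proof (rule A.subringI)
    fix x y assume "x \<in> cycles" "y \<in> cycles"
    then obtain f g where f: "f \<in> FG" "D f \<in> I" "x = dg.cl f" and g: "g \<in> FG" "D g \<in> I" "y = dg.cl g"
      by (auto simp: cycles_eq)
    have "D (f \<star> g) \<in> I" "D (f + g) \<in> I"
      using I_D(3)[OF I_D(8)[OF f(2) g(1)] I_D(7)[OF g(2) sgi_Fr[OF f(1)]]] I_D(3)[OF f(2) g(2)]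
        Fr_fs[OF f(1)] Fr_fs[OF g(1)] by (simp_all add: der_conv der_linear)
    then show "x \<otimes>\<^bsub>dg.A\<^esub> y \<in> cycles" "x \<oplus>\<^bsub>dg.A\<^esub> y \<in> cycles"
      using f g by (auto simp: cycles_eq dg.cl_simps)
  qed (auto simp: cycles_eq dg.cl_in dg.cl_simps dg.cl_uminus der_linear I_D)
  then show ?thesis by (rule A.subring_is_ring)
qed

lemma toCyc_hom: "ring_hom_ring cycle_alg cyc toCyc"
proof (rule ring_hom_ringI[OF ring_cycle_alg ring_alg_quot[OF ideal_Kc]])
  note ops = alg_quot_ops[OF ideal_Kc]
  show "toCyc x \<in> carrier cyc" if "x \<in> carrier cycle_alg" for x
    using that by (auto simp: cycles_eq toCyc_cl rth_Fr aff.cl_in intro!: ops(5))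
  fix x y assume "x \<in> carrier cycle_alg" "y \<in> carrier cycle_alg"
  then obtain f g where f: "f \<in> FG" "x = dg.cl f" and g: "g \<in> FG" "y = dg.cl g"
    by (auto simp: cycles_eq)
  show "toCyc (x \<otimes>\<^bsub>cycle_alg\<^esub> y) = toCyc x \<otimes>\<^bsub>cyc\<^esub> toCyc y"
    using f g by (simp add: dg.cl_simps toCyc_cl ops aff.cl_in rth_Fr aff.cl_simps rth_conv)
  show "toCyc (x \<oplus>\<^bsub>cycle_alg\<^esub> y) = toCyc x \<oplus>\<^bsub>cyc\<^esub> toCyc y"
    using f g by (simp add: dg.cl_simps toCyc_cl ops aff.cl_in rth_Fr aff.cl_simps rth_linear)
next
  show "toCyc \<one>\<^bsub>cycle_alg\<^esub> = \<one>\<^bsub>cyc\<^esub>"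
    using alg_quot_ops(3)[OF ideal_Kc] by (simp add: dg.cl_simps toCyc_cl rth_linear aff.cl_simps)
qed

lemma toCyc_surj: "toCyc ` carrier cycle_alg = carrier cyc"
proof
  show "carrier cyc \<subseteq> toCyc ` carrier cycle_alg"
  proof
    fix X assume "X \<in> carrier cyc"
    then obtain h where h: "h \<in> FH" "X = Kc +>\<^bsub>aff.A\<^esub> aff.cl h"
      by (auto simp: alg_quot_carrier[of aff.A] aff.cl_carrier)
    then have "X = toCyc (dg.cl h)" by (simp add: toCyc_cl FH_FG rth_hecke)
    moreover have "dg.cl h \<in> cycles" using h(1) by (auto simp: cycles_eq FH_FG der_hecke I_D(2))
    ultimately show "X \<in> toCyc ` carrier cycle_alg" by auto
  qed
qed (use ring_hom_ring.homh[OF toCyc_hom] in \<open>auto simp: ring_hom_def\<close>)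

lemma toCyc_kernel: "a_kernel cycle_alg cyc toCyc = bounds"
proof -
  have "x \<in> a_kernel cycle_alg cyc toCyc \<longleftrightarrow> x \<in> bounds" for x
  proof
    assume "x \<in> a_kernel cycle_alg cyc toCyc"
    then obtain f where f: "f \<in> FG" "D f \<in> I" "x = dg.cl f" "toCyc x = Kc"
      by (auto simp: a_kernel_def' cycles_eq alg_quot_ops(4)[OF ideal_Kc])
    then obtain y where "y \<in> FG" "f - D y \<in> I" using toCyc_zero_iff by blast
    then have "x = dg.cl (D y)" using f by (simp add: dg.cl_eq_iff D_in)
    then show "x \<in> bounds" using \<open>y \<in> FG\<close> by (auto simp: bounds_eq)
  next
    assume "x \<in> bounds"
    then obtain y where y: "y \<in> FG" "x = dg.cl (D y)" by (auto simp: bounds_eq)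
    have "D (D y) = 0" using y(1) P_FH by (intro der_der) (auto intro: Fr_fs)
    then have "D (D y) \<in> I" by (simp add: I_D(2))
    moreover have "\<exists>z\<in>FG. D y - D z \<in> I" using y(1) I_D(2) by (intro bexI[of _ y]) auto
    ultimately show "x \<in> a_kernel cycle_alg cyc toCyc"
      using y toCyc_zero_iff[of "D y"]
      by (auto simp: a_kernel_def' cycles_eq alg_quot_ops(4)[OF ideal_Kc] D_in)
  qed
  then show ?thesis by blast
qed

lemma ideal_bounds: "ideal bounds cycle_alg"
  using ring_hom_ring.kernel_is_ideal[OF toCyc_hom] by (simp add: toCyc_kernel)

lemma homology_alg_eq: "homology_alg (dg_hecke d) (dg_differential d l Q) = alg_quot cycle_alg bounds"
  by (simp add: homology_alg_def A_eq dg_differential_eq cycles_def bounds_def)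

text \<open>Bridges two ambient rings: \<open>homology_part\<close> takes cosets in the whole
  algebra, \<open>homology_alg\<close> in the subalgebra of cycles.\<close>

lemma bounds_coset: "bounds +>\<^bsub>dg.A\<^esub> x = bounds +>\<^bsub>cycle_alg\<^esub> x"
  by (simp add: a_r_coset_def')

lemma homology_parts:
  assumes "n \<noteq> 0"
  shows "homology_part (dg_hecke d) (dg_differential d l Q) (dg_part d) n =
     {\<zero>\<^bsub>homology_alg (dg_hecke d) (dg_differential d l Q)\<^esub>}"
proof -
  have "bounds +>\<^bsub>dg.A\<^esub> x = bounds" if x: "x \<in> dg_part d n" "\<delta>0 x = \<zero>\<^bsub>dg.A\<^esub>" for x
  proof -
    obtain f where f: "x = dg.cl f" "f \<in> FG" "\<And>w. f w \<noteq> 0 \<Longrightarrow> count_list w GenTheta = n"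
      using x(1) unfolding dg_part_def dg.cl_def by blast
    have "D f \<in> I" using x(2) f(2) by (simp add: f(1) \<delta>0_cl dg.cl_simps dg.cl_zero_iff D_in)
    then obtain y where "y \<in> FG" "f - D y \<in> I" using homology_part_zero[OF assms f(2,3)] by blast
    then have "x = dg.cl (D y)" using f by (simp add: dg.cl_eq_iff D_in)
    then have "x \<in> bounds" using \<open>y \<in> FG\<close> by (auto simp: bounds_eq)
    moreover have "x \<in> carrier cycle_alg" using f \<open>D f \<in> I\<close> by (auto simp: cycles_eq)
    ultimately show ?thesis unfolding bounds_coset using alg_quot_zero_iff[OF ideal_bounds] by blast
  qed
  \<comment> \<open>Zero is homogeneous of every degree, so the set of classes is nonempty and
    equals the singleton.\<close>
  moreover have "dg.cl 0 \<in> dg_part d n" unfolding dg_part_def dg.cl_def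
    by (intro CollectI exI[of _ 0]) (auto simp: zero_fun_apply)
  moreover have "\<delta>0 (dg.cl 0) = \<zero>\<^bsub>dg.A\<^esub>" using \<delta>0_cl[of 0] by (simp add: der_linear dg.cl_0 dg.cl_simps)
  ultimately have "{bounds +>\<^bsub>dg.A\<^esub> x | x. x \<in> dg_part d n \<and> \<delta>0 x = \<zero>\<^bsub>dg.A\<^esub>} = {bounds}" by blast
  then show ?thesis
    unfolding homology_alg_eq alg_quot_ops(4)[OF ideal_bounds]
    by (simp add: homology_part_def A_eq dg_differential_eq bounds_def)
qed

lemma smult_cyc:
  assumes "u \<in> carrier aff.A"
  shows "c \<odot>\<^bsub>cyc\<^esub> (Kc +>\<^bsub>aff.A\<^esub> u) = Kc +>\<^bsub>aff.A\<^esub> (c \<odot>\<^bsub>aff.A\<^esub> u)"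
proof (rule alg_quot_smult[OF ideal_Kc assms])
  fix y assume y: "y \<in> Kc"
  then have "y \<in> carrier aff.A" using ideal.Icarr[OF ideal_Kc] by blast
  then obtain h where "h \<in> FH" "y = aff.cl h" by (auto simp: aff.cl_carrier)
  then show "c \<odot>\<^bsub>aff.A\<^esub> y \<in> Kc" using pre_D(6)[of h c] y by (simp add: aff.cl_smult)
qed (auto simp: aff.cl_carrier aff.cl_smult aff.cl_simps scl_distribs)

lemma smult_homology:
  assumes "x \<in> cycles"
  shows "c \<odot>\<^bsub>alg_quot cycle_alg bounds\<^esub> (bounds +>\<^bsub>cycle_alg\<^esub> x) = bounds +>\<^bsub>cycle_alg\<^esub> (c \<odot>\<^bsub>dg.A\<^esub> x)"
    "c \<odot>\<^bsub>dg.A\<^esub> x \<in> cycles"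
proof -
  have cyc: "c \<odot>\<^bsub>dg.A\<^esub> x \<in> cycles" if "x \<in> cycles" for x
    using that by (auto simp: cycles_eq dg.cl_smult der_linear intro!: imageI I_D(6))
  show "c \<odot>\<^bsub>dg.A\<^esub> x \<in> cycles" by (rule cyc[OF assms])
  have b: "c \<odot>\<^bsub>dg.A\<^esub> y \<in> bounds" if "y \<in> bounds" for y
    using that by (auto simp: bounds_eq dg.cl_smult D_in image_iff simp flip: der_linear(3))
  have add: "c \<odot>\<^bsub>dg.A\<^esub> (y \<oplus>\<^bsub>dg.A\<^esub> z) = c \<odot>\<^bsub>dg.A\<^esub> y \<oplus>\<^bsub>dg.A\<^esub> c \<odot>\<^bsub>dg.A\<^esub> z"
    if "y \<in> cycles" "z \<in> cycles" for y z
    using that by (auto simp: cycles_eq dg.cl_smult dg.cl_simps scl_distribs)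
  have "c \<odot>\<^bsub>alg_quot cycle_alg bounds\<^esub> (bounds +>\<^bsub>cycle_alg\<^esub> x) = bounds +>\<^bsub>cycle_alg\<^esub> (c \<odot>\<^bsub>cycle_alg\<^esub> x)"
    by (rule alg_quot_smult[OF ideal_bounds]) (use assms cyc b add in simp_all)
  then show "c \<odot>\<^bsub>alg_quot cycle_alg bounds\<^esub> (bounds +>\<^bsub>cycle_alg\<^esub> x) = bounds +>\<^bsub>cycle_alg\<^esub> (c \<odot>\<^bsub>dg.A\<^esub> x)"
    by simp
qed

text \<open>The first isomorphism theorem for \<open>toCyc\<close> on the ring of cycles, whose
  kernel is the boundaries; compatibility with scalars is checked on cosets.\<close>

lemma homology_iso:
  "alg_iso (homology_alg (dg_hecke d) (dg_differential d l Q)) (cyclotomic_hecke d l Q) \<noteq> {}"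
proof -
  interpret h: ring_hom_ring cycle_alg cyc toCyc by (rule toCyc_hom)
  let ?\<Phi> = "\<lambda>X. the_elem (toCyc ` X)"
  have \<Phi>: "?\<Phi> (bounds +>\<^bsub>cycle_alg\<^esub> x) = toCyc x" if "x \<in> cycles" for x
    using h.the_elem_simp[of x] that by (simp add: toCyc_kernel)
  have "?\<Phi> \<in> ring_iso (cycle_alg Quot bounds) cyc"
    using h.FactRing_iso_set[OF toCyc_surj] by (simp add: toCyc_kernel)
  then have iso: "?\<Phi> \<in> ring_iso (alg_quot cycle_alg bounds) cyc"
    unfolding ring_iso_def ring_hom_def alg_quot_simps[of cycle_alg bounds] by simp
  have "?\<Phi> (c \<odot>\<^bsub>alg_quot cycle_alg bounds\<^esub> X) = c \<odot>\<^bsub>cyc\<^esub> ?\<Phi> X"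
    if X: "X \<in> carrier (alg_quot cycle_alg bounds)" for c X
  proof -
    obtain x where x: "x \<in> cycles" "X = bounds +>\<^bsub>cycle_alg\<^esub> x"
      using X unfolding alg_quot_carrier by auto
    obtain f where f: "f \<in> FG" "x = dg.cl f" using x(1) by (auto simp: cycles_eq)
    have "?\<Phi> (c \<odot>\<^bsub>alg_quot cycle_alg bounds\<^esub> X) = toCyc (c \<odot>\<^bsub>dg.A\<^esub> x)"
      unfolding x(2) smult_homology(1)[OF x(1)] by (rule \<Phi>[OF smult_homology(2)[OF x(1)]])
    also have "\<dots> = c \<odot>\<^bsub>cyc\<^esub> toCyc x"
      using f by (simp add: dg.cl_smult toCyc_cl smult_cyc aff.cl_in aff.cl_smult rth_Fr rth_linear)
    finally show ?thesis using \<Phi>[OF x(1)] x(2) by simp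
  qed
  then have "?\<Phi> \<in> alg_iso (alg_quot cycle_alg bounds) cyc"
    using iso unfolding alg_iso_def by blast
  then show ?thesis unfolding homology_alg_eq cyc_eq by blast
qed

end

theorem proposition4p17:
  fixes d l :: nat and Q :: "nat \<Rightarrow> 'k::alg_closed_field"
  assumes "d \<ge> 1" and "l \<ge> 1"
  defines "A \<equiv> dg_hecke d" and "\<delta> \<equiv> dg_differential d l Q"
  shows "(\<forall>n. n \<noteq> 0 \<longrightarrow> homology_part A \<delta> (dg_part d) n = {\<zero>\<^bsub>homology_alg A \<delta>\<^esub>}) \<and>
    alg_iso (homology_alg A \<delta>) (cyclotomic_hecke d l Q) \<noteq> {}"
proof -
  interpret dg_setting d l Q by unfold_locales (use assms in auto)
  show ?thesis unfolding A_def \<delta>_def using homology_parts homology_iso by blast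
qed

end
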